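(* Let $\mu_1,\mu_2,\lambda,\tau>0$, $p\in(0,1)$ and $\tilde t\in(0,\tau)$. Consider the policy under which in condition $2$ nothing is done, and in condition $1$ preventive maintenance is performed at every scheduled opportunity and at every unscheduled opportunity for which the remaining time until the next scheduled opportunity is greater than $\tilde t$, and nothing is done otherwise. Under this policy, the long-run rate of cost per time unit equals $$\frac{c_{\mathrm{pm}}^{\mathrm{so}}\,p_1(0)+c_{\mathrm{pm}}^{\mathrm{uso}}\lambda \int_{\tilde t}^{\tau}p_1(t)\,dt + c_{\mathrm{cm}}\, \mu_1 \int_{0}^{\tau} p_1(t)\,dt}{\tau},$$ with $$p_1(t)=\begin{cases}\dfrac{\mu_2}{\mu_1+\mu_2}+C_1\,e^{(\mu_1+\mu_2)t}, & t\in[0,\tilde t),\\[2mm] \dfrac{\mu_2}{\mu_1+\mu_2+\lambda p}+C_2\,e^{(\mu_1+\mu_2+\lambda p)t}, & t\in[\tilde t,\tau),\end{cases}$$ where $$C_1=C_2\,e^{\lambda p\tilde t}-\frac{\mu_2}{\mu_1+\mu_2}\,\frac{\lambda p}{\mu_1+\mu_2+\lambda p}\,e^{-(\mu_1+\mu_2)\tilde t},$$ $$C_2=\frac{\frac{\mu_2}{\mu_1+\mu_2}\left(1-e^{-(\mu_1+\mu_2)\tilde t}\right)-\frac{\mu_2}{\mu_1+\mu_2+\lambda p}\left(\frac{1}{1-p}-e^{-(\mu_1+\mu_2)\tilde t}\right)}{\frac{1}{1-p}e^{(\mu_1+\mu_2+\lambda p)\tau}-e^{\lambda p\tilde t}}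.$$
   Context: Model. A single-unit system has condition $2$ (perfect) or $1$ (satisfactory). It spends an $\mathrm{Exp}(\mu_i)$ time in condition $i\in\{1,2\}$. From condition $2$ it moves to condition $1$; when the time in condition $1$ expires the system fails and is instantaneously replaced (corrective maintenance, cost $c_{\mathrm{cm}}$), returning to condition $2$. Scheduled opportunities (SO) for preventive maintenance occur at times $\tau,2\tau,3\tau,\dots$; unscheduled opportunities (USO) occur according to an independent Poisson process of rate $\lambda$. Preventive maintenance costs $c_{\mathrm{pm}}^{\mathrm{so}}>0$ at an SO and $c_{\mathrm{pm}}^{\mathrm{uso}}>0$ at a USO (both less than $c_{\mathrm{cm}}$). After preventive maintenance the system is "as good as new" (condition $2$) with probability $p$ and "as bad as old" (unchanged) with probability $1-p$, independently of everything else. For $t\in[0,\tau)$ and $i\in\{1,2\}$, $p_i(t)$ denotes the stationary probability that the system is in condition $i$ given that the remaining time until the next SO is $t$, where $p_i(0)$ refers to the condition found at an SO, immediately before maintenance. The stationary regime is the one in which the condition found at successive SOs has the stationary law $(p_1(0),p_2(0))$. The long-run rate of cost per time unit is the expected total cost incurred between consecutive SOs in this stationary regime, divided by $\tau$. *)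

theory Defs
  imports "HOL-Probability.Probability"
begin

datatype cond = Perfect | Satisfactory

text \<open>
  An outcome consists of: the condition at time 0; the lengths of the successive stays in
  condition 2 (\<open>Perfect\<close>) and in condition 1 (\<open>Satisfactory\<close>), as long as no preventive
  maintenance cuts them short; the gaps between successive unscheduled opportunities; and,
  for the scheduled resp. unscheduled opportunities, whether a preventive maintenance performed
  there makes the system as good as new (\<open>True\<close>) or leaves it as bad as old (\<open>False\<close>).
  All components are independent.  Opportunities and stays are numbered from 0.
\<close>

type_synonym outcome =
  "cond \<times> (nat \<Rightarrow> real) \<times> (nat \<Rightarrow> real) \<times> (nat \<Rightarrow> real) \<times> (nat \<Rightarrow> bool) \<times> (nat \<Rightarrow> bool)"

fun initial_cond :: "outcome \<Rightarrow> cond"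
  where "initial_cond (c, d2, d1, g, bso, buso) = c"
fun stay2 :: "outcome \<Rightarrow> nat \<Rightarrow> real"
  where "stay2 (c, d2, d1, g, bso, buso) = d2"
fun stay1 :: "outcome \<Rightarrow> nat \<Rightarrow> real"
  where "stay1 (c, d2, d1, g, bso, buso) = d1"
fun uso_gap :: "outcome \<Rightarrow> nat \<Rightarrow> real"
  where "uso_gap (c, d2, d1, g, bso, buso) = g"
fun so_success :: "outcome \<Rightarrow> nat \<Rightarrow> bool"
  where "so_success (c, d2, d1, g, bso, buso) = bso"
fun uso_success :: "outcome \<Rightarrow> nat \<Rightarrow> bool"
  where "uso_success (c, d2, d1, g, bso, buso) = buso"

definition exponential :: "real \<Rightarrow> real measure"
  where "exponential r = density lborel (\<lambda>x. ennreal (exponential_density r x))"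

definition model ::
  "real \<Rightarrow> real \<Rightarrow> real \<Rightarrow> real \<Rightarrow> cond pmf \<Rightarrow> outcome measure"
  where "model \<mu>1 \<mu>2 lam p init =
    measure_pmf init
      \<Otimes>\<^sub>M (\<Pi>\<^sub>M n\<in>UNIV. exponential \<mu>2)
      \<Otimes>\<^sub>M (\<Pi>\<^sub>M n\<in>UNIV. exponential \<mu>1)
      \<Otimes>\<^sub>M (\<Pi>\<^sub>M n\<in>UNIV. exponential lam)
      \<Otimes>\<^sub>M (\<Pi>\<^sub>M n\<in>UNIV. measure_pmf (bernoulli_pmf p))
      \<Otimes>\<^sub>M (\<Pi>\<^sub>M n\<in>UNIV. measure_pmf (bernoulli_pmf p))"

definition so_time :: "real \<Rightarrow> nat \<Rightarrow> real"
  where "so_time \<tau> k = real (Suc k) * \<tau>"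

definition uso_time :: "outcome \<Rightarrow> nat \<Rightarrow> real"
  where "uso_time \<omega> k = (\<Sum>j\<le>k. uso_gap \<omega> j)"

text \<open>Remaining time until the next scheduled opportunity; it is 0 at such an opportunity.\<close>

definition remaining :: "real \<Rightarrow> real \<Rightarrow> real"
  where "remaining \<tau> s = of_int \<lceil>s / \<tau>\<rceil> * \<tau> - s"

text \<open>
  The policy prescribes preventive maintenance in condition 1 at all scheduled opportunities and
  at the unscheduled ones with remaining time greater than \<open>tcut\<close>.  The following epochs are
  those at which maintenance, if the system is then found in condition 1, renews the system.
\<close>

definition renewing_epochs :: "real \<Rightarrow> real \<Rightarrow> outcome \<Rightarrow> real set"
  where "renewing_epochs \<tau> tcut \<omega> =
    {so_time \<tau> k | k. so_success \<omega> k} \<union>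
    {uso_time \<omega> k | k. tcut < remaining \<tau> (uso_time \<omega> k) \<and> uso_success \<omega> k}"

text \<open>
  The \<open>n\<close>-th stay in condition 1 begins at \<open>enter1 n\<close>.  It ends at \<open>leave1 n\<close>, either by failure,
  when its full length has elapsed, or before that by the first renewing maintenance; in both
  cases the system is then in condition 2.  Maintenance without success leaves the stay as it is.
  Almost surely the infimum is a minimum.
\<close>

definition stay1_end :: "real \<Rightarrow> real \<Rightarrow> outcome \<Rightarrow> nat \<Rightarrow> real \<Rightarrow> real"
  where "stay1_end \<tau> tcut \<omega> n u =
    Inf (insert (u + stay1 \<omega> n) {h \<in> renewing_epochs \<tau> tcut \<omega>. u \<le> h})"

primrec enter1 :: "real \<Rightarrow> real \<Rightarrow> outcome \<Rightarrow> nat \<Rightarrow> real" where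
  "enter1 \<tau> tcut \<omega> 0 = (if initial_cond \<omega> = Satisfactory then 0 else stay2 \<omega> 0)"
| "enter1 \<tau> tcut \<omega> (Suc n) =
     stay1_end \<tau> tcut \<omega> n (enter1 \<tau> tcut \<omega> n) + stay2 \<omega> (Suc n)"

definition leave1 :: "real \<Rightarrow> real \<Rightarrow> outcome \<Rightarrow> nat \<Rightarrow> real"
  where "leave1 \<tau> tcut \<omega> n = stay1_end \<tau> tcut \<omega> n (enter1 \<tau> tcut \<omega> n)"

text \<open>
  The condition found at time \<open>s\<close>, before any maintenance performed at time \<open>s\<close>: this is why the
  end of a stay in condition 1 still belongs to it.
\<close>

definition cond_at :: "real \<Rightarrow> real \<Rightarrow> outcome \<Rightarrow> real \<Rightarrow> cond"
  where "cond_at \<tau> tcut \<omega> s =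
    (if \<exists>n. enter1 \<tau> tcut \<omega> n \<le> s \<and> s \<le> leave1 \<tau> tcut \<omega> n then Satisfactory else Perfect)"

definition found_prob ::
  "real \<Rightarrow> real \<Rightarrow> real \<Rightarrow> real \<Rightarrow> real \<Rightarrow> real \<Rightarrow> cond pmf \<Rightarrow> real \<Rightarrow> cond \<Rightarrow> real"
  where "found_prob \<mu>1 \<mu>2 lam \<tau> p tcut init s c =
    measure (model \<mu>1 \<mu>2 lam p init)
      {\<omega> \<in> space (model \<mu>1 \<mu>2 lam p init). cond_at \<tau> tcut \<omega> s = c}"

text \<open>
  An initial law yields the stationary regime if the condition found at successive scheduled
  opportunities always has the same law.
\<close>

definition stationary_regime ::
  "real \<Rightarrow> real \<Rightarrow> real \<Rightarrow> real \<Rightarrow> real \<Rightarrow> real \<Rightarrow> cond pmf \<Rightarrow> bool"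
  where "stationary_regime \<mu>1 \<mu>2 lam \<tau> p tcut init \<longleftrightarrow>
    (\<forall>k c. found_prob \<mu>1 \<mu>2 lam \<tau> p tcut init (so_time \<tau> (Suc k)) c =
           found_prob \<mu>1 \<mu>2 lam \<tau> p tcut init (so_time \<tau> k) c)"

text \<open>The number of corrective maintenances and of preventive ones of either kind in \<open>{a..<b}\<close>.\<close>

definition num_cm :: "real \<Rightarrow> real \<Rightarrow> real \<Rightarrow> real \<Rightarrow> outcome \<Rightarrow> nat"
  where "num_cm \<tau> tcut a b \<omega> =
    card {n. leave1 \<tau> tcut \<omega> n = enter1 \<tau> tcut \<omega> n + stay1 \<omega> n \<and> leave1 \<tau> tcut \<omega> n \<in> {a..<b}}"

definition num_pm_so :: "real \<Rightarrow> real \<Rightarrow> real \<Rightarrow> real \<Rightarrow> outcome \<Rightarrow> nat"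
  where "num_pm_so \<tau> tcut a b \<omega> =
    card {k. so_time \<tau> k \<in> {a..<b} \<and> cond_at \<tau> tcut \<omega> (so_time \<tau> k) = Satisfactory}"

definition num_pm_uso :: "real \<Rightarrow> real \<Rightarrow> real \<Rightarrow> real \<Rightarrow> outcome \<Rightarrow> nat"
  where "num_pm_uso \<tau> tcut a b \<omega> =
    card {k. uso_time \<omega> k \<in> {a..<b} \<and> tcut < remaining \<tau> (uso_time \<omega> k) \<and>
             cond_at \<tau> tcut \<omega> (uso_time \<omega> k) = Satisfactory}"

text \<open>Total cost from the \<open>k\<close>-th scheduled opportunity (included) to the next one (excluded).\<close>

definition cycle_cost ::
  "real \<Rightarrow> real \<Rightarrow> real \<Rightarrow> real \<Rightarrow> real \<Rightarrow> nat \<Rightarrow> outcome \<Rightarrow> real"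
  where "cycle_cost c_so c_uso c_cm \<tau> tcut k \<omega> =
    c_so * real (num_pm_so \<tau> tcut (so_time \<tau> k) (so_time \<tau> (Suc k)) \<omega>) +
    c_uso * real (num_pm_uso \<tau> tcut (so_time \<tau> k) (so_time \<tau> (Suc k)) \<omega>) +
    c_cm * real (num_cm \<tau> tcut (so_time \<tau> k) (so_time \<tau> (Suc k)) \<omega>)"

definition C2 :: "real \<Rightarrow> real \<Rightarrow> real \<Rightarrow> real \<Rightarrow> real \<Rightarrow> real \<Rightarrow> real"
  where "C2 \<mu>1 \<mu>2 lam \<tau> p tcut =
    (\<mu>2 / (\<mu>1 + \<mu>2) * (1 - exp (- (\<mu>1 + \<mu>2) * tcut))
      - \<mu>2 / (\<mu>1 + \<mu>2 + lam * p) * (1 / (1 - p) - exp (- (\<mu>1 + \<mu>2) * tcut)))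
    / (1 / (1 - p) * exp ((\<mu>1 + \<mu>2 + lam * p) * \<tau>) - exp (lam * p * tcut))"

definition C1 :: "real \<Rightarrow> real \<Rightarrow> real \<Rightarrow> real \<Rightarrow> real \<Rightarrow> real \<Rightarrow> real"
  where "C1 \<mu>1 \<mu>2 lam \<tau> p tcut =
    C2 \<mu>1 \<mu>2 lam \<tau> p tcut * exp (lam * p * tcut)
      - \<mu>2 / (\<mu>1 + \<mu>2) * (lam * p / (\<mu>1 + \<mu>2 + lam * p)) * exp (- (\<mu>1 + \<mu>2) * tcut)"

end

theory Submission
  imports Defs
begin

text \<open>
  Let \<open>P(s)\<close> be the probability of finding condition 1 at time \<open>s\<close>. The stated formulas
  are those of the linear equation \<open>P' = \<mu>2 (1 - P) - \<mu>1 P - lam p 1_eligible P\<close> between scheduled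
  opportunities, with the jump \<open>P \<mapsto> (1 - p) P\<close> at each of them; "eligible" times are those at which
  the policy lets an unscheduled opportunity be used. The real work is to derive this equation from
  the path-by-path construction, and the derivation below does it without any Markov property.

  The tool is a compensator identity, \<open>exponential_hazard\<close>: if an exponential clock of rate \<open>r\<close> starts
  at time \<open>a\<close> and \<open>G s\<close> does not depend on how long after \<open>s\<close> it rings, then the
  expectation of \<open>G\<close> at the ringing time is \<open>r\<close> times the expected integral of \<open>G\<close> over the time the
  clock runs. It only uses that one coordinate of the outcome may be replaced by an
  independent copy (\<open>resamples\<close>). That the condition found at time \<open>s\<close> is not affected by renewing
  maintenance at time \<open>s\<close> or later is a deterministic statement about paths, \<open>cond_at_causal\<close>.

  Applied to every stay and every gap and summed up, the identity gives the expected numbers of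
  failures (\<open>expected_failures\<close>), of unscheduled opportunities met in condition 1
  (\<open>expected_usos_sat\<close>) and of entrances into condition 1 (\<open>expected_entrances\<close>) as rates times
  expected occupation times. The same estimates show that neither unscheduled opportunities nor
  entrances accumulate. The system is in condition 1 exactly if it has entered once more often than it
  has left, and each departure is either a failure or a successful maintenance of one of two kinds
  (\<open>leave_less_decomposition\<close>). Taking expectations gives the integral form of the equation
  (\<open>balance\<close>, \<open>sat_prob_balance\<close>).

  Solving it over a cycle makes the probability found at one scheduled opportunity an affine function
  of the probability just after the previous one (\<open>sat_prob_so_time\<close>), with slope strictly between 0 and 1.
  Hence there is exactly one stationary initial law, its fixed point determines the
  constants, and the expected cost is read off from the three expected numbers.
\<close>

section \<open>Replacing one independent coordinate\<close>

text \<open>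
  Independence of a coordinate with law \<open>N\<close> from the rest, in the form in which it is needed: overwriting
  the coordinate by an independent copy leaves the law \<open>M\<close> unchanged.
\<close>

definition resamples :: "'a measure \<Rightarrow> 'b measure \<Rightarrow> ('b \<Rightarrow> 'a \<Rightarrow> 'a) \<Rightarrow> bool" where
  "resamples M N upd \<longleftrightarrow> case_prod upd \<in> N \<Otimes>\<^sub>M M \<rightarrow>\<^sub>M M \<and>
     (\<forall>H\<in>borel_measurable M. (\<integral>\<^sup>+\<omega>. H \<omega> \<partial>M) = (\<integral>\<^sup>+\<omega>. \<integral>\<^sup>+x. H (upd x \<omega>) \<partial>N \<partial>M))"

lemma resamples_measurable:
  assumes "resamples M N upd" "f \<in> K \<rightarrow>\<^sub>M N" "g \<in> K \<rightarrow>\<^sub>M M"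
  shows "(\<lambda>x. upd (f x) (g x)) \<in> K \<rightarrow>\<^sub>M M"
proof -
  have "(\<lambda>x. case_prod upd (f x, g x)) \<in> K \<rightarrow>\<^sub>M M"
    using assms unfolding resamples_def by (auto intro: measurable_compose[OF measurable_Pair])
  then show ?thesis by simp
qed

lemma resamples_nn_integral:
  "resamples M N upd \<Longrightarrow> H \<in> borel_measurable M \<Longrightarrow>
    (\<integral>\<^sup>+\<omega>. H \<omega> \<partial>M) = (\<integral>\<^sup>+\<omega>. \<integral>\<^sup>+x. H (upd x \<omega>) \<partial>N \<partial>M)"
  unfolding resamples_def by blast

text \<open>
  Since \<open>insert n UNIV = UNIV\<close>, adjoining a fresh \<open>n\<close>-th coordinate to the product overwrites the old one.
\<close>

lemma resamples_PiM:
  assumes "\<And>i. prob_space (K i)"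
  shows "resamples (\<Pi>\<^sub>M i\<in>UNIV. K i) (K n) (\<lambda>x f. f(n := x))"
  unfolding resamples_def
proof (intro conjI ballI)
  interpret P: prob_space "\<Pi>\<^sub>M i\<in>UNIV. K i" using assms by (intro prob_space_PiM)
  interpret Kn: prob_space "K n" by fact
  interpret pair_sigma_finite "K n" "\<Pi>\<^sub>M i\<in>UNIV. K i" ..
  have m: "(\<lambda>(x, f). f(n := x)) \<in> K n \<Otimes>\<^sub>M (\<Pi>\<^sub>M i\<in>UNIV. K i) \<rightarrow>\<^sub>M (\<Pi>\<^sub>M i\<in>UNIV. K i)"
    using measurable_fun_upd[of UNIV UNIV n "\<lambda>z. snd z" "K n \<Otimes>\<^sub>M (\<Pi>\<^sub>M i\<in>UNIV. K i)" K "\<lambda>z. fst z"]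
    by (simp add: split_beta')
  then show "case_prod (\<lambda>x f. f(n := x)) \<in> K n \<Otimes>\<^sub>M (\<Pi>\<^sub>M i\<in>UNIV. K i) \<rightarrow>\<^sub>M (\<Pi>\<^sub>M i\<in>UNIV. K i)"
    by simp
  fix H :: "('a \<Rightarrow> 'b) \<Rightarrow> ennreal" assume [measurable]: "H \<in> borel_measurable (\<Pi>\<^sub>M i\<in>UNIV. K i)"
  have "(\<integral>\<^sup>+f. H f \<partial>(\<Pi>\<^sub>M i\<in>UNIV. K i)) =
    (\<integral>\<^sup>+f. H f \<partial>distr (K n \<Otimes>\<^sub>M (\<Pi>\<^sub>M i\<in>UNIV. K i)) (\<Pi>\<^sub>M i\<in>UNIV. K i) (\<lambda>(x, f). f(n := x)))"
    using distr_pair_PiM_eq_PiM[of UNIV K n] assms by simp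
  also have "\<dots> = (\<integral>\<^sup>+z. H ((\<lambda>(x, f). f(n := x)) z) \<partial>(K n \<Otimes>\<^sub>M (\<Pi>\<^sub>M i\<in>UNIV. K i)))"
    by (intro nn_integral_distr m) simp
  also have "\<dots> = (\<integral>\<^sup>+f. \<integral>\<^sup>+x. H (f(n := x)) \<partial>K n \<partial>(\<Pi>\<^sub>M i\<in>UNIV. K i))"
    using measurable_compose[OF m, of H borel] by (subst nn_integral_snd[symmetric]) (auto simp: split_beta')
  finally show "(\<integral>\<^sup>+f. H f \<partial>(\<Pi>\<^sub>M i\<in>UNIV. K i)) = (\<integral>\<^sup>+f. \<integral>\<^sup>+x. H (f(n := x)) \<partial>K n \<partial>(\<Pi>\<^sub>M i\<in>UNIV. K i))" .
qed

lemma resamples_snd: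
  assumes r: "resamples M N upd" and "prob_space M" "prob_space N"
  shows "resamples (A \<Otimes>\<^sub>M M) N (\<lambda>x z. (fst z, upd x (snd z)))"
  unfolding resamples_def
proof (intro conjI ballI)
  interpret M: prob_space M by fact
  interpret N: prob_space N by fact
  show "(\<lambda>(x, z). (fst z, upd x (snd z))) \<in> N \<Otimes>\<^sub>M (A \<Otimes>\<^sub>M M) \<rightarrow>\<^sub>M A \<Otimes>\<^sub>M M"
    unfolding split_beta' by (intro measurable_Pair resamples_measurable[OF r]) simp_all
  fix H :: "'c \<times> 'a \<Rightarrow> ennreal" assume [measurable]: "H \<in> borel_measurable (A \<Otimes>\<^sub>M M)"
  note [measurable] = resamples_measurable[OF r]
  have [measurable]: "(\<lambda>z. \<integral>\<^sup>+x. H (fst z, upd x (snd z)) \<partial>N) \<in> borel_measurable (A \<Otimes>\<^sub>M M)"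
    by measurable
  have "(\<integral>\<^sup>+z. H z \<partial>(A \<Otimes>\<^sub>M M)) = (\<integral>\<^sup>+a. \<integral>\<^sup>+m. H (a, m) \<partial>M \<partial>A)"
    by (simp add: M.nn_integral_fst)
  also have "\<dots> = (\<integral>\<^sup>+a. \<integral>\<^sup>+m. \<integral>\<^sup>+x. H (a, upd x m) \<partial>N \<partial>M \<partial>A)"
    by (intro nn_integral_cong resamples_nn_integral[OF r]) simp
  also have "\<dots> = (\<integral>\<^sup>+z. \<integral>\<^sup>+x. H (fst z, upd x (snd z)) \<partial>N \<partial>(A \<Otimes>\<^sub>M M))"
    by (subst M.nn_integral_fst[symmetric]) simp_all
  finally show "(\<integral>\<^sup>+z. H z \<partial>(A \<Otimes>\<^sub>M M)) = (\<integral>\<^sup>+z. \<integral>\<^sup>+x. H (fst z, upd x (snd z)) \<partial>N \<partial>(A \<Otimes>\<^sub>M M))" .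
qed

lemma resamples_fst:
  assumes r: "resamples M N upd" and "prob_space M" "prob_space N" "prob_space A"
  shows "resamples (M \<Otimes>\<^sub>M A) N (\<lambda>x z. (upd x (fst z), snd z))"
  unfolding resamples_def
proof (intro conjI ballI)
  interpret M: prob_space M by fact
  interpret N: prob_space N by fact
  interpret A: prob_space A by fact
  interpret NA: pair_sigma_finite N A ..
  show "(\<lambda>(x, z). (upd x (fst z), snd z)) \<in> N \<Otimes>\<^sub>M (M \<Otimes>\<^sub>M A) \<rightarrow>\<^sub>M M \<Otimes>\<^sub>M A"
    unfolding split_beta' by (intro measurable_Pair resamples_measurable[OF r]) simp_all
  fix H :: "'a \<times> 'c \<Rightarrow> ennreal" assume [measurable]: "H \<in> borel_measurable (M \<Otimes>\<^sub>M A)"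
  note [measurable] = resamples_measurable[OF r]
  have [measurable]: "(\<lambda>z. \<integral>\<^sup>+x. H (upd x (fst z), snd z) \<partial>N) \<in> borel_measurable (M \<Otimes>\<^sub>M A)"
    by measurable
  have "(\<integral>\<^sup>+z. H z \<partial>(M \<Otimes>\<^sub>M A)) = (\<integral>\<^sup>+m. \<integral>\<^sup>+a. H (m, a) \<partial>A \<partial>M)"
    by (simp add: A.nn_integral_fst)
  also have "\<dots> = (\<integral>\<^sup>+m. \<integral>\<^sup>+x. \<integral>\<^sup>+a. H (upd x m, a) \<partial>A \<partial>N \<partial>M)"
    by (intro resamples_nn_integral[OF r]) simp
  also have "\<dots> = (\<integral>\<^sup>+m. \<integral>\<^sup>+a. \<integral>\<^sup>+x. H (upd x m, a) \<partial>N \<partial>A \<partial>M)"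
    by (intro nn_integral_cong NA.Fubini'[symmetric]) measurable
  also have "\<dots> = (\<integral>\<^sup>+z. \<integral>\<^sup>+x. H (upd x (fst z), snd z) \<partial>N \<partial>(M \<Otimes>\<^sub>M A))"
    by (subst A.nn_integral_fst[symmetric]) simp_all
  finally show "(\<integral>\<^sup>+z. H z \<partial>(M \<Otimes>\<^sub>M A)) = (\<integral>\<^sup>+z. \<integral>\<^sup>+x. H (upd x (fst z), snd z) \<partial>N \<partial>(M \<Otimes>\<^sub>M A))" .
qed

lemma resamples_AE:
  assumes "resamples M N upd" "prob_space M" "prob_space N" and Q: "Measurable.pred M Q"
    and *: "\<And>\<omega>. \<omega> \<in> space M \<Longrightarrow> AE x in N. Q (upd x \<omega>)"
  shows "AE \<omega> in M. Q \<omega>"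
proof -
  note [measurable] = Q
  have "(\<integral>\<^sup>+\<omega>. of_bool (\<not> Q \<omega>) \<partial>M) = (\<integral>\<^sup>+\<omega>. \<integral>\<^sup>+x. of_bool (\<not> Q (upd x \<omega>)) \<partial>N \<partial>M)"
    by (rule resamples_nn_integral[OF assms(1)]) measurable
  also have "\<dots> = (\<integral>\<^sup>+\<omega>. 0 \<partial>M)"
  proof (intro nn_integral_cong)
    fix \<omega> assume "\<omega> \<in> space M"
    then have "(\<integral>\<^sup>+x. of_bool (\<not> Q (upd x \<omega>)) \<partial>N) = (\<integral>\<^sup>+x. 0 \<partial>N :: ennreal)"
      using *[of \<omega>] by (intro nn_integral_cong_AE) auto
    then show "(\<integral>\<^sup>+x. of_bool (\<not> Q (upd x \<omega>)) \<partial>N) = (0 :: ennreal)" by simp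
  qed
  finally have "(\<integral>\<^sup>+\<omega>. of_bool (\<not> Q \<omega>) \<partial>M) = (0 :: ennreal)" by simp
  then have "AE \<omega> in M. of_bool (\<not> Q \<omega>) = (0 :: ennreal)"
    by (subst (asm) nn_integral_0_iff_AE) auto
  then show ?thesis by eventually_elim (auto split: if_splits)
qed

text \<open>
  Thinning: a coin that the quantity \<open>K\<close> does not depend on contributes the factor \<open>p\<close>.
\<close>

lemma resamples_bernoulli_thinning:
  assumes "resamples M (measure_pmf (bernoulli_pmf p)) upd" and p: "0 \<le> p" "p \<le> 1"
    and [measurable]: "Measurable.pred M B" "K \<in> borel_measurable M"
    and P: "AE \<omega> in M. P \<omega>"
    and B: "\<And>\<omega> b. P \<omega> \<Longrightarrow> B (upd b \<omega>) = b"
    and K: "\<And>\<omega> b. P \<omega> \<Longrightarrow> K (upd b \<omega>) = K \<omega>"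
  shows "(\<integral>\<^sup>+\<omega>. of_bool (B \<omega>) * K \<omega> \<partial>M) = ennreal p * (\<integral>\<^sup>+\<omega>. K \<omega> \<partial>M)"
proof -
  have "(\<integral>\<^sup>+\<omega>. of_bool (B \<omega>) * K \<omega> \<partial>M) =
    (\<integral>\<^sup>+\<omega>. \<integral>\<^sup>+b. of_bool (B (upd b \<omega>)) * K (upd b \<omega>) \<partial>measure_pmf (bernoulli_pmf p) \<partial>M)"
    by (rule resamples_nn_integral[OF assms(1)]) measurable
  also have "\<dots> = (\<integral>\<^sup>+\<omega>. ennreal p * K \<omega> \<partial>M)"
  proof (rule nn_integral_cong_AE, use P in eventually_elim)
    fix \<omega> assume "P \<omega>"
    then show "(\<integral>\<^sup>+b. of_bool (B (upd b \<omega>)) * K (upd b \<omega>) \<partial>measure_pmf (bernoulli_pmf p)) = ennreal p * K \<omega>"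
      using p by (simp add: B K mult_ac)
  qed
  also have "\<dots> = ennreal p * (\<integral>\<^sup>+\<omega>. K \<omega> \<partial>M)"
    by (rule nn_integral_cmult) measurable
  finally show ?thesis .
qed

section \<open>Exponential clocks\<close>

lemma sets_exponential [measurable_cong, simp]: "sets (exponential r) = sets borel"
  by (simp add: exponential_def)

lemma space_exponential [simp]: "space (exponential r) = UNIV"
  by (simp add: exponential_def)

lemma prob_space_exponential: "0 < r \<Longrightarrow> prob_space (exponential r)"
  unfolding exponential_def by (rule prob_space_exponential_density)

lemma nn_integral_exponential:
  assumes [measurable]: "f \<in> borel_measurable borel"
  shows "(\<integral>\<^sup>+x. f x \<partial>exponential r) = (\<integral>\<^sup>+x. ennreal (exponential_density r x) * f x \<partial>lborel)"
  unfolding exponential_def by (rule nn_integral_density) auto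

lemma AE_exponential_pos: "AE x in exponential r. 0 < x"
proof -
  have "AE x in lborel. x \<noteq> (0 :: real)" by (rule AE_lborel_singleton)
  then have "AE x in lborel. 0 < ennreal (exponential_density r x) \<longrightarrow> 0 < x"
    by eventually_elim (auto simp: exponential_density_def)
  then show ?thesis unfolding exponential_def by (subst AE_density) auto
qed

lemma exponential_tail:
  assumes "0 < r" "0 \<le> t"
  shows "(\<integral>\<^sup>+x. ennreal (exponential_density r x) * of_bool (t \<le> x) \<partial>lborel) = ennreal (exp (- r * t))"
proof -
  have "(\<integral>\<^sup>+x. ennreal (exponential_density r x) * of_bool (t \<le> x) \<partial>lborel) =
    (\<integral>\<^sup>+x. ennreal (r * exp (- r * x)) * indicator {t..} x \<partial>lborel)"
    using assms by (intro nn_integral_cong) (auto simp: exponential_density_def indicator_def mult_ac)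
  also have "\<dots> = ennreal (0 - (- exp (- r * t)))"
  proof (rule nn_integral_FTC_atLeast)
    have "((\<lambda>x. - exp (- (r * x))) \<longlongrightarrow> - 0) at_top"
      using assms
      by (intro tendsto_minus filterlim_compose[OF exp_at_bot] filterlim_uminus_at_bot_at_top
          filterlim_compose[OF filterlim_uminus_at_bot_at_top] filterlim_tendsto_pos_mult_at_top[OF tendsto_const])
        (auto intro: filterlim_ident)
    then show "((\<lambda>x. - exp (- r * x)) \<longlongrightarrow> 0) at_top" by simp
  qed (use assms in \<open>auto intro!: derivative_eq_intros\<close>)
  finally show ?thesis by simp
qed

text \<open>
  Given the other coordinates, both sides equal \<open>r * \<integral> exp (- r (s - a)) G s ds\<close>: on the left this is the
  density of the ringing time \<open>a + X\<close>, on the right \<open>r\<close> times the probability that the clock is still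
  running at \<open>s\<close>. The invariance hypothesis says that \<open>G s\<close> does not depend on how long after \<open>s\<close>
  the clock rings; the outcome in which it rings exactly at \<open>s\<close> therefore represents all of these.
  The event \<open>P\<close> collects almost sure properties of the outcome, such as other clocks having positive length.
\<close>

lemma exponential_hazard:
  fixes G :: "real \<Rightarrow> 'a \<Rightarrow> ennreal"
  assumes r: "0 < r" and res: "resamples M (exponential r) upd" and "prob_space M"
    and [measurable]: "a \<in> borel_measurable M" "X \<in> borel_measurable M"
    and G: "case_prod G \<in> borel_measurable (borel \<Otimes>\<^sub>M M)"
    and P: "AE \<omega> in M. P \<omega>"
    and X: "\<And>\<omega> x. P \<omega> \<Longrightarrow> 0 < x \<Longrightarrow> X (upd x \<omega>) = x"
    and a: "\<And>\<omega> x. P \<omega> \<Longrightarrow> 0 < x \<Longrightarrow> a (upd x \<omega>) = a \<omega>"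
    and inv: "\<And>\<omega> s x. P \<omega> \<Longrightarrow> a \<omega> < s \<Longrightarrow> s \<le> a \<omega> + x \<Longrightarrow> G s (upd x \<omega>) = G s (upd (s - a \<omega>) \<omega>)"
  shows "(\<integral>\<^sup>+\<omega>. G (a \<omega> + X \<omega>) \<omega> \<partial>M) =
    ennreal r * (\<integral>\<^sup>+\<omega>. \<integral>\<^sup>+s. G s \<omega> * of_bool (a \<omega> < s \<and> s \<le> a \<omega> + X \<omega>) \<partial>lborel \<partial>M)"
proof -
  interpret M: prob_space M by fact
  interpret E: prob_space "exponential r" using r by (rule prob_space_exponential)
  note [measurable] = resamples_measurable[OF res]
  have pm: "(\<lambda>(\<omega>, s). G s \<omega> * of_bool (a \<omega> < s \<and> s \<le> a \<omega> + X \<omega>)) \<in> borel_measurable (M \<Otimes>\<^sub>M lborel)"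
    using measurable_compose[OF measurable_Pair[OF measurable_snd measurable_fst] G]
    by (simp add: split_beta')
  have m: "(\<lambda>\<omega>. \<integral>\<^sup>+s. G s \<omega> * of_bool (a \<omega> < s \<and> s \<le> a \<omega> + X \<omega>) \<partial>lborel) \<in> borel_measurable M"
    using lborel.borel_measurable_nn_integral[OF pm] .
  have Gm: "(\<lambda>s. G (f s) (upd (g s) \<omega>)) \<in> borel_measurable borel"
    if "f \<in> borel_measurable borel" "g \<in> borel_measurable borel" "\<omega> \<in> space M" for f g :: "real \<Rightarrow> real" and \<omega>
  proof -
    have "(\<lambda>s. upd (g s) \<omega>) \<in> borel \<rightarrow>\<^sub>M M"
      using that by (intro resamples_measurable[OF res]) (auto cong: measurable_cong_sets)
    from measurable_compose[OF measurable_Pair[OF that(1) this] G] show ?thesis by simp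
  qed
  define d where "d x = ennreal (exponential_density r x)" for x
  have [measurable]: "d \<in> borel_measurable borel" unfolding d_def by measurable
  have nz: "AE x in lborel. x \<noteq> (0 :: real)"
    by (rule AE_lborel_singleton)
  have d0: "d x = 0" if "x < 0" for x
    using that by (simp add: d_def exponential_density_def)
  have main: "(\<integral>\<^sup>+x. G (a (upd x \<omega>) + X (upd x \<omega>)) (upd x \<omega>) \<partial>exponential r) =
     ennreal r * (\<integral>\<^sup>+x. \<integral>\<^sup>+s. G s (upd x \<omega>) *
       of_bool (a (upd x \<omega>) < s \<and> s \<le> a (upd x \<omega>) + X (upd x \<omega>)) \<partial>lborel \<partial>exponential r)"
    (is "?L = ennreal r * ?R") if \<omega>: "P \<omega>" "\<omega> \<in> space M" for \<omega>
  proof -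
    have [measurable]: "(\<lambda>x. upd x \<omega>) \<in> borel \<rightarrow>\<^sub>M M"
      using \<omega> by (intro resamples_measurable[OF res]) (auto cong: measurable_cong_sets)
    define g where "g s = G s (upd (s - a \<omega>) \<omega>) * of_bool (a \<omega> < s)" for s
    have [measurable]: "g \<in> borel_measurable borel"
      unfolding g_def using Gm[of "\<lambda>s. s" "\<lambda>s. s - a \<omega>" \<omega>] \<omega> by measurable
    have "?L = (\<integral>\<^sup>+x. d x * G (a (upd x \<omega>) + X (upd x \<omega>)) (upd x \<omega>) \<partial>lborel)"
      unfolding d_def using \<omega> by (intro nn_integral_exponential Gm) auto
    also have "\<dots> = (\<integral>\<^sup>+x. d x * g (a \<omega> + x) \<partial>lborel)"
    proof (rule nn_integral_cong_AE, use nz in eventually_elim)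
      fix x :: real assume "x \<noteq> 0"
      then show "d x * G (a (upd x \<omega>) + X (upd x \<omega>)) (upd x \<omega>) = d x * g (a \<omega> + x)"
        using X[OF \<omega>(1), of x] a[OF \<omega>(1), of x] d0[of x] by (cases "x < 0") (auto simp: g_def)
    qed
    also have "\<dots> = (\<integral>\<^sup>+s. d (s - a \<omega>) * g s \<partial>lborel)"
      by (subst nn_integral_real_affine[where c=1 and t="a \<omega>" and f="\<lambda>s. d (s - a \<omega>) * g s"]) auto
    also have "\<dots> = (\<integral>\<^sup>+s. ennreal r * (ennreal (exp (- r * (s - a \<omega>))) * g s) \<partial>lborel)"
      using r by (intro nn_integral_cong)
        (auto simp: g_def d_def exponential_density_def ennreal_mult algebra_simps)
    also have "\<dots> = ennreal r * (\<integral>\<^sup>+s. ennreal (exp (- r * (s - a \<omega>))) * g s \<partial>lborel)"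
      by (rule nn_integral_cmult) measurable
    \<comment> \<open>The exponential factor is unfolded into the probability that the clock runs until \<open>s\<close>.\<close>
    also have "(\<integral>\<^sup>+s. ennreal (exp (- r * (s - a \<omega>))) * g s \<partial>lborel) =
        (\<integral>\<^sup>+s. \<integral>\<^sup>+x. d x * of_bool (s - a \<omega> \<le> x) * g s \<partial>lborel \<partial>lborel)"
    proof (rule nn_integral_cong)
      fix s :: real
      have "(\<integral>\<^sup>+x. d x * of_bool (s - a \<omega> \<le> x) * g s \<partial>lborel) = (\<integral>\<^sup>+x. d x * of_bool (s - a \<omega> \<le> x) \<partial>lborel) * g s"
        by (rule nn_integral_multc) measurable
      then show "ennreal (exp (- r * (s - a \<omega>))) * g s = (\<integral>\<^sup>+x. d x * of_bool (s - a \<omega> \<le> x) * g s \<partial>lborel)"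
        using exponential_tail[OF r, of "s - a \<omega>"] by (cases "a \<omega> < s") (auto simp: g_def d_def)
    qed
    also have "\<dots> = (\<integral>\<^sup>+x. \<integral>\<^sup>+s. d x * of_bool (s - a \<omega> \<le> x) * g s \<partial>lborel \<partial>lborel)"
      by (rule lborel_pair.Fubini') measurable
    also have "\<dots> = (\<integral>\<^sup>+x. d x * (\<integral>\<^sup>+s. G s (upd x \<omega>) *
       of_bool (a (upd x \<omega>) < s \<and> s \<le> a (upd x \<omega>) + X (upd x \<omega>)) \<partial>lborel) \<partial>lborel)"
    proof (rule nn_integral_cong_AE, use nz in eventually_elim)
      fix x :: real assume "x \<noteq> 0"
      have [measurable]: "(\<lambda>s. G s (upd x \<omega>)) \<in> borel_measurable borel"
        using Gm[of "\<lambda>s. s" "\<lambda>_. x" \<omega>] \<omega> by simp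
      show "(\<integral>\<^sup>+s. d x * of_bool (s - a \<omega> \<le> x) * g s \<partial>lborel) = d x * (\<integral>\<^sup>+s. G s (upd x \<omega>) *
       of_bool (a (upd x \<omega>) < s \<and> s \<le> a (upd x \<omega>) + X (upd x \<omega>)) \<partial>lborel)"
      proof (cases "x < 0")
        case False
        then have "0 < x" using \<open>x \<noteq> 0\<close> by simp
        show ?thesis
          by (subst nn_integral_cmult[symmetric])
            (auto simp: X[OF \<omega>(1) \<open>0 < x\<close>] a[OF \<omega>(1) \<open>0 < x\<close>] g_def mult_ac inv[OF \<omega>(1), of _ x]
              intro!: nn_integral_cong)
      qed (simp add: d0)
    qed
    also have "\<dots> = ?R"
      unfolding d_def
      by (intro nn_integral_exponential[symmetric] measurable_compose[OF _ m]) measurable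
    finally show ?thesis .
  qed
  have GM: "(\<lambda>\<omega>. G (a \<omega> + X \<omega>) \<omega>) \<in> borel_measurable M"
    using measurable_compose[OF measurable_Pair[of "\<lambda>\<omega>. a \<omega> + X \<omega>" M borel "\<lambda>\<omega>. \<omega>" M] G] by simp
  have "(\<integral>\<^sup>+\<omega>. G (a \<omega> + X \<omega>) \<omega> \<partial>M) =
      (\<integral>\<^sup>+\<omega>. \<integral>\<^sup>+x. G (a (upd x \<omega>) + X (upd x \<omega>)) (upd x \<omega>) \<partial>exponential r \<partial>M)"
    by (rule resamples_nn_integral[OF res GM])
  also have "\<dots> = (\<integral>\<^sup>+\<omega>. ennreal r * (\<integral>\<^sup>+x. \<integral>\<^sup>+s. G s (upd x \<omega>) *
       of_bool (a (upd x \<omega>) < s \<and> s \<le> a (upd x \<omega>) + X (upd x \<omega>)) \<partial>lborel \<partial>exponential r) \<partial>M)"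
    using P main by (intro nn_integral_cong_AE) auto
  also have "\<dots> = ennreal r * (\<integral>\<^sup>+\<omega>. \<integral>\<^sup>+x. \<integral>\<^sup>+s. G s (upd x \<omega>) *
       of_bool (a (upd x \<omega>) < s \<and> s \<le> a (upd x \<omega>) + X (upd x \<omega>)) \<partial>lborel \<partial>exponential r \<partial>M)"
    using measurable_compose[OF resamples_measurable[OF res measurable_snd measurable_fst] m]
    by (intro nn_integral_cmult E.borel_measurable_nn_integral) (simp add: split_beta')
  also have "(\<integral>\<^sup>+\<omega>. \<integral>\<^sup>+x. \<integral>\<^sup>+s. G s (upd x \<omega>) *
       of_bool (a (upd x \<omega>) < s \<and> s \<le> a (upd x \<omega>) + X (upd x \<omega>)) \<partial>lborel \<partial>exponential r \<partial>M) =
     (\<integral>\<^sup>+\<omega>. \<integral>\<^sup>+s. G s \<omega> * of_bool (a \<omega> < s \<and> s \<le> a \<omega> + X \<omega>) \<partial>lborel \<partial>M)"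
    by (rule resamples_nn_integral[OF res m, symmetric])
  finally show ?thesis .
qed

section \<open>Random counts\<close>

lemma suminf_of_bool_unique:
  assumes "\<And>i j. P i \<Longrightarrow> P j \<Longrightarrow> i = j"
  shows "(\<Sum>i. of_bool (P i)) = (of_bool (\<exists>i. P i) :: ennreal)"
proof (cases "\<exists>i. P i")
  case True
  then obtain i where i: "P i" by blast
  have "(\<Sum>i. of_bool (P i) :: ennreal) = (\<Sum>k\<in>{i}. of_bool (P k))"
    by (rule suminf_finite) (use i assms in auto)
  then show ?thesis using i by auto
qed simp

lemma suminf_of_bool_eq_card:
  fixes P :: "nat \<Rightarrow> bool"
  assumes "(\<Sum>k. of_bool (P k) :: ennreal) \<noteq> \<infinity>"
  shows "finite {k. P k}" "(\<Sum>k. of_bool (P k) :: ennreal) = of_nat (card {k. P k})"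
proof -
  have "(\<Sum>k. of_bool (P k) :: ennreal) = (\<integral>\<^sup>+k. indicator {k. P k} k \<partial>count_space UNIV)"
    unfolding nn_integral_count_space_nat by (intro arg_cong[where f=suminf]) (auto simp: indicator_def)
  also have "\<dots> = emeasure (count_space UNIV) {k. P k}"
    by (rule nn_integral_indicator) simp
  finally have *: "(\<Sum>k. of_bool (P k) :: ennreal) = emeasure (count_space UNIV) {k. P k}" .
  then show fin: "finite {k. P k}"
    using assms by (cases "finite {k. P k}") (simp_all add: emeasure_count_space)
  show "(\<Sum>k. of_bool (P k) :: ennreal) = of_nat (card {k. P k})"
    unfolding * using fin by (subst emeasure_count_space_finite) auto
qed

text \<open>
  The first Borel-Cantelli lemma.
\<close>

lemma AE_finite_of_summable_prob:
  fixes P :: "nat \<Rightarrow> 'a \<Rightarrow> bool"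
  assumes [measurable]: "\<And>k. Measurable.pred M (P k)"
    and "(\<Sum>k. \<integral>\<^sup>+\<omega>. of_bool (P k \<omega>) \<partial>M) \<noteq> \<infinity>"
  shows "AE \<omega> in M. finite {k. P k \<omega>}"
proof -
  have "(\<integral>\<^sup>+\<omega>. (\<Sum>k. of_bool (P k \<omega>)) \<partial>M) \<noteq> \<infinity>"
    using assms(2) by (subst nn_integral_suminf) auto
  then have "AE \<omega> in M. (\<Sum>k. of_bool (P k \<omega>) :: ennreal) \<noteq> \<infinity>"
    by (intro nn_integral_noteq_infinite) auto
  then show ?thesis by eventually_elim (rule suminf_of_bool_eq_card(1))
qed

lemma (in prob_space) expected_count:
  fixes P :: "nat \<Rightarrow> 'a \<Rightarrow> bool"
  assumes [measurable]: "\<And>k. Measurable.pred M (P k)"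
    and sum: "(\<Sum>k. \<integral>\<^sup>+\<omega>. of_bool (P k \<omega>) \<partial>M) = ennreal r" and "0 \<le> r"
  shows "has_bochner_integral M (\<lambda>\<omega>. real (card {k. P k \<omega>})) r"
proof (rule has_bochner_integral_nn_integral)
  have sum': "(\<integral>\<^sup>+\<omega>. (\<Sum>k. of_bool (P k \<omega>)) \<partial>M) = ennreal r"
    using sum by (simp add: nn_integral_suminf)
  then have "AE \<omega> in M. (\<Sum>k. of_bool (P k \<omega>) :: ennreal) \<noteq> \<infinity>"
    by (intro nn_integral_noteq_infinite) auto
  then have "AE \<omega> in M. ennreal (real (card {k. P k \<omega>})) = (\<Sum>k. of_bool (P k \<omega>))"
    by eventually_elim (simp add: suminf_of_bool_eq_card(2) ennreal_of_nat_eq_real_of_nat)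
  then show "(\<integral>\<^sup>+\<omega>. ennreal (real (card {k. P k \<omega>})) \<partial>M) = ennreal r"
    unfolding sum'[symmetric] by (rule nn_integral_cong_AE)
qed (use \<open>0 \<le> r\<close> in auto)

lemma (in sigma_finite_measure) suminf_nn_integral_nn_integral:
  assumes "\<And>k :: nat. (\<lambda>(x, y). f k x y) \<in> borel_measurable (N \<Otimes>\<^sub>M M)"
  shows "(\<Sum>k. \<integral>\<^sup>+x. \<integral>\<^sup>+y. f k x y \<partial>M \<partial>N) = (\<integral>\<^sup>+x. \<integral>\<^sup>+y. (\<Sum>k. f k x y) \<partial>M \<partial>N)"
proof -
  note [measurable] = assms
  have "(\<integral>\<^sup>+x. \<integral>\<^sup>+y. (\<Sum>k. f k x y) \<partial>M \<partial>N) = (\<integral>\<^sup>+x. (\<Sum>k. \<integral>\<^sup>+y. f k x y \<partial>M) \<partial>N)"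
    by (intro nn_integral_cong nn_integral_suminf) measurable
  also have "\<dots> = (\<Sum>k. \<integral>\<^sup>+x. \<integral>\<^sup>+y. f k x y \<partial>M \<partial>N)"
    by (intro nn_integral_suminf borel_measurable_nn_integral assms)
  finally show ?thesis ..
qed

lemma ennreal_suminf_commute:
  fixes f :: "nat \<Rightarrow> nat \<Rightarrow> ennreal"
  shows "(\<Sum>i. \<Sum>j. f i j) = (\<Sum>j. \<Sum>i. f i j)"
  unfolding nn_integral_count_space_nat[symmetric]
  by (rule nn_integral_count_space_nn_integral) auto

lemma AE_not_in_range: "AE s in lborel. \<forall>n :: nat. s \<noteq> (f n :: real)"
  unfolding AE_all_countable by (auto intro: AE_lborel_singleton)

lemma finite_below_strict_mono:
  fixes f :: "nat \<Rightarrow> real"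
  assumes "strict_mono f" "\<exists>k. s < f k"
  shows "finite {k. f k < s}"
proof -
  obtain k where "s < f k" using assms by blast
  then have "{k. f k < s} \<subseteq> {..<k}"
    using strict_mono_less[OF assms(1)] by (force simp: not_less[symmetric])
  then show ?thesis by (rule finite_subset) simp
qed

section \<open>Linear integral equations and integrals over intervals\<close>

text \<open>
  The solution of \<open>f' = m - c f\<close>. The equation is not imposed at \<open>a\<close> itself, where \<open>f\<close> may have a jump;
  the indefinite integral on the right is the continuous version of \<open>f\<close> that can be differentiated.
\<close>

lemma linear_integral_equation:
  fixes f :: "real \<Rightarrow> real"
  assumes "a < b" "c \<noteq> 0" and int: "f integrable_on {a..b}"
    and eq: "\<And>s. a < s \<Longrightarrow> s \<le> b \<Longrightarrow> f s = y0 + integral {a..s} (\<lambda>t. m - c * f t)"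
    and s: "a < s" "s \<le> b"
  shows "f s = m / c + (y0 - m / c) * exp (- c * (s - a))"
proof -
  let ?g = "\<lambda>t. m - c * f t"
  have gi: "?g integrable_on {a..b}"
    using int by (intro integrable_diff integrable_on_mult_right) auto
  define z where "z s = y0 + integral {a..s} ?g" for s
  have cz: "continuous_on {a..b} z"
    unfolding z_def by (intro continuous_intros indefinite_integral_continuous_1 gi)
  \<comment> \<open>Changing the integrand at the single point \<open>a\<close> replaces \<open>f\<close> by its continuous version.\<close>
  have z_eq: "z s = y0 + integral {a..s} (\<lambda>t. m - c * z t)" if "s \<in> {a..b}" for s
    unfolding z_def[of s]
    using that eq by (intro arg_cong2[where f="(+)"] refl integral_spike[where S="{a}"]) (auto simp: z_def)
  have dz: "(z has_real_derivative (m - c * z t)) (at t within {a..b})" if t: "t \<in> {a..b}" for t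
  proof -
    have "((\<lambda>s. y0 + integral {a..s} (\<lambda>t. m - c * z t)) has_real_derivative (m - c * z t)) (at t within {a..b})"
      by (rule derivative_eq_intros integral_has_real_derivative t continuous_intros cz refl | simp)+
    then show ?thesis
      unfolding has_field_derivative_def
      using has_derivative_transform[of t "{a..b}" z "\<lambda>s. y0 + integral {a..s} (\<lambda>t. m - c * z t)"] t z_eq by blast
  qed
  have "\<exists>k. \<forall>t\<in>{a..b}. (z t - m / c) * exp (c * (t - a)) = k"
  proof (rule has_field_derivative_zero_constant)
    fix t assume t: "t \<in> {a..b}"
    have "((\<lambda>t. (z t - m / c) * exp (c * (t - a))) has_real_derivative
        (m - c * z t) * exp (c * (t - a)) + (z t - m / c) * (c * exp (c * (t - a)))) (at t within {a..b})"
      by (rule derivative_eq_intros dz[OF t] refl | simp)+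
    moreover have "(m - c * z t) * exp (c * (t - a)) + (z t - m / c) * (c * exp (c * (t - a))) = 0"
      using \<open>c \<noteq> 0\<close> by (simp add: field_simps)
    ultimately show "((\<lambda>t. (z t - m / c) * exp (c * (t - a))) has_real_derivative 0) (at t within {a..b})"
      by simp
  qed simp
  then obtain k where k: "(z t - m / c) * exp (c * (t - a)) = k" if "t \<in> {a..b}" for t by blast
  have *: "(z s - m / c) * exp (c * (s - a)) = y0 - m / c"
    using k[of s] k[of a] s \<open>a < b\<close> by (simp add: z_def)
  have "z s - m / c = (z s - m / c) * exp (c * (s - a)) * exp (- c * (s - a))"
    by (simp add: mult.assoc flip: exp_add)
  then have "z s - m / c = (y0 - m / c) * exp (- c * (s - a))"
    by (simp only: *)
  moreover have "f s = z s" using eq s by (simp add: z_def)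
  ultimately show ?thesis by simp
qed

text \<open>
  Gauge integrals over closed intervals are used for solving equations, nonnegative Lebesgue integrals
  for counting; the endpoints, null sets, are included or not as the counting dictates.
\<close>

lemma bounded_integral:
  fixes f :: "real \<Rightarrow> real"
  assumes [measurable]: "f \<in> borel_measurable borel" and b: "\<And>x. 0 \<le> f x" "\<And>x. f x \<le> C"
  shows "f integrable_on {a..b}"
    and "(\<integral>\<^sup>+x. indicator {a<..<b} x * ennreal (f x) \<partial>lborel) = ennreal (integral {a..b} f)"
    and "(\<integral>\<^sup>+x. indicator {a<..b} x * ennreal (f x) \<partial>lborel) = ennreal (integral {a..b} f)"
    and "(\<integral>\<^sup>+x. indicator {a..<b} x * ennreal (f x) \<partial>lborel) = ennreal (integral {a..b} f)"
proof -
  have si: "set_integrable lborel {a..b} f"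
    unfolding set_integrable_def
  proof (rule Bochner_Integration.integrable_bound[where f="\<lambda>x. C * indicator {a..b} x"])
    show "integrable lborel (\<lambda>x. C * indicator {a..b} x)"
      by (intro integrable_mult_right integrable_real_indicator) (auto simp: emeasure_lborel_Icc_eq)
    show "AE x in lborel. norm (indicator {a..b} x *\<^sub>R f x) \<le> norm (C * indicator {a..b} x)"
      using b order_trans[OF b] by (auto simp: indicator_def)
  qed simp
  then show "f integrable_on {a..b}" by (rule set_borel_integral_eq_integral)
  have "(\<integral>\<^sup>+x. indicator {a..b} x * ennreal (f x) \<partial>lborel) = (\<integral>\<^sup>+x. ennreal (indicator {a..b} x *\<^sub>R f x) \<partial>lborel)"
    by (intro nn_integral_cong) (auto simp: indicator_def)
  also have "\<dots> = ennreal (LINT x:{a..b}|lborel. f x)"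
    unfolding set_lebesgue_integral_def using si b
    by (intro nn_integral_eq_integral) (auto simp: set_integrable_def)
  also have "\<dots> = ennreal (integral {a..b} f)"
    using set_borel_integral_eq_integral(2)[OF si] by simp
  finally have *: "(\<integral>\<^sup>+x. indicator {a..b} x * ennreal (f x) \<partial>lborel) = ennreal (integral {a..b} f)" .
  have ae: "AE x in lborel. x \<noteq> a \<and> x \<noteq> b"
    using AE_lborel_singleton[of a] AE_lborel_singleton[of b] by eventually_elim simp
  show "(\<integral>\<^sup>+x. indicator {a<..<b} x * ennreal (f x) \<partial>lborel) = ennreal (integral {a..b} f)"
    unfolding *[symmetric] by (rule nn_integral_cong_AE, use ae in eventually_elim) (auto simp: indicator_def)
  show "(\<integral>\<^sup>+x. indicator {a<..b} x * ennreal (f x) \<partial>lborel) = ennreal (integral {a..b} f)"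
    unfolding *[symmetric] by (rule nn_integral_cong_AE, use ae in eventually_elim) (auto simp: indicator_def)
  show "(\<integral>\<^sup>+x. indicator {a..<b} x * ennreal (f x) \<partial>lborel) = ennreal (integral {a..b} f)"
    unfolding *[symmetric] by (rule nn_integral_cong_AE, use ae in eventually_elim) (auto simp: indicator_def)
qed

lemma integral_reflect_shift:
  fixes g :: "real \<Rightarrow> real"
  assumes "g integrable_on {c - b..c - a}"
  shows "integral {a..b} (\<lambda>t. g (c - t)) = integral {c - b..c - a} g"
proof -
  have "(g has_integral integral {c - b..c - a} g) (cbox (c - b) (c - a))"
    using assms by (simp add: has_integral_integral)
  from has_integral_affinity[OF this, of "-1" c]
  have "((\<lambda>t. g (c - t)) has_integral integral {c - b..c - a} g) ((\<lambda>t. c - t) ` {c - b..c - a})"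
    by simp
  moreover have "(\<lambda>t. c - t) ` {c - b..c - a} = {a..b}"
    by (force simp: image_iff intro!: bexI[of _ "c - x" for x])
  ultimately show ?thesis by (simp add: integral_unique)
qed

section \<open>Paths of the maintained system\<close>

text \<open>
  An almost sure property. It makes stays disjoint and unscheduled opportunities distinct.
\<close>

definition positive_lengths :: "outcome \<Rightarrow> bool" where
  "positive_lengths \<omega> \<longleftrightarrow> (\<forall>n. 0 < stay2 \<omega> n \<and> 0 < stay1 \<omega> n \<and> 0 < uso_gap \<omega> n)"

lemma positive_lengthsD:
  assumes "positive_lengths \<omega>"
  shows "0 < stay2 \<omega> n" "0 < stay1 \<omega> n" "0 < uso_gap \<omega> n"
  using assms by (auto simp: positive_lengths_def)

lemma uso_time_Suc: "uso_time \<omega> (Suc k) = uso_time \<omega> k + uso_gap \<omega> (Suc k)"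
  by (simp add: uso_time_def)

lemma uso_time_strict_mono:
  assumes "positive_lengths \<omega>"
  shows "strict_mono (uso_time \<omega>)"
  using positive_lengthsD(3)[OF assms] by (auto simp: strict_mono_Suc_iff uso_time_Suc)

lemma uso_time_pos: "positive_lengths \<omega> \<Longrightarrow> 0 < uso_time \<omega> k"
  unfolding uso_time_def using positive_lengthsD(3)[of \<omega>] by (intro sum_pos) auto

text \<open>
  The starting time of the clock that rings at the \<open>k\<close>-th unscheduled opportunity.
\<close>

definition prev_uso :: "outcome \<Rightarrow> nat \<Rightarrow> real" where
  "prev_uso \<omega> k = (\<Sum>j<k. uso_gap \<omega> j)"

lemma uso_time_eq: "uso_time \<omega> k = prev_uso \<omega> k + uso_gap \<omega> k"
  by (simp add: uso_time_def prev_uso_def lessThan_Suc_atMost[symmetric])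

lemma prev_uso_simps: "prev_uso \<omega> 0 = 0" "prev_uso \<omega> (Suc k) = uso_time \<omega> k"
  by (simp_all add: uso_time_def prev_uso_def lessThan_Suc_atMost)

lemma prev_uso_mono:
  assumes "positive_lengths \<omega>" "i < j"
  shows "uso_time \<omega> i \<le> prev_uso \<omega> j"
  using assms(2) strict_mono_less_eq[OF uso_time_strict_mono[OF assms(1)]]
  by (cases j) (auto simp: prev_uso_simps)

lemma prev_uso_interval_unique:
  assumes "positive_lengths \<omega>"
    "prev_uso \<omega> i < s" "s \<le> uso_time \<omega> i" "prev_uso \<omega> j < s" "s \<le> uso_time \<omega> j"
  shows "i = j"
  using prev_uso_mono[OF assms(1), of i j] prev_uso_mono[OF assms(1), of j i] assms(2-)
  by (cases i j rule: linorder_cases) auto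

definition usos_unbounded :: "outcome \<Rightarrow> bool" where
  "usos_unbounded \<omega> \<longleftrightarrow> (\<forall>s. \<exists>k. s < uso_time \<omega> k)"

lemma ex_prev_uso_interval:
  assumes "positive_lengths \<omega>" "usos_unbounded \<omega>" "0 < s"
  shows "\<exists>k. prev_uso \<omega> k < s \<and> s \<le> uso_time \<omega> k"
proof -
  define k where "k = (LEAST k. s \<le> uso_time \<omega> k)"
  have ex: "\<exists>k. s \<le> uso_time \<omega> k" using assms(2) by (auto simp: usos_unbounded_def intro: less_imp_le)
  then have "s \<le> uso_time \<omega> k" unfolding k_def by (rule LeastI_ex)
  moreover have "prev_uso \<omega> k < s"
  proof (cases k)
    case (Suc j)
    then have "\<not> s \<le> uso_time \<omega> j" using not_less_Least[of j "\<lambda>k. s \<le> uso_time \<omega> k"] by (simp add: k_def)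
    then show ?thesis using Suc by (simp add: prev_uso_simps)
  qed (use assms in \<open>simp add: prev_uso_simps\<close>)
  ultimately show ?thesis by blast
qed

locale opportunity_policy =
  fixes \<tau> tcut :: real
  assumes \<tau>_pos: "0 < \<tau>" and tcut_pos: "0 < tcut"
begin

abbreviation epochs where "epochs \<equiv> renewing_epochs \<tau> tcut"

abbreviation enter where "enter \<equiv> enter1 \<tau> tcut"

abbreviation leave where "leave \<equiv> leave1 \<tau> tcut"

abbreviation sat where "sat \<omega> s \<equiv> cond_at \<tau> tcut \<omega> s = Satisfactory"

text \<open>
  This equivalence and the next trade the infimum for a countable disjunction, which serves both
  pathwise arguments and measurability.
\<close>

lemma stay1_end_less_iff:
  "stay1_end \<tau> tcut \<omega> n u < s \<longleftrightarrow> u + stay1 \<omega> n < s \<or> (\<exists>h\<in>epochs \<omega>. u \<le> h \<and> h < s)"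
proof -
  have "bdd_below (insert (u + stay1 \<omega> n) {h \<in> epochs \<omega>. u \<le> h})"
    by (auto simp: bdd_below_def intro!: exI[of _ "min u (u + stay1 \<omega> n)"])
  then show ?thesis
    unfolding stay1_end_def by (subst cInf_less_iff) auto
qed

lemma le_stay1_end_iff:
  "s \<le> stay1_end \<tau> tcut \<omega> n u \<longleftrightarrow> s \<le> u + stay1 \<omega> n \<and> (\<forall>h\<in>epochs \<omega>. u \<le> h \<longrightarrow> s \<le> h)"
  using stay1_end_less_iff[of \<omega> n u s] by (auto simp: not_less[symmetric])

lemma leave_less_iff:
  "leave \<omega> n < s \<longleftrightarrow> enter \<omega> n + stay1 \<omega> n < s \<or> (\<exists>h\<in>epochs \<omega>. enter \<omega> n \<le> h \<and> h < s)"
  by (simp add: leave1_def stay1_end_less_iff)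

lemma le_leave_iff:
  "s \<le> leave \<omega> n \<longleftrightarrow> s \<le> enter \<omega> n + stay1 \<omega> n \<and> (\<forall>h\<in>epochs \<omega>. enter \<omega> n \<le> h \<longrightarrow> s \<le> h)"
  by (simp add: leave1_def le_stay1_end_iff)

lemma enter_Suc: "enter \<omega> (Suc n) = leave \<omega> n + stay2 \<omega> (Suc n)"
  by (simp add: leave1_def)

declare enter1.simps(2) [simp del]

lemma leave_le_full_stay: "leave \<omega> n \<le> enter \<omega> n + stay1 \<omega> n"
  using le_leave_iff[of "leave \<omega> n" \<omega> n] by simp

lemma enter_le_leave: "positive_lengths \<omega> \<Longrightarrow> enter \<omega> n \<le> leave \<omega> n"
  using positive_lengthsD(2)[of \<omega> n] by (simp add: le_leave_iff less_imp_le)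

lemma leave_less_enter_Suc: "positive_lengths \<omega> \<Longrightarrow> leave \<omega> n < enter \<omega> (Suc n)"
  using positive_lengthsD(1)[of \<omega> "Suc n"] by (simp add: enter_Suc)

lemma leave_less_enter:
  assumes "positive_lengths \<omega>" "m < n"
  shows "leave \<omega> m < enter \<omega> n"
  using assms(2)
proof (induction n)
  case (Suc n)
  have "leave \<omega> n < enter \<omega> (Suc n)" using leave_less_enter_Suc[OF assms(1)] .
  moreover have "m = n \<or> leave \<omega> m < leave \<omega> n"
    using Suc enter_le_leave[OF assms(1), of n] by (fastforce simp: less_Suc_eq)
  ultimately show ?case by auto
qed simp

lemma enter_nonneg: "positive_lengths \<omega> \<Longrightarrow> 0 \<le> enter \<omega> n"
proof (induction n)
  case 0 then show ?case using positive_lengthsD(1)[of \<omega> 0] by auto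
next
  case (Suc n) then show ?case
    using enter_le_leave[of \<omega> n] leave_less_enter_Suc[of \<omega> n] by linarith
qed

lemma enter_Suc_pos: "positive_lengths \<omega> \<Longrightarrow> 0 < enter \<omega> (Suc n)"
  using enter_nonneg[of \<omega> n] enter_le_leave[of \<omega> n] leave_less_enter_Suc[of \<omega> n] by linarith

lemma enter_eq_0_iff:
  "positive_lengths \<omega> \<Longrightarrow> enter \<omega> n = 0 \<longleftrightarrow> n = 0 \<and> initial_cond \<omega> = Satisfactory"
  using enter_Suc_pos[of \<omega>] positive_lengthsD(1)[of \<omega> 0] by (cases n) (auto simp: less_le)

lemma in_stay1_unique:
  assumes "positive_lengths \<omega>" "enter \<omega> m \<le> s" "s \<le> leave \<omega> m" "enter \<omega> n \<le> s" "s \<le> leave \<omega> n"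
  shows "m = n"
  using leave_less_enter[OF assms(1), of m n] leave_less_enter[OF assms(1), of n m] assms(2-)
  by (cases m n rule: linorder_cases) auto

lemma cond_at_eq_Satisfactory:
  "cond_at \<tau> tcut \<omega> s = Satisfactory \<longleftrightarrow> (\<exists>n. enter \<omega> n \<le> s \<and> s \<le> leave \<omega> n)"
  by (simp add: cond_at_def)

lemma suminf_in_stay1:
  assumes pos: "positive_lengths \<omega>"
  shows "(\<Sum>n. of_bool (enter \<omega> n \<le> s \<and> s \<le> leave \<omega> n)) = (of_bool (sat \<omega> s) :: ennreal)"
  unfolding cond_at_eq_Satisfactory
  by (rule suminf_of_bool_unique) (auto dest: in_stay1_unique[OF pos])

text \<open>
  Induction over the stays. An entrance at or before \<open>s\<close> is preceded by a stay in condition 2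
  of positive length, hence the departure before it happens strictly before \<open>s\<close>, and departures strictly
  before \<open>s\<close> are determined by the renewing epochs strictly before \<open>s\<close>.
\<close>

lemma enter_causal:
  assumes pos: "positive_lengths \<omega>"
    and same: "initial_cond \<omega>' = initial_cond \<omega>" "stay2 \<omega>' = stay2 \<omega>" "stay1 \<omega>' = stay1 \<omega>"
    and epochs: "\<And>h. h < s \<Longrightarrow> h \<in> epochs \<omega>' \<longleftrightarrow> h \<in> epochs \<omega>"
  shows "(enter \<omega> n \<le> s \<longleftrightarrow> enter \<omega>' n \<le> s) \<and> (enter \<omega> n \<le> s \<longrightarrow> enter \<omega>' n = enter \<omega> n)"
proof (induction n)
  case 0
  show ?case by (simp add: same)
next
  case (Suc n)
  have p: "0 < stay2 \<omega> (Suc n)" "0 < stay1 \<omega> n" using positive_lengthsD[OF pos] by auto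
  show ?case
  proof (cases "enter \<omega> n \<le> s")
    case True
    then have eq: "enter \<omega>' n = enter \<omega> n" using Suc by simp
    have *: "leave \<omega> n < r \<longleftrightarrow> leave \<omega>' n < r" if "r \<le> s" for r
      unfolding leave_less_iff eq same using epochs that by fastforce
    have "leave \<omega>' n = leave \<omega> n" if "leave \<omega> n < s \<or> leave \<omega>' n < s"
      using *[of s] *[of "leave \<omega> n"] *[of "leave \<omega>' n"] that by force
    then show ?thesis using p by (auto simp: enter_Suc same)
  next
    case False
    then have "\<not> enter \<omega>' n \<le> s" using Suc by simp
    moreover have "enter \<omega>' n \<le> leave \<omega>' n" using p by (simp add: le_leave_iff same less_imp_le)
    ultimately show ?thesis using p enter_le_leave[OF pos, of n] False by (auto simp: enter_Suc same)
  qed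
qed

text \<open>
  The condition found at time \<open>s\<close> ignores all renewing epochs from \<open>s\<close> on, including one at \<open>s\<close> itself,
  because maintenance at \<open>s\<close> takes place after the inspection.
\<close>

lemma cond_at_causal:
  assumes pos: "positive_lengths \<omega>"
    and same: "initial_cond \<omega>' = initial_cond \<omega>" "stay2 \<omega>' = stay2 \<omega>" "stay1 \<omega>' = stay1 \<omega>"
    and epochs: "\<And>h. h < s \<Longrightarrow> h \<in> epochs \<omega>' \<longleftrightarrow> h \<in> epochs \<omega>"
  shows "cond_at \<tau> tcut \<omega>' s = cond_at \<tau> tcut \<omega> s"
proof -
  have "enter \<omega>' n \<le> s \<and> s \<le> leave \<omega>' n \<longleftrightarrow> enter \<omega> n \<le> s \<and> s \<le> leave \<omega> n" for n
  proof -
    have e: "(enter \<omega> n \<le> s \<longleftrightarrow> enter \<omega>' n \<le> s) \<and> (enter \<omega> n \<le> s \<longrightarrow> enter \<omega>' n = enter \<omega> n)"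
      by (rule enter_causal[OF assms])
    show ?thesis
    proof (cases "enter \<omega> n \<le> s")
      case True
      then have eq: "enter \<omega>' n = enter \<omega> n" using e by simp
      have "leave \<omega> n < s \<longleftrightarrow> leave \<omega>' n < s"
        unfolding leave_less_iff eq same using epochs by fastforce
      then show ?thesis using eq by auto
    qed (use e in auto)
  qed
  then show ?thesis by (simp add: cond_at_def)
qed

lemma so_time_strict_mono: "strict_mono (so_time \<tau>)"
  using \<tau>_pos by (auto simp: strict_mono_Suc_iff so_time_def)

lemma so_time_unbounded: "\<exists>k. s < so_time \<tau> k"
proof -
  obtain k where "s / \<tau> < real k" using reals_Archimedean2 by blast
  then show ?thesis using \<tau>_pos by (auto simp: so_time_def field_simps intro!: exI[of _ k])
qed

lemma remaining_so_time [simp]: "remaining \<tau> (so_time \<tau> k) = 0"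
  using \<tau>_pos by (simp add: remaining_def so_time_def)

lemma finite_epochs_below:
  assumes "positive_lengths \<omega>" "usos_unbounded \<omega>"
  shows "finite {h \<in> epochs \<omega>. h < s}"
proof -
  have "{h \<in> epochs \<omega>. h < s} \<subseteq> so_time \<tau> ` {k. so_time \<tau> k < s} \<union> uso_time \<omega> ` {k. uso_time \<omega> k < s}"
    by (auto simp: renewing_epochs_def)
  moreover have "finite \<dots>"
    using finite_below_strict_mono[OF so_time_strict_mono so_time_unbounded]
      finite_below_strict_mono[OF uso_time_strict_mono[OF assms(1)]] assms(2)
    by (auto simp: usos_unbounded_def)
  ultimately show ?thesis by (rule finite_subset)
qed

lemma countable_epochs: "countable (epochs \<omega>)"
proof (rule countable_subset)
  show "epochs \<omega> \<subseteq> range (so_time \<tau>) \<union> range (uso_time \<omega>)" by (auto simp: renewing_epochs_def)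
qed auto

text \<open>
  Renewing epochs do not accumulate, so the infimum that ends a stay is attained.
\<close>

lemma leave_in_epochs:
  assumes "positive_lengths \<omega>" "usos_unbounded \<omega>" "leave \<omega> n \<noteq> enter \<omega> n + stay1 \<omega> n"
  shows "leave \<omega> n \<in> epochs \<omega>"
proof -
  let ?A = "{h \<in> epochs \<omega>. h < enter \<omega> n + stay1 \<omega> n} \<inter> {enter \<omega> n..}"
  have lt: "leave \<omega> n < enter \<omega> n + stay1 \<omega> n"
    using assms(3) leave_le_full_stay[of \<omega> n] by simp
  then have "?A \<noteq> {}" by (subst (asm) leave_less_iff) auto
  moreover have "finite ?A" using finite_epochs_below[OF assms(1,2)] by auto
  ultimately have m: "Min ?A \<in> ?A" "\<And>h. h \<in> ?A \<Longrightarrow> Min ?A \<le> h"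
    using Min_in[of ?A] Min_le[of ?A] by blast+
  have "Min ?A \<le> leave \<omega> n"
    using m by (subst le_leave_iff) (force simp: not_less[symmetric])
  moreover have "leave \<omega> n \<le> Min ?A"
    using m(1) le_leave_iff[of "leave \<omega> n" \<omega> n] by auto
  ultimately show ?thesis using m(1) by auto
qed

text \<open>
  Each departure has exactly one cause. Scheduled and unscheduled causes exclude each other because
  the remaining time is 0 at a scheduled opportunity and exceeds \<open>tcut\<close> at a usable unscheduled one.
  Writing the cause as a sum over all opportunities is what later allows each of them to be
  treated separately.
\<close>

lemma leave_less_decomposition:
  assumes pos: "positive_lengths \<omega>" and unb: "usos_unbounded \<omega>"
    and tie: "enter \<omega> n + stay1 \<omega> n \<notin> epochs \<omega>"
  shows "(of_bool (leave \<omega> n < s) :: ennreal) =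
    of_bool (leave \<omega> n = enter \<omega> n + stay1 \<omega> n \<and> leave \<omega> n < s) +
    (\<Sum>k. of_bool (so_success \<omega> k \<and> so_time \<tau> k < s \<and> enter \<omega> n \<le> so_time \<tau> k \<and> so_time \<tau> k \<le> leave \<omega> n)) +
    (\<Sum>k. of_bool (uso_success \<omega> k \<and> uso_time \<omega> k < s \<and> tcut < remaining \<tau> (uso_time \<omega> k) \<and>
        enter \<omega> n \<le> uso_time \<omega> k \<and> uso_time \<omega> k \<le> leave \<omega> n))"
proof -
  let ?A = "\<lambda>k. so_success \<omega> k \<and> so_time \<tau> k < s \<and> enter \<omega> n \<le> so_time \<tau> k \<and> so_time \<tau> k \<le> leave \<omega> n"
  let ?B = "\<lambda>k. uso_success \<omega> k \<and> uso_time \<omega> k < s \<and> tcut < remaining \<tau> (uso_time \<omega> k) \<and>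
        enter \<omega> n \<le> uso_time \<omega> k \<and> uso_time \<omega> k \<le> leave \<omega> n"
  have ep: "h = leave \<omega> n" if "h \<in> epochs \<omega>" "enter \<omega> n \<le> h" "h \<le> leave \<omega> n" for h
    using that le_leave_iff[of "leave \<omega> n" \<omega> n] by auto
  have A: "so_time \<tau> k = leave \<omega> n" if "?A k" for k
    using that by (intro ep) (auto simp: renewing_epochs_def)
  have B: "uso_time \<omega> k = leave \<omega> n" if "?B k" for k
    using that by (intro ep) (auto simp: renewing_epochs_def)
  have "(\<Sum>k. of_bool (?A k)) = (of_bool (\<exists>k. ?A k) :: ennreal)"
    using A strict_mono_eq[OF so_time_strict_mono] by (intro suminf_of_bool_unique) metis
  moreover have "(\<Sum>k. of_bool (?B k)) = (of_bool (\<exists>k. ?B k) :: ennreal)"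
    using B strict_mono_eq[OF uso_time_strict_mono[OF pos]] by (intro suminf_of_bool_unique) metis
  moreover have "\<not> ((\<exists>k. ?A k) \<and> (\<exists>k. ?B k))"
    using A B tcut_pos remaining_so_time by (metis not_less_iff_gr_or_eq)
  moreover have "(\<exists>k. ?A k) \<or> (\<exists>k. ?B k) \<longleftrightarrow> leave \<omega> n \<in> epochs \<omega> \<and> leave \<omega> n < s"
  proof
    assume "(\<exists>k. ?A k) \<or> (\<exists>k. ?B k)"
    then obtain k where "?A k \<or> ?B k" by blast
    then show "leave \<omega> n \<in> epochs \<omega> \<and> leave \<omega> n < s"
    proof
      assume k: "?A k"
      then have "leave \<omega> n = so_time \<tau> k" using A[of k] by simp
      then show ?thesis using k by (auto simp: renewing_epochs_def)
    next
      assume k: "?B k"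
      then have "leave \<omega> n = uso_time \<omega> k" using B[of k] by simp
      then show ?thesis using k by (auto simp: renewing_epochs_def)
    qed
  next
    assume *: "leave \<omega> n \<in> epochs \<omega> \<and> leave \<omega> n < s"
    then show "(\<exists>k. ?A k) \<or> (\<exists>k. ?B k)"
      using enter_le_leave[OF pos, of n] by (auto simp: renewing_epochs_def)
  qed
  moreover have "leave \<omega> n \<in> epochs \<omega> \<longleftrightarrow> leave \<omega> n \<noteq> enter \<omega> n + stay1 \<omega> n"
    using leave_in_epochs[OF pos unb, of n] tie by auto
  moreover have "(of_bool l :: ennreal) = of_bool (f \<and> l) + of_bool a + of_bool b"
    if "\<not> (a \<and> b)" "a \<or> b \<longleftrightarrow> r \<and> l" "r \<longleftrightarrow> \<not> f" for a b f l r
    using that by (cases a; cases b) auto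
  ultimately show ?thesis by (simp only:)
qed

end

section \<open>The coordinates of the model\<close>

text \<open>
  Each of these overwrites one of the independent coordinates, to be combined with \<open>resamples\<close>.
\<close>

fun upd_stay2 :: "nat \<Rightarrow> real \<Rightarrow> outcome \<Rightarrow> outcome"
  where "upd_stay2 n x (c, d2, d1, g, bso, buso) = (c, d2(n := x), d1, g, bso, buso)"

fun upd_stay1 :: "nat \<Rightarrow> real \<Rightarrow> outcome \<Rightarrow> outcome"
  where "upd_stay1 n x (c, d2, d1, g, bso, buso) = (c, d2, d1(n := x), g, bso, buso)"

fun upd_gap :: "nat \<Rightarrow> real \<Rightarrow> outcome \<Rightarrow> outcome"
  where "upd_gap n x (c, d2, d1, g, bso, buso) = (c, d2, d1, g(n := x), bso, buso)"

fun upd_so :: "nat \<Rightarrow> bool \<Rightarrow> outcome \<Rightarrow> outcome"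
  where "upd_so n b (c, d2, d1, g, bso, buso) = (c, d2, d1, g, bso(n := b), buso)"

fun upd_uso :: "nat \<Rightarrow> bool \<Rightarrow> outcome \<Rightarrow> outcome"
  where "upd_uso n b (c, d2, d1, g, bso, buso) = (c, d2, d1, g, bso, buso(n := b))"

lemma upd_simps [simp]:
  "initial_cond (upd_stay2 n x \<omega>) = initial_cond \<omega>" "stay2 (upd_stay2 n x \<omega>) = (stay2 \<omega>)(n := x)"
  "stay1 (upd_stay2 n x \<omega>) = stay1 \<omega>" "uso_gap (upd_stay2 n x \<omega>) = uso_gap \<omega>"
  "so_success (upd_stay2 n x \<omega>) = so_success \<omega>" "uso_success (upd_stay2 n x \<omega>) = uso_success \<omega>"
  "initial_cond (upd_stay1 n x \<omega>) = initial_cond \<omega>" "stay2 (upd_stay1 n x \<omega>) = stay2 \<omega>"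
  "stay1 (upd_stay1 n x \<omega>) = (stay1 \<omega>)(n := x)" "uso_gap (upd_stay1 n x \<omega>) = uso_gap \<omega>"
  "so_success (upd_stay1 n x \<omega>) = so_success \<omega>" "uso_success (upd_stay1 n x \<omega>) = uso_success \<omega>"
  "initial_cond (upd_gap n x \<omega>) = initial_cond \<omega>" "stay2 (upd_gap n x \<omega>) = stay2 \<omega>"
  "stay1 (upd_gap n x \<omega>) = stay1 \<omega>" "uso_gap (upd_gap n x \<omega>) = (uso_gap \<omega>)(n := x)"
  "so_success (upd_gap n x \<omega>) = so_success \<omega>" "uso_success (upd_gap n x \<omega>) = uso_success \<omega>"
  "initial_cond (upd_so n b \<omega>) = initial_cond \<omega>" "stay2 (upd_so n b \<omega>) = stay2 \<omega>"
  "stay1 (upd_so n b \<omega>) = stay1 \<omega>" "uso_gap (upd_so n b \<omega>) = uso_gap \<omega>"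
  "so_success (upd_so n b \<omega>) = (so_success \<omega>)(n := b)" "uso_success (upd_so n b \<omega>) = uso_success \<omega>"
  "initial_cond (upd_uso n b \<omega>) = initial_cond \<omega>" "stay2 (upd_uso n b \<omega>) = stay2 \<omega>"
  "stay1 (upd_uso n b \<omega>) = stay1 \<omega>" "uso_gap (upd_uso n b \<omega>) = uso_gap \<omega>"
  "so_success (upd_uso n b \<omega>) = so_success \<omega>" "uso_success (upd_uso n b \<omega>) = (uso_success \<omega>)(n := b)"
  by (cases \<omega>; simp)+

lemma uso_time_upd [simp]:
  "uso_time (upd_stay1 n x \<omega>) = uso_time \<omega>" "uso_time (upd_stay2 n x \<omega>) = uso_time \<omega>"
  "uso_time (upd_so n b \<omega>) = uso_time \<omega>" "uso_time (upd_uso n b \<omega>) = uso_time \<omega>"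
  by (simp_all add: uso_time_def fun_eq_iff)

lemma uso_time_upd_gap:
  assumes "j < k" shows "uso_time (upd_gap k x \<omega>) j = uso_time \<omega> j"
  unfolding uso_time_def using assms by (intro sum.cong) auto

lemma prev_uso_upd_gap [simp]: "prev_uso (upd_gap k x \<omega>) k = prev_uso \<omega> k"
  unfolding prev_uso_def by (intro sum.cong) auto

lemma positive_upd_gap: "positive_lengths \<omega> \<Longrightarrow> 0 < x \<Longrightarrow> positive_lengths (upd_gap k x \<omega>)"
  by (auto simp: positive_lengths_def)

lemma initial_cond_eq: "initial_cond = fst" by (auto simp: fun_eq_iff)

lemma stay2_eq: "stay2 = (\<lambda>\<omega>. fst (snd \<omega>))" by (auto simp: fun_eq_iff)

lemma stay1_eq: "stay1 = (\<lambda>\<omega>. fst (snd (snd \<omega>)))" by (auto simp: fun_eq_iff)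

lemma uso_gap_eq: "uso_gap = (\<lambda>\<omega>. fst (snd (snd (snd \<omega>))))" by (auto simp: fun_eq_iff)

lemma so_success_eq: "so_success = (\<lambda>\<omega>. fst (snd (snd (snd (snd \<omega>)))))" by (auto simp: fun_eq_iff)

lemma uso_success_eq: "uso_success = (\<lambda>\<omega>. snd (snd (snd (snd (snd \<omega>)))))" by (auto simp: fun_eq_iff)

locale maintenance_model = opportunity_policy \<tau> tcut for \<tau> tcut :: real +
  fixes \<mu>1 \<mu>2 lam p :: real and init :: "cond pmf"
  assumes \<mu>1_pos: "0 < \<mu>1" and \<mu>2_pos: "0 < \<mu>2" and lam_pos: "0 < lam"
    and p_pos: "0 < p" and p_less_1: "p < 1" and tcut_less: "tcut < \<tau>"
begin

abbreviation M where "M \<equiv> model \<mu>1 \<mu>2 lam p init"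

lemma prob_space_coordinates:
  "prob_space (measure_pmf init)"
  "prob_space (\<Pi>\<^sub>M n\<in>(UNIV :: nat set). exponential \<mu>2)"
  "prob_space (\<Pi>\<^sub>M n\<in>(UNIV :: nat set). exponential \<mu>1)"
  "prob_space (\<Pi>\<^sub>M n\<in>(UNIV :: nat set). exponential lam)"
  "prob_space (\<Pi>\<^sub>M n\<in>(UNIV :: nat set). measure_pmf (bernoulli_pmf p))"
  using \<mu>1_pos \<mu>2_pos lam_pos
  by (auto intro!: prob_space_PiM prob_space_exponential prob_space_measure_pmf)

sublocale prob_space M
  unfolding model_def by (intro prob_space_pair prob_space_coordinates)

lemma space_M [simp]: "space M = UNIV"
  by (simp add: model_def space_pair_measure space_PiM PiE_def Pi_def extensional_def)

lemmas prob_space_model_rules =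
  prob_space_pair prob_space_coordinates prob_space_measure_pmf prob_space_exponential \<mu>1_pos \<mu>2_pos lam_pos

lemma resamples_stay2: "resamples M (exponential \<mu>2) (upd_stay2 n)"
proof -
  have eq: "upd_stay2 n = (\<lambda>x z. (fst z, (fst (snd z))(n := x), snd (snd z)))"
    by (auto simp: fun_eq_iff)
  show ?thesis unfolding model_def eq
    by (rule resamples_snd[OF resamples_fst[OF resamples_PiM[of "\<lambda>_. exponential \<mu>2" n]]])
      (intro prob_space_model_rules)+
qed

lemma resamples_stay1: "resamples M (exponential \<mu>1) (upd_stay1 n)"
proof -
  have eq: "upd_stay1 n = (\<lambda>x z. (fst z, fst (snd z), (fst (snd (snd z)))(n := x), snd (snd (snd z))))"
    by (auto simp: fun_eq_iff)
  show ?thesis unfolding model_def eq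
    by (rule resamples_snd[OF resamples_snd[OF resamples_fst[OF resamples_PiM[of "\<lambda>_. exponential \<mu>1" n]]]])
      (intro prob_space_model_rules)+
qed

lemma resamples_gap: "resamples M (exponential lam) (upd_gap n)"
proof -
  have eq: "upd_gap n = (\<lambda>x z. (fst z, fst (snd z), fst (snd (snd z)), (fst (snd (snd (snd z))))(n := x), snd (snd (snd (snd z)))))"
    by (auto simp: fun_eq_iff)
  show ?thesis unfolding model_def eq
    by (rule resamples_snd[OF resamples_snd[OF resamples_snd[OF resamples_fst[OF resamples_PiM[of "\<lambda>_. exponential lam" n]]]]])
      (intro prob_space_model_rules)+
qed

lemma resamples_so: "resamples M (measure_pmf (bernoulli_pmf p)) (upd_so n)"
proof -
  have eq: "upd_so n = (\<lambda>x z. (fst z, fst (snd z), fst (snd (snd z)), fst (snd (snd (snd z))),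
      (fst (snd (snd (snd (snd z)))))(n := x), snd (snd (snd (snd (snd z))))))"
    by (auto simp: fun_eq_iff)
  show ?thesis unfolding model_def eq
    by (rule resamples_snd[OF resamples_snd[OF resamples_snd[OF resamples_snd[OF resamples_fst[OF resamples_PiM[of "\<lambda>_. measure_pmf (bernoulli_pmf p)" n]]]]]])
      (intro prob_space_model_rules)+
qed

lemma resamples_uso: "resamples M (measure_pmf (bernoulli_pmf p)) (upd_uso n)"
proof -
  have eq: "upd_uso n = (\<lambda>x z. (fst z, fst (snd z), fst (snd (snd z)), fst (snd (snd (snd z))),
      fst (snd (snd (snd (snd z)))), (snd (snd (snd (snd (snd z)))))(n := x)))"
    by (auto simp: fun_eq_iff)
  show ?thesis unfolding model_def eq
    by (rule resamples_snd[OF resamples_snd[OF resamples_snd[OF resamples_snd[OF resamples_snd[OF resamples_PiM[of "\<lambda>_. measure_pmf (bernoulli_pmf p)" n]]]]]])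
      (intro prob_space_model_rules)+
qed

lemma nn_integral_initial: "(\<integral>\<^sup>+\<omega>. of_bool (initial_cond \<omega> = c) \<partial>M) = ennreal (pmf init c)"
proof -
  have "(\<integral>\<^sup>+\<omega>. of_bool (initial_cond \<omega> = c) \<partial>M) = (\<integral>\<^sup>+\<omega>. indicator {c} (fst \<omega>) \<partial>M)"
    by (intro nn_integral_cong) (auto simp: initial_cond_eq indicator_def)
  also have "\<dots> = (\<integral>\<^sup>+x. indicator {c} x \<partial>measure_pmf init)"
  proof -
    define M' where "M' = (\<Pi>\<^sub>M n\<in>(UNIV :: nat set). exponential \<mu>2)
      \<Otimes>\<^sub>M (\<Pi>\<^sub>M n\<in>(UNIV :: nat set). exponential \<mu>1)
      \<Otimes>\<^sub>M (\<Pi>\<^sub>M n\<in>(UNIV :: nat set). exponential lam)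
      \<Otimes>\<^sub>M (\<Pi>\<^sub>M n\<in>(UNIV :: nat set). measure_pmf (bernoulli_pmf p))
      \<Otimes>\<^sub>M (\<Pi>\<^sub>M n\<in>(UNIV :: nat set). measure_pmf (bernoulli_pmf p))"
    interpret M': prob_space M'
      unfolding M'_def by (intro prob_space_pair prob_space_coordinates)
    have "(\<integral>\<^sup>+\<omega>. indicator {c} (fst \<omega>) \<partial>(measure_pmf init \<Otimes>\<^sub>M M')) =
      (\<integral>\<^sup>+x. \<integral>\<^sup>+y. indicator {c} (fst (x, y)) \<partial>M' \<partial>measure_pmf init)"
      by (rule M'.nn_integral_fst[symmetric], rule measurable_compose[OF measurable_fst]) simp
    then show ?thesis using M'.emeasure_space_1 by (simp add: model_def M'_def)
  qed
  also have "\<dots> = ennreal (pmf init c)" by (simp add: emeasure_pmf_single)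
  finally show ?thesis .
qed

lemma sets_M: "sets M = sets (count_space UNIV \<Otimes>\<^sub>M (\<Pi>\<^sub>M n\<in>(UNIV :: nat set). borel :: real measure)
   \<Otimes>\<^sub>M (\<Pi>\<^sub>M n\<in>(UNIV :: nat set). borel :: real measure) \<Otimes>\<^sub>M (\<Pi>\<^sub>M n\<in>(UNIV :: nat set). borel :: real measure)
   \<Otimes>\<^sub>M (\<Pi>\<^sub>M n\<in>(UNIV :: nat set). count_space (UNIV :: bool set)) \<Otimes>\<^sub>M (\<Pi>\<^sub>M n\<in>(UNIV :: nat set). count_space (UNIV :: bool set)))"
  unfolding model_def by (intro sets_pair_measure_cong sets_PiM_cong) auto

lemma measurable_coordinates:
  "initial_cond \<in> M \<rightarrow>\<^sub>M count_space UNIV"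
  "(\<lambda>\<omega>. stay2 \<omega> n) \<in> borel_measurable M"
  "(\<lambda>\<omega>. stay1 \<omega> n) \<in> borel_measurable M"
  "(\<lambda>\<omega>. uso_gap \<omega> n) \<in> borel_measurable M"
  "Measurable.pred M (\<lambda>\<omega>. so_success \<omega> n)"
  "Measurable.pred M (\<lambda>\<omega>. uso_success \<omega> n)"
  unfolding measurable_cong_sets[OF sets_M refl] initial_cond_eq stay2_eq stay1_eq uso_gap_eq
    so_success_eq uso_success_eq
  by measurable

lemma measurable_coordinates_compose [measurable (raw)]:
  assumes "f \<in> K \<rightarrow>\<^sub>M M"
  shows "(\<lambda>x. initial_cond (f x)) \<in> K \<rightarrow>\<^sub>M count_space UNIV"
  "(\<lambda>x. stay2 (f x) n) \<in> borel_measurable K"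
  "(\<lambda>x. stay1 (f x) n) \<in> borel_measurable K"
  "(\<lambda>x. uso_gap (f x) n) \<in> borel_measurable K"
  "Measurable.pred K (\<lambda>x. so_success (f x) n)"
  "Measurable.pred K (\<lambda>x. uso_success (f x) n)"
  using measurable_compose[OF assms measurable_coordinates(1)]
    measurable_compose[OF assms measurable_coordinates(2)]
    measurable_compose[OF assms measurable_coordinates(3)]
    measurable_compose[OF assms measurable_coordinates(4)]
    measurable_compose[OF assms measurable_coordinates(5)]
    measurable_compose[OF assms measurable_coordinates(6)]
  by simp_all

lemma measurable_uso_time [measurable (raw)]:
  "f \<in> K \<rightarrow>\<^sub>M M \<Longrightarrow> (\<lambda>x. uso_time (f x) k) \<in> borel_measurable K"
  unfolding uso_time_def by measurable

lemma measurable_prev_uso [measurable (raw)]: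
  "f \<in> K \<rightarrow>\<^sub>M M \<Longrightarrow> (\<lambda>x. prev_uso (f x) k) \<in> borel_measurable K"
  unfolding prev_uso_def by measurable

lemma measurable_remaining [measurable (raw)]:
  assumes [measurable]: "s \<in> borel_measurable K"
  shows "(\<lambda>x. remaining \<tau> (s x)) \<in> borel_measurable K"
  unfolding remaining_def by simp

lemma measurable_renewing_epochs [measurable (raw)]:
  assumes [measurable]: "f \<in> K \<rightarrow>\<^sub>M M" "s \<in> borel_measurable K"
  shows "Measurable.pred K (\<lambda>x. s x \<in> epochs (f x))"
  unfolding renewing_epochs_def by simp

lemma Bex_renewing_epochs:
  "(\<exists>h\<in>epochs \<omega>. Q h) \<longleftrightarrow> (\<exists>k. so_success \<omega> k \<and> Q (so_time \<tau> k)) \<or>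
     (\<exists>k. uso_success \<omega> k \<and> tcut < remaining \<tau> (uso_time \<omega> k) \<and> Q (uso_time \<omega> k))"
  by (auto simp: renewing_epochs_def)

lemma measurable_stay1_end [measurable (raw)]:
  assumes [measurable]: "f \<in> K \<rightarrow>\<^sub>M M" "u \<in> borel_measurable K"
  shows "(\<lambda>x. stay1_end \<tau> tcut (f x) n (u x)) \<in> borel_measurable K"
  unfolding borel_measurable_iff_less stay1_end_less_iff Bex_renewing_epochs by measurable

lemma measurable_enter [measurable (raw)]:
  assumes [measurable]: "f \<in> K \<rightarrow>\<^sub>M M"
  shows "(\<lambda>x. enter (f x) n) \<in> borel_measurable K"
proof (induction n)
  case (Suc n)
  note [measurable] = Suc
  show ?case unfolding enter1.simps by measurable
qed simp

lemma measurable_leave [measurable (raw)]: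
  assumes [measurable]: "f \<in> K \<rightarrow>\<^sub>M M"
  shows "(\<lambda>x. leave (f x) n) \<in> borel_measurable K"
  unfolding leave1_def by measurable

lemma measurable_cond_at [measurable (raw)]:
  assumes [measurable]: "f \<in> K \<rightarrow>\<^sub>M M" "s \<in> borel_measurable K"
  shows "Measurable.pred K (\<lambda>x. cond_at \<tau> tcut (f x) (s x) = Satisfactory)"
  unfolding cond_at_eq_Satisfactory by measurable

lemma measurable_no_epoch_between [measurable (raw)]:
  assumes [measurable]: "f \<in> K \<rightarrow>\<^sub>M M" "s \<in> borel_measurable K" "u \<in> borel_measurable K"
  shows "Measurable.pred K (\<lambda>x. \<forall>h\<in>epochs (f x). u x \<le> h \<longrightarrow> s x \<le> h)"
proof -
  have "(\<forall>h\<in>epochs (f x). u x \<le> h \<longrightarrow> s x \<le> h) \<longleftrightarrow> \<not> (\<exists>h\<in>epochs (f x). u x \<le> h \<and> \<not> s x \<le> h)" for x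
    by auto
  then show ?thesis unfolding Bex_renewing_epochs by simp
qed

lemma AE_positive_lengths: "AE \<omega> in M. positive_lengths \<omega>"
proof -
  have "AE \<omega> in M. 0 < stay2 \<omega> n" for n
    by (rule resamples_AE[OF resamples_stay2[of n] prob_space_axioms prob_space_exponential[OF \<mu>2_pos]])
      (auto intro: AE_exponential_pos)
  moreover have "AE \<omega> in M. 0 < stay1 \<omega> n" for n
    by (rule resamples_AE[OF resamples_stay1[of n] prob_space_axioms prob_space_exponential[OF \<mu>1_pos]])
      (auto intro: AE_exponential_pos)
  moreover have "AE \<omega> in M. 0 < uso_gap \<omega> n" for n
    by (rule resamples_AE[OF resamples_gap[of n] prob_space_axioms prob_space_exponential[OF lam_pos]])
      (auto intro: AE_exponential_pos)
  ultimately show ?thesis unfolding positive_lengths_def AE_all_countable by auto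
qed

section \<open>Unscheduled opportunities met in condition 1\<close>

text \<open>
  Overwriting the \<open>k\<close>-th gap moves the \<open>k\<close>-th unscheduled opportunity to \<open>prev_uso \<omega> k + x\<close> and later
  ones beyond it, so up to that time only the earlier ones are seen, and they stay in place.
\<close>

lemma in_epochs_upd_gap_iff:
  assumes pos: "positive_lengths \<omega>" and x: "0 < x" "s \<le> prev_uso \<omega> k + x" and h: "h < s"
  shows "h \<in> epochs (upd_gap k x \<omega>) \<longleftrightarrow> (\<exists>j. h = so_time \<tau> j \<and> so_success \<omega> j) \<or>
    (\<exists>j<k. h = uso_time \<omega> j \<and> tcut < remaining \<tau> (uso_time \<omega> j) \<and> uso_success \<omega> j)"
proof -
  have "j < k" if "h = uso_time (upd_gap k x \<omega>) j" for j
  proof (rule ccontr)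
    assume "\<not> j < k"
    then have "uso_time (upd_gap k x \<omega>) k \<le> uso_time (upd_gap k x \<omega>) j"
      using uso_time_strict_mono[OF positive_upd_gap[OF pos x(1)]] by (simp add: strict_mono_less_eq)
    then show False using that x h by (simp add: uso_time_eq)
  qed
  then have "h = uso_time (upd_gap k x \<omega>) j \<and> tcut < remaining \<tau> (uso_time (upd_gap k x \<omega>) j) \<and> uso_success \<omega> j
      \<longleftrightarrow> j < k \<and> h = uso_time \<omega> j \<and> tcut < remaining \<tau> (uso_time \<omega> j) \<and> uso_success \<omega> j" for j
    using uso_time_upd_gap[of j k x \<omega>] by (cases "j < k") auto
  then show ?thesis
    by (simp add: renewing_epochs_def)
qed

lemma cond_at_upd_gap:
  assumes pos: "positive_lengths \<omega>" and s: "prev_uso \<omega> k < s" "s \<le> prev_uso \<omega> k + x"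
  shows "cond_at \<tau> tcut (upd_gap k x \<omega>) s = cond_at \<tau> tcut (upd_gap k (s - prev_uso \<omega> k) \<omega>) s"
proof (rule cond_at_causal)
  show "positive_lengths (upd_gap k (s - prev_uso \<omega> k) \<omega>)"
    using positive_upd_gap[OF pos] s by simp
  show "h \<in> epochs (upd_gap k x \<omega>) \<longleftrightarrow> h \<in> epochs (upd_gap k (s - prev_uso \<omega> k) \<omega>)" if "h < s" for h
    using in_epochs_upd_gap_iff[OF pos _ _ that, of x k] in_epochs_upd_gap_iff[OF pos _ _ that, of "s - prev_uso \<omega> k" k] s
    by simp
qed simp_all

lemma nn_integral_uso_time:
  assumes [measurable]: "B \<in> sets borel"
  shows "(\<integral>\<^sup>+\<omega>. of_bool (uso_time \<omega> k \<in> B) \<partial>M) =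
    ennreal lam * (\<integral>\<^sup>+\<omega>. \<integral>\<^sup>+s. of_bool (s \<in> B) * of_bool (prev_uso \<omega> k < s \<and> s \<le> uso_time \<omega> k) \<partial>lborel \<partial>M)"
  unfolding uso_time_eq
  by (rule exponential_hazard[OF lam_pos resamples_gap[of k] prob_space_axioms _ _ _ AE_positive_lengths,
      where G="\<lambda>s \<omega>. of_bool (s \<in> B)"]) simp_all

text \<open>
  The clock is the \<open>k\<close>-th gap; what is observed when it rings is the condition found then.
\<close>

lemma nn_integral_uso_time_sat:
  assumes [measurable]: "B \<in> sets borel"
  shows "(\<integral>\<^sup>+\<omega>. of_bool (uso_time \<omega> k \<in> B \<and> sat \<omega> (uso_time \<omega> k)) \<partial>M) =
    ennreal lam * (\<integral>\<^sup>+\<omega>. \<integral>\<^sup>+s. of_bool (s \<in> B \<and> sat \<omega> s) *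
       of_bool (prev_uso \<omega> k < s \<and> s \<le> uso_time \<omega> k) \<partial>lborel \<partial>M)"
  unfolding uso_time_eq
proof (rule exponential_hazard[OF lam_pos resamples_gap[of k] prob_space_axioms _ _ _ AE_positive_lengths,
      where G="\<lambda>s \<omega>. of_bool (s \<in> B \<and> sat \<omega> s)"])
  show "of_bool (s \<in> B \<and> sat (upd_gap k x \<omega>) s) =
      (of_bool (s \<in> B \<and> sat (upd_gap k (s - prev_uso \<omega> k) \<omega>) s) :: ennreal)"
    if "positive_lengths \<omega>" "prev_uso \<omega> k < s" "s \<le> prev_uso \<omega> k + x" for \<omega> s x
    using cond_at_upd_gap[OF that] by simp
qed simp_all

text \<open>
  The intervals between successive opportunities are disjoint, so at most \<open>lam * N\<close> opportunities are
  expected up to time \<open>N\<close>, and almost surely only finitely many occur.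
\<close>

lemma AE_usos_unbounded: "AE \<omega> in M. usos_unbounded \<omega>"
proof -
  have "AE \<omega> in M. finite {k. uso_time \<omega> k \<in> {0<..real N}}" for N :: nat
  proof (rule AE_finite_of_summable_prob)
    have eq: "(\<Sum>k. \<integral>\<^sup>+\<omega>. of_bool (uso_time \<omega> k \<in> {0<..real N}) \<partial>M) =
      ennreal lam * (\<Sum>k. \<integral>\<^sup>+\<omega>. \<integral>\<^sup>+s. of_bool (s \<in> {0<..real N}) *
        of_bool (prev_uso \<omega> k < s \<and> s \<le> uso_time \<omega> k) \<partial>lborel \<partial>M)"
      by (subst nn_integral_uso_time) auto
    have "(\<Sum>k. \<integral>\<^sup>+\<omega>. \<integral>\<^sup>+s. of_bool (s \<in> {0<..real N}) *
        of_bool (prev_uso \<omega> k < s \<and> s \<le> uso_time \<omega> k) \<partial>lborel \<partial>M) =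
      (\<integral>\<^sup>+\<omega>. \<integral>\<^sup>+s. (\<Sum>k. of_bool (s \<in> {0<..real N}) *
        of_bool (prev_uso \<omega> k < s \<and> s \<le> uso_time \<omega> k)) \<partial>lborel \<partial>M)"
      by (rule lborel.suminf_nn_integral_nn_integral) measurable
    also have "\<dots> \<le> (\<integral>\<^sup>+\<omega>. \<integral>\<^sup>+s. indicator {0<..real N} s \<partial>lborel \<partial>M)"
    proof (rule nn_integral_mono_AE, use AE_positive_lengths in eventually_elim)
      fix \<omega> assume pos: "positive_lengths \<omega>"
      have "(\<Sum>k. of_bool (prev_uso \<omega> k < s \<and> s \<le> uso_time \<omega> k)) \<le> (1 :: ennreal)" for s
        by (subst suminf_of_bool_unique) (auto dest: prev_uso_interval_unique[OF pos])
      then show "(\<integral>\<^sup>+s. (\<Sum>k. of_bool (s \<in> {0<..real N}) *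
        of_bool (prev_uso \<omega> k < s \<and> s \<le> uso_time \<omega> k)) \<partial>lborel) \<le> (\<integral>\<^sup>+s. indicator {0<..real N} s \<partial>lborel)"
        by (intro nn_integral_mono) (auto simp: indicator_def)
    qed
    also have "\<dots> = ennreal (real N)" using emeasure_space_1 by simp
    finally show "(\<Sum>k. \<integral>\<^sup>+\<omega>. of_bool (uso_time \<omega> k \<in> {0<..real N}) \<partial>M) \<noteq> \<infinity>"
      unfolding eq by (auto simp: ennreal_mult_eq_top_iff top_unique)
  qed auto
  then have all: "AE \<omega> in M. \<forall>N :: nat. finite {k. uso_time \<omega> k \<in> {0<..real N}}"
    by (simp add: AE_all_countable)
  show ?thesis
  proof (use all AE_positive_lengths in eventually_elim)
    fix \<omega> assume fin: "\<forall>N :: nat. finite {k. uso_time \<omega> k \<in> {0<..real N}}" and pos: "positive_lengths \<omega>"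
    show "usos_unbounded \<omega>" unfolding usos_unbounded_def
    proof
      fix s
      obtain N :: nat where "s < real N" using reals_Archimedean2 by blast
      moreover obtain k where "k \<notin> {k. uso_time \<omega> k \<in> {0<..real N}}"
        using fin ex_new_if_finite infinite_UNIV_nat by blast
      ultimately show "\<exists>k. s < uso_time \<omega> k" using uso_time_pos[OF pos, of k] by (auto intro!: exI[of _ k])
    qed
  qed
qed

text \<open>
  Poisson arrivals see time averages.
\<close>

lemma expected_usos_sat:
  assumes [measurable]: "B \<in> sets borel" and B: "B \<subseteq> {0<..}"
  shows "(\<Sum>k. \<integral>\<^sup>+\<omega>. of_bool (uso_time \<omega> k \<in> B \<and> sat \<omega> (uso_time \<omega> k)) \<partial>M) =
    ennreal lam * (\<integral>\<^sup>+\<omega>. \<integral>\<^sup>+s. of_bool (s \<in> B \<and> sat \<omega> s) \<partial>lborel \<partial>M)"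
proof -
  have "(\<Sum>k. \<integral>\<^sup>+\<omega>. of_bool (uso_time \<omega> k \<in> B \<and> sat \<omega> (uso_time \<omega> k)) \<partial>M) =
    ennreal lam * (\<integral>\<^sup>+\<omega>. \<integral>\<^sup>+s. (\<Sum>k. of_bool (s \<in> B \<and> sat \<omega> s) *
       of_bool (prev_uso \<omega> k < s \<and> s \<le> uso_time \<omega> k)) \<partial>lborel \<partial>M)"
    unfolding nn_integral_uso_time_sat[OF assms(1)] ennreal_suminf_cmult
    by (subst lborel.suminf_nn_integral_nn_integral) simp_all
  also have "(\<integral>\<^sup>+\<omega>. \<integral>\<^sup>+s. (\<Sum>k. of_bool (s \<in> B \<and> sat \<omega> s) *
       of_bool (prev_uso \<omega> k < s \<and> s \<le> uso_time \<omega> k)) \<partial>lborel \<partial>M) =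
     (\<integral>\<^sup>+\<omega>. \<integral>\<^sup>+s. of_bool (s \<in> B \<and> sat \<omega> s) \<partial>lborel \<partial>M)"
  proof (rule nn_integral_cong_AE, use AE_positive_lengths AE_usos_unbounded in eventually_elim)
    fix \<omega> assume g: "positive_lengths \<omega>" "usos_unbounded \<omega>"
    have "(\<Sum>k. of_bool (prev_uso \<omega> k < s \<and> s \<le> uso_time \<omega> k)) = (1 :: ennreal)" if "s \<in> B" for s
      using ex_prev_uso_interval[OF g, of s] that B
      by (subst suminf_of_bool_unique) (auto dest: prev_uso_interval_unique[OF g(1)])
    then show "(\<integral>\<^sup>+s. (\<Sum>k. of_bool (s \<in> B \<and> sat \<omega> s) *
       of_bool (prev_uso \<omega> k < s \<and> s \<le> uso_time \<omega> k)) \<partial>lborel) = (\<integral>\<^sup>+s. of_bool (s \<in> B \<and> sat \<omega> s) \<partial>lborel)"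
      by (intro nn_integral_cong) auto
  qed
  finally show ?thesis .
qed

section \<open>Failures\<close>

lemma epochs_upd [simp]:
  "epochs (upd_stay1 n x \<omega>) = epochs \<omega>" "epochs (upd_stay2 n x \<omega>) = epochs \<omega>"
  by (simp_all add: renewing_epochs_def)

lemma enter_upd_stay1: "m \<le> n \<Longrightarrow> enter (upd_stay1 n x \<omega>) m = enter \<omega> m"
proof (induction m)
  case (Suc m)
  then show ?case by (simp add: enter_Suc leave1_def stay1_end_def)
qed simp

lemma enter_upd_stay2:
  "m < n \<Longrightarrow> enter (upd_stay2 n x \<omega>) m = enter \<omega> m \<and> leave (upd_stay2 n x \<omega>) m = leave \<omega> m"
proof (induction m)
  case 0
  then show ?case by (simp add: leave1_def stay1_end_def)
next
  case (Suc m)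
  then show ?case by (simp add: enter_Suc leave1_def stay1_end_def)
qed

abbreviation fails where "fails \<omega> n \<equiv> leave \<omega> n = enter \<omega> n + stay1 \<omega> n"

text \<open>
  The clock is the full length of the stay, and the observation at its end is whether no renewing epoch
  has come before. Renewing epochs and the beginning of the stay are functions of the other coordinates.
\<close>

lemma nn_integral_failure:
  assumes [measurable]: "B \<in> sets borel"
  shows "(\<integral>\<^sup>+\<omega>. of_bool (fails \<omega> n \<and> leave \<omega> n \<in> B) \<partial>M) =
    ennreal \<mu>1 * (\<integral>\<^sup>+\<omega>. \<integral>\<^sup>+s. of_bool (s \<in> B) * of_bool (enter \<omega> n < s \<and> s \<le> leave \<omega> n) \<partial>lborel \<partial>M)"
proof -
  let ?G = "\<lambda>s \<omega>. of_bool (s \<in> B \<and> (\<forall>h\<in>epochs \<omega>. enter \<omega> n \<le> h \<longrightarrow> s \<le> h)) :: ennreal"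
  have "fails \<omega> n \<longleftrightarrow> (\<forall>h\<in>epochs \<omega>. enter \<omega> n \<le> h \<longrightarrow> enter \<omega> n + stay1 \<omega> n \<le> h)" for \<omega>
    using le_leave_iff[of "enter \<omega> n + stay1 \<omega> n" \<omega> n] leave_le_full_stay[of \<omega> n] by auto
  then have "(\<integral>\<^sup>+\<omega>. of_bool (fails \<omega> n \<and> leave \<omega> n \<in> B) \<partial>M) = (\<integral>\<^sup>+\<omega>. ?G (enter \<omega> n + stay1 \<omega> n) \<omega> \<partial>M)"
    by (intro nn_integral_cong arg_cong[where f=of_bool]) metis
  also have "\<dots> = ennreal \<mu>1 * (\<integral>\<^sup>+\<omega>. \<integral>\<^sup>+s. ?G s \<omega> *
      of_bool (enter \<omega> n < s \<and> s \<le> enter \<omega> n + stay1 \<omega> n) \<partial>lborel \<partial>M)"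
    by (rule exponential_hazard[OF \<mu>1_pos resamples_stay1[of n] prob_space_axioms _ _ _ AE_positive_lengths])
      (simp_all add: enter_upd_stay1)
  also have "(\<integral>\<^sup>+\<omega>. \<integral>\<^sup>+s. ?G s \<omega> * of_bool (enter \<omega> n < s \<and> s \<le> enter \<omega> n + stay1 \<omega> n) \<partial>lborel \<partial>M) =
      (\<integral>\<^sup>+\<omega>. \<integral>\<^sup>+s. of_bool (s \<in> B) * of_bool (enter \<omega> n < s \<and> s \<le> leave \<omega> n) \<partial>lborel \<partial>M)"
    by (intro nn_integral_cong) (auto simp: le_leave_iff)
  finally show ?thesis .
qed

text \<open>
  A full stay has a continuous law and is independent of the countably many renewing epochs, hence
  almost surely does not end at one of them.
\<close>

lemma AE_no_tie: "AE \<omega> in M. \<forall>n. enter \<omega> n + stay1 \<omega> n \<notin> epochs \<omega>"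
proof -
  have "AE \<omega> in M. enter \<omega> n + stay1 \<omega> n \<notin> epochs \<omega>" for n
  proof -
    have "(\<integral>\<^sup>+\<omega>. of_bool (enter \<omega> n + stay1 \<omega> n \<in> epochs \<omega>) \<partial>M) =
      ennreal \<mu>1 * (\<integral>\<^sup>+\<omega>. \<integral>\<^sup>+s. of_bool (s \<in> epochs \<omega>) *
        of_bool (enter \<omega> n < s \<and> s \<le> enter \<omega> n + stay1 \<omega> n) \<partial>lborel \<partial>M)"
      by (rule exponential_hazard[OF \<mu>1_pos resamples_stay1[of n] prob_space_axioms _ _ _ AE_positive_lengths])
        (simp_all add: enter_upd_stay1)
    also have "\<dots> = ennreal \<mu>1 * (\<integral>\<^sup>+\<omega>. 0 \<partial>M)"
    proof (intro arg_cong2[where f="(*)"] refl nn_integral_cong)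
      fix \<omega>
      have "AE s in lborel. s \<notin> epochs \<omega>"
        using countable_imp_null_set_lborel[OF countable_epochs] by (rule AE_not_in)
      then have "AE s in lborel. (of_bool (s \<in> epochs \<omega>) *
        of_bool (enter \<omega> n < s \<and> s \<le> enter \<omega> n + stay1 \<omega> n) :: ennreal) = 0"
        by eventually_elim auto
      then show "(\<integral>\<^sup>+s. of_bool (s \<in> epochs \<omega>) *
        of_bool (enter \<omega> n < s \<and> s \<le> enter \<omega> n + stay1 \<omega> n) \<partial>lborel) = (0 :: ennreal)"
        by (rule nn_integral_zero')
    qed
    finally have "(\<integral>\<^sup>+\<omega>. of_bool (enter \<omega> n + stay1 \<omega> n \<in> epochs \<omega>) \<partial>M) = (0 :: ennreal)" by simp
    then have "AE \<omega> in M. of_bool (enter \<omega> n + stay1 \<omega> n \<in> epochs \<omega>) = (0 :: ennreal)"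
      by (subst (asm) nn_integral_0_iff_AE) auto
    then show ?thesis by eventually_elim (auto split: if_splits)
  qed
  then show ?thesis by (simp add: AE_all_countable)
qed

lemma expected_failures:
  assumes [measurable]: "B \<in> sets borel"
  shows "(\<Sum>n. \<integral>\<^sup>+\<omega>. of_bool (fails \<omega> n \<and> leave \<omega> n \<in> B) \<partial>M) =
    ennreal \<mu>1 * (\<integral>\<^sup>+\<omega>. \<integral>\<^sup>+s. of_bool (s \<in> B \<and> sat \<omega> s) \<partial>lborel \<partial>M)"
proof -
  have "(\<Sum>n. \<integral>\<^sup>+\<omega>. of_bool (fails \<omega> n \<and> leave \<omega> n \<in> B) \<partial>M) =
    ennreal \<mu>1 * (\<integral>\<^sup>+\<omega>. \<integral>\<^sup>+s. (\<Sum>n. of_bool (s \<in> B) *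
       of_bool (enter \<omega> n < s \<and> s \<le> leave \<omega> n)) \<partial>lborel \<partial>M)"
    unfolding nn_integral_failure[OF assms] ennreal_suminf_cmult
    by (subst lborel.suminf_nn_integral_nn_integral) simp_all
  also have "(\<integral>\<^sup>+\<omega>. \<integral>\<^sup>+s. (\<Sum>n. of_bool (s \<in> B) *
       of_bool (enter \<omega> n < s \<and> s \<le> leave \<omega> n)) \<partial>lborel \<partial>M) =
     (\<integral>\<^sup>+\<omega>. \<integral>\<^sup>+s. of_bool (s \<in> B \<and> sat \<omega> s) \<partial>lborel \<partial>M)"
  proof (rule nn_integral_cong_AE, use AE_positive_lengths in eventually_elim)
    fix \<omega> assume pos: "positive_lengths \<omega>"
    show "(\<integral>\<^sup>+s. (\<Sum>n. of_bool (s \<in> B) * of_bool (enter \<omega> n < s \<and> s \<le> leave \<omega> n)) \<partial>lborel) =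
        (\<integral>\<^sup>+s. of_bool (s \<in> B \<and> sat \<omega> s) \<partial>lborel)"
    proof (rule nn_integral_cong_AE, use AE_not_in_range[of "enter \<omega>"] in eventually_elim)
      fix s assume "\<forall>n. s \<noteq> enter \<omega> n"
      then have "enter \<omega> n < s \<longleftrightarrow> enter \<omega> n \<le> s" for n
        by (metis order_le_less)
      then show "(\<Sum>n. of_bool (s \<in> B) * of_bool (enter \<omega> n < s \<and> s \<le> leave \<omega> n)) =
         (of_bool (s \<in> B \<and> sat \<omega> s) :: ennreal)"
        using suminf_in_stay1[OF pos, of s] by (cases "s \<in> B") auto
    qed
  qed
  finally show ?thesis .
qed

section \<open>Entrances into condition 1\<close>

text \<open>
  The \<open>n\<close>-th stay in condition 2 fills the interval from \<open>prev_leave \<omega> n\<close> to \<open>enter1 \<tau> tcut \<omega> n\<close>. For \<open>n = 0\<close>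
  this is degenerate, as it should be, if the system starts in condition 1.
\<close>

definition prev_leave :: "outcome \<Rightarrow> nat \<Rightarrow> real" where
  "prev_leave \<omega> n = (case n of 0 \<Rightarrow> 0 | Suc m \<Rightarrow> leave \<omega> m)"

lemma prev_leave_simps [simp]: "prev_leave \<omega> 0 = 0" "prev_leave \<omega> (Suc n) = leave \<omega> n"
  by (simp_all add: prev_leave_def)

lemma measurable_prev_leave [measurable (raw)]:
  "f \<in> K \<rightarrow>\<^sub>M M \<Longrightarrow> (\<lambda>x. prev_leave (f x) n) \<in> borel_measurable K"
  by (cases n) simp_all

lemma prev_leave_upd_stay2: "prev_leave (upd_stay2 n x \<omega>) n = prev_leave \<omega> n"
  by (cases n) (simp_all add: enter_upd_stay2)

lemma enter_eq_prev_leave: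
  "n = 0 \<longrightarrow> initial_cond \<omega> = Perfect \<Longrightarrow> enter \<omega> n = prev_leave \<omega> n + stay2 \<omega> n"
  by (cases n) (auto simp: enter_Suc)

text \<open>
  The clock is the \<open>n\<close>-th stay in condition 2. Restricting to positive times discards the entrance
  at time 0 of a system that starts in condition 1, which no clock announces.
\<close>

lemma nn_integral_enter:
  assumes [measurable]: "B \<in> sets borel" and B: "B \<subseteq> {0<..}"
  shows "(\<integral>\<^sup>+\<omega>. of_bool (enter \<omega> n \<in> B) \<partial>M) =
    ennreal \<mu>2 * (\<integral>\<^sup>+\<omega>. \<integral>\<^sup>+s. of_bool (s \<in> B) * of_bool (prev_leave \<omega> n < s \<and> s \<le> enter \<omega> n) \<partial>lborel \<partial>M)"
proof -
  let ?G = "\<lambda>s \<omega>. of_bool (s \<in> B \<and> (n = 0 \<longrightarrow> initial_cond \<omega> = Perfect)) :: ennreal"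
  have c: "initial_cond \<omega> = Perfect \<or> initial_cond \<omega> = Satisfactory" for \<omega>
    using cond.exhaust by blast
  have "enter \<omega> n \<in> B \<longleftrightarrow> prev_leave \<omega> n + stay2 \<omega> n \<in> B \<and> (n = 0 \<longrightarrow> initial_cond \<omega> = Perfect)" for \<omega>
    using enter_eq_prev_leave[of n \<omega>] B c[of \<omega>] by (cases "n = 0 \<longrightarrow> initial_cond \<omega> = Perfect") auto
  then have "(\<integral>\<^sup>+\<omega>. of_bool (enter \<omega> n \<in> B) \<partial>M) = (\<integral>\<^sup>+\<omega>. ?G (prev_leave \<omega> n + stay2 \<omega> n) \<omega> \<partial>M)"
    by (intro nn_integral_cong arg_cong[where f=of_bool]) metis
  also have "\<dots> = ennreal \<mu>2 * (\<integral>\<^sup>+\<omega>. \<integral>\<^sup>+s. ?G s \<omega> *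
      of_bool (prev_leave \<omega> n < s \<and> s \<le> prev_leave \<omega> n + stay2 \<omega> n) \<partial>lborel \<partial>M)"
    by (rule exponential_hazard[OF \<mu>2_pos resamples_stay2[of n] prob_space_axioms _ _ _ AE_positive_lengths])
      (simp_all add: prev_leave_upd_stay2)
  also have "(\<integral>\<^sup>+\<omega>. \<integral>\<^sup>+s. ?G s \<omega> *
      of_bool (prev_leave \<omega> n < s \<and> s \<le> prev_leave \<omega> n + stay2 \<omega> n) \<partial>lborel \<partial>M) =
    (\<integral>\<^sup>+\<omega>. \<integral>\<^sup>+s. of_bool (s \<in> B) * of_bool (prev_leave \<omega> n < s \<and> s \<le> enter \<omega> n) \<partial>lborel \<partial>M)"
  proof (intro nn_integral_cong)
    fix \<omega> s
    show "?G s \<omega> * of_bool (prev_leave \<omega> n < s \<and> s \<le> prev_leave \<omega> n + stay2 \<omega> n) =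
       (of_bool (s \<in> B) * of_bool (prev_leave \<omega> n < s \<and> s \<le> enter \<omega> n) :: ennreal)"
      using enter_eq_prev_leave[of n \<omega>] c[of \<omega>]
      by (cases "n = 0 \<longrightarrow> initial_cond \<omega> = Perfect") auto
  qed
  finally show ?thesis .
qed

lemma prev_leave_interval_unique:
  assumes "positive_lengths \<omega>"
    "prev_leave \<omega> i < s" "s \<le> enter \<omega> i" "prev_leave \<omega> j < s" "s \<le> enter \<omega> j"
  shows "i = j"
proof -
  have "enter \<omega> i \<le> prev_leave \<omega> j" if ij: "i < j" for i j
  proof -
    obtain j' where j: "j = Suc j'" using ij by (cases j) auto
    then have "i = j' \<or> leave \<omega> i < enter \<omega> j'" using ij leave_less_enter[OF assms(1), of i j'] by (auto simp: less_Suc_eq)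
    then show ?thesis
      using j enter_le_leave[OF assms(1), of i] enter_le_leave[OF assms(1), of j'] by auto
  qed
  then show ?thesis using assms(2-) by (cases i j rule: linorder_cases) fastforce+
qed

lemma suminf_nn_integral_enter:
  "(\<Sum>n. \<integral>\<^sup>+\<omega>. of_bool (enter \<omega> n \<in> {0<..s}) \<partial>M) =
    ennreal \<mu>2 * (\<integral>\<^sup>+\<omega>. \<integral>\<^sup>+t. of_bool (t \<in> {0<..s}) *
      (\<Sum>n. of_bool (prev_leave \<omega> n < t \<and> t \<le> enter \<omega> n)) \<partial>lborel \<partial>M)"
proof -
  have "(\<Sum>n. \<integral>\<^sup>+\<omega>. of_bool (enter \<omega> n \<in> {0<..s}) \<partial>M) =
    ennreal \<mu>2 * (\<Sum>n. \<integral>\<^sup>+\<omega>. \<integral>\<^sup>+t. of_bool (t \<in> {0<..s}) * of_bool (prev_leave \<omega> n < t \<and> t \<le> enter \<omega> n) \<partial>lborel \<partial>M)"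
    by (subst nn_integral_enter) auto
  also have "(\<Sum>n. \<integral>\<^sup>+\<omega>. \<integral>\<^sup>+t. of_bool (t \<in> {0<..s}) * of_bool (prev_leave \<omega> n < t \<and> t \<le> enter \<omega> n) \<partial>lborel \<partial>M) =
    (\<integral>\<^sup>+\<omega>. \<integral>\<^sup>+t. (\<Sum>n. of_bool (t \<in> {0<..s}) * of_bool (prev_leave \<omega> n < t \<and> t \<le> enter \<omega> n)) \<partial>lborel \<partial>M)"
    by (rule lborel.suminf_nn_integral_nn_integral) measurable
  finally show ?thesis by simp
qed

text \<open>
  The system does not explode: as stays in condition 2 are disjoint, at most \<open>\<mu>2 * N\<close> entrances are expected
  in the first \<open>N\<close> units of time.
\<close>

lemma AE_enters_unbounded: "AE \<omega> in M. \<forall>s. \<exists>n. s < enter \<omega> n"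
proof -
  have "AE \<omega> in M. finite {n. enter \<omega> n \<in> {0<..real N}}" for N :: nat
  proof (rule AE_finite_of_summable_prob)
    have "(\<integral>\<^sup>+\<omega>. \<integral>\<^sup>+t. of_bool (t \<in> {0<..real N}) *
      (\<Sum>n. of_bool (prev_leave \<omega> n < t \<and> t \<le> enter \<omega> n)) \<partial>lborel \<partial>M)
      \<le> (\<integral>\<^sup>+\<omega>. \<integral>\<^sup>+t. indicator {0<..real N} t \<partial>lborel \<partial>M)"
    proof (rule nn_integral_mono_AE, use AE_positive_lengths in eventually_elim)
      fix \<omega> assume pos: "positive_lengths \<omega>"
      have "(\<Sum>n. of_bool (prev_leave \<omega> n < t \<and> t \<le> enter \<omega> n)) \<le> (1 :: ennreal)" for t
        by (subst suminf_of_bool_unique) (auto dest: prev_leave_interval_unique[OF pos])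
      then show "(\<integral>\<^sup>+t. of_bool (t \<in> {0<..real N}) *
          (\<Sum>n. of_bool (prev_leave \<omega> n < t \<and> t \<le> enter \<omega> n)) \<partial>lborel) \<le> (\<integral>\<^sup>+t. indicator {0<..real N} t \<partial>lborel)"
        by (intro nn_integral_mono) (auto simp: indicator_def)
    qed
    also have "\<dots> = ennreal (real N)" using emeasure_space_1 by simp
    finally show "(\<Sum>n. \<integral>\<^sup>+\<omega>. of_bool (enter \<omega> n \<in> {0<..real N}) \<partial>M) \<noteq> \<infinity>"
      unfolding suminf_nn_integral_enter by (auto simp: ennreal_mult_eq_top_iff top_unique)
  qed auto
  then have all: "AE \<omega> in M. \<forall>N :: nat. finite {n. enter \<omega> n \<in> {0<..real N}}"
    by (simp add: AE_all_countable)
  show ?thesis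
  proof (use all AE_positive_lengths in eventually_elim)
    fix \<omega> assume fin: "\<forall>N :: nat. finite {n. enter \<omega> n \<in> {0<..real N}}" and pos: "positive_lengths \<omega>"
    show "\<forall>s. \<exists>n. s < enter \<omega> n"
    proof
      fix s
      obtain N :: nat where N: "s < real N" using reals_Archimedean2 by blast
      have "finite (insert 0 {n. enter \<omega> n \<in> {0<..real N}})" using fin by blast
      then obtain n where n: "n \<notin> insert 0 {n. enter \<omega> n \<in> {0<..real N}}"
        using ex_new_if_finite infinite_UNIV_nat by blast
      then obtain m where "n = Suc m" by (cases n) auto
      then show "\<exists>n. s < enter \<omega> n" using N n enter_Suc_pos[OF pos, of m] by (auto intro!: exI[of _ n])
    qed
  qed
qed

text \<open>
  Outside the countable set of entrance times, the stays in condition 2 are exactly the gaps left by the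
  stays in condition 1; unboundedness of the entrances ensures that no time is missed.
\<close>

lemma suminf_prev_leave_interval:
  assumes pos: "positive_lengths \<omega>" and unb: "\<forall>s. \<exists>n. s < enter \<omega> n"
    and s: "0 < s" "\<forall>n. s \<noteq> enter \<omega> n"
  shows "(\<Sum>n. of_bool (prev_leave \<omega> n < s \<and> s \<le> enter \<omega> n)) = (of_bool (\<not> sat \<omega> s) :: ennreal)"
proof -
  have "(\<exists>n. prev_leave \<omega> n < s \<and> s \<le> enter \<omega> n) \<longleftrightarrow> \<not> sat \<omega> s"
  proof
    assume "\<exists>n. prev_leave \<omega> n < s \<and> s \<le> enter \<omega> n"
    then obtain n where n: "prev_leave \<omega> n < s" "s < enter \<omega> n" using s(2) by (metis order_less_le)
    show "\<not> sat \<omega> s"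
    proof
      assume "sat \<omega> s"
      then obtain m where m: "enter \<omega> m \<le> s" "s \<le> leave \<omega> m" by (auto simp: cond_at_eq_Satisfactory)
      have "m \<noteq> n" using m n by auto
      moreover have "\<not> n < m"
        using leave_less_enter[OF pos, of n m] enter_le_leave[OF pos, of n] m n by auto
      moreover have "leave \<omega> m \<le> prev_leave \<omega> n" if mn: "m < n"
      proof -
        obtain n' where n': "n = Suc n'" using mn by (cases n) auto
        show ?thesis
          using leave_less_enter[OF pos, of m n'] enter_le_leave[OF pos, of n'] mn n'
          by (cases "m = n'") auto
      qed
      ultimately show False using m n by (meson linorder_neqE_nat not_less order_trans)
    qed
  next
    assume ns: "\<not> sat \<omega> s"
    define n where "n = (LEAST n. s \<le> enter \<omega> n)"
    have "\<exists>n. s \<le> enter \<omega> n" using unb by (auto intro: less_imp_le)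
    then have n: "s \<le> enter \<omega> n" unfolding n_def by (rule LeastI_ex)
    have "prev_leave \<omega> n < s"
    proof (cases n)
      case (Suc m)
      then have "\<not> s \<le> enter \<omega> m" using not_less_Least[of m "\<lambda>n. s \<le> enter \<omega> n"] by (simp add: n_def)
      moreover have "\<not> (enter \<omega> m \<le> s \<and> s \<le> leave \<omega> m)"
        using ns unfolding cond_at_eq_Satisfactory by blast
      ultimately show ?thesis using Suc by simp
    qed (use s in simp)
    then show "\<exists>n. prev_leave \<omega> n < s \<and> s \<le> enter \<omega> n" using n by blast
  qed
  then show ?thesis
    by (subst suminf_of_bool_unique) (auto dest: prev_leave_interval_unique[OF pos])
qed

lemma expected_entrances:
  "(\<Sum>n. \<integral>\<^sup>+\<omega>. of_bool (enter \<omega> n \<in> {0<..s}) \<partial>M) =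
    ennreal \<mu>2 * (\<integral>\<^sup>+\<omega>. \<integral>\<^sup>+t. of_bool (t \<in> {0<..s} \<and> \<not> sat \<omega> t) \<partial>lborel \<partial>M)"
  unfolding suminf_nn_integral_enter
proof (intro arg_cong2[where f="(*)"] refl nn_integral_cong_AE,
    use AE_positive_lengths AE_enters_unbounded in eventually_elim)
  fix \<omega> assume g: "positive_lengths \<omega>" "\<forall>s. \<exists>n. s < enter \<omega> n"
  show "(\<integral>\<^sup>+t. of_bool (t \<in> {0<..s}) * (\<Sum>n. of_bool (prev_leave \<omega> n < t \<and> t \<le> enter \<omega> n)) \<partial>lborel) =
     (\<integral>\<^sup>+t. of_bool (t \<in> {0<..s} \<and> \<not> sat \<omega> t) \<partial>lborel)"
    by (intro nn_integral_cong_AE, use AE_not_in_range[of "enter \<omega>"] in eventually_elim)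
      (use suminf_prev_leave_interval[OF g] in auto)
qed

section \<open>Balance of entrances and departures\<close>

definition esat_prob :: "real \<Rightarrow> ennreal" where
  "esat_prob s = (\<integral>\<^sup>+\<omega>. of_bool (sat \<omega> s) \<partial>M)"

lemma measurable_esat_prob [measurable]: "esat_prob \<in> borel_measurable borel"
proof -
  have "(\<lambda>(s, \<omega>). of_bool (sat \<omega> s)) \<in> borel_measurable (borel \<Otimes>\<^sub>M M)" by measurable
  from borel_measurable_nn_integral[OF this] show ?thesis by (simp add: esat_prob_def[abs_def])
qed

lemma esat_prob_le_1: "esat_prob s \<le> 1"
proof -
  have "esat_prob s \<le> (\<integral>\<^sup>+\<omega>. 1 \<partial>M)" unfolding esat_prob_def by (intro nn_integral_mono) auto
  then show ?thesis using emeasure_space_1 by simp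
qed

lemma nn_integral_not_sat: "(\<integral>\<^sup>+\<omega>. of_bool (\<not> sat \<omega> s) \<partial>M) = 1 - esat_prob s"
proof -
  have "esat_prob s + (\<integral>\<^sup>+\<omega>. of_bool (\<not> sat \<omega> s) \<partial>M) = (\<integral>\<^sup>+\<omega>. of_bool (sat \<omega> s) + of_bool (\<not> sat \<omega> s) \<partial>M)"
    unfolding esat_prob_def by (rule nn_integral_add[symmetric]) auto
  also have "\<dots> = (\<integral>\<^sup>+\<omega>. 1 \<partial>M)" by (intro nn_integral_cong) auto
  finally have "esat_prob s + (\<integral>\<^sup>+\<omega>. of_bool (\<not> sat \<omega> s) \<partial>M) = 1" using emeasure_space_1 by simp
  moreover have "esat_prob s \<noteq> \<top>" using esat_prob_le_1[of s] by (auto simp: top_unique)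
  ultimately show ?thesis by (metis ennreal_add_diff_cancel_left)
qed

lemma nn_integral_time_in_state:
  assumes [measurable]: "B \<in> sets borel"
  shows "(\<integral>\<^sup>+\<omega>. \<integral>\<^sup>+s. of_bool (s \<in> B \<and> sat \<omega> s) \<partial>lborel \<partial>M) = (\<integral>\<^sup>+s. indicator B s * esat_prob s \<partial>lborel)"
    and "(\<integral>\<^sup>+\<omega>. \<integral>\<^sup>+s. of_bool (s \<in> B \<and> \<not> sat \<omega> s) \<partial>lborel \<partial>M) = (\<integral>\<^sup>+s. indicator B s * (1 - esat_prob s) \<partial>lborel)"
proof -
  interpret pair_sigma_finite lborel M ..
  have "(\<integral>\<^sup>+\<omega>. \<integral>\<^sup>+s. of_bool (s \<in> B \<and> sat \<omega> s) \<partial>lborel \<partial>M) = (\<integral>\<^sup>+s. \<integral>\<^sup>+\<omega>. of_bool (s \<in> B \<and> sat \<omega> s) \<partial>M \<partial>lborel)"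
    by (rule Fubini') measurable
  also have "\<dots> = (\<integral>\<^sup>+s. indicator B s * esat_prob s \<partial>lborel)"
    by (intro nn_integral_cong) (auto simp: esat_prob_def indicator_def)
  finally show "(\<integral>\<^sup>+\<omega>. \<integral>\<^sup>+s. of_bool (s \<in> B \<and> sat \<omega> s) \<partial>lborel \<partial>M) = (\<integral>\<^sup>+s. indicator B s * esat_prob s \<partial>lborel)" .
  have "(\<integral>\<^sup>+\<omega>. \<integral>\<^sup>+s. of_bool (s \<in> B \<and> \<not> sat \<omega> s) \<partial>lborel \<partial>M) = (\<integral>\<^sup>+s. \<integral>\<^sup>+\<omega>. of_bool (s \<in> B \<and> \<not> sat \<omega> s) \<partial>M \<partial>lborel)"
    by (rule Fubini') measurable
  also have "\<dots> = (\<integral>\<^sup>+s. indicator B s * (1 - esat_prob s) \<partial>lborel)"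
    by (intro nn_integral_cong) (auto simp: nn_integral_not_sat indicator_def)
  finally show "(\<integral>\<^sup>+\<omega>. \<integral>\<^sup>+s. of_bool (s \<in> B \<and> \<not> sat \<omega> s) \<partial>lborel \<partial>M) = (\<integral>\<^sup>+s. indicator B s * (1 - esat_prob s) \<partial>lborel)" .
qed

text \<open>
  Success of a maintenance only matters after the inspection that precedes it.
\<close>

lemma cond_at_upd_so:
  assumes "positive_lengths \<omega>"
  shows "cond_at \<tau> tcut (upd_so k b \<omega>) (so_time \<tau> k) = cond_at \<tau> tcut \<omega> (so_time \<tau> k)"
proof (rule cond_at_causal[OF assms])
  show "h \<in> epochs (upd_so k b \<omega>) \<longleftrightarrow> h \<in> epochs \<omega>" if "h < so_time \<tau> k" for h
    using that by (auto simp: renewing_epochs_def split: if_splits)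
qed simp_all

lemma cond_at_upd_uso:
  assumes "positive_lengths \<omega>"
  shows "cond_at \<tau> tcut (upd_uso k b \<omega>) (uso_time \<omega> k) = cond_at \<tau> tcut \<omega> (uso_time \<omega> k)"
proof (rule cond_at_causal[OF assms])
  show "h \<in> epochs (upd_uso k b \<omega>) \<longleftrightarrow> h \<in> epochs \<omega>" if "h < uso_time \<omega> k" for h
    using that by (auto simp: renewing_epochs_def split: if_splits)
qed simp_all

lemma nn_integral_so_success:
  "(\<integral>\<^sup>+\<omega>. of_bool (so_success \<omega> k \<and> so_time \<tau> k < s \<and> sat \<omega> (so_time \<tau> k)) \<partial>M) =
    ennreal p * (of_bool (so_time \<tau> k < s) * esat_prob (so_time \<tau> k))"
proof -
  have "(\<integral>\<^sup>+\<omega>. of_bool (so_success \<omega> k \<and> so_time \<tau> k < s \<and> sat \<omega> (so_time \<tau> k)) \<partial>M) =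
    (\<integral>\<^sup>+\<omega>. of_bool (so_success \<omega> k) * of_bool (so_time \<tau> k < s \<and> sat \<omega> (so_time \<tau> k)) \<partial>M)"
    by (intro nn_integral_cong) auto
  also have "\<dots> = ennreal p * (\<integral>\<^sup>+\<omega>. of_bool (so_time \<tau> k < s \<and> sat \<omega> (so_time \<tau> k)) \<partial>M)"
    by (rule resamples_bernoulli_thinning[OF resamples_so[of k] _ _ _ _ AE_positive_lengths])
      (use p_pos p_less_1 in \<open>simp_all add: cond_at_upd_so\<close>)
  also have "(\<integral>\<^sup>+\<omega>. of_bool (so_time \<tau> k < s \<and> sat \<omega> (so_time \<tau> k)) \<partial>M) = of_bool (so_time \<tau> k < s) * esat_prob (so_time \<tau> k)"
    by (auto simp: esat_prob_def)
  finally show ?thesis .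
qed

lemma nn_integral_uso_success:
  assumes [measurable]: "B \<in> sets borel"
  shows "(\<integral>\<^sup>+\<omega>. of_bool (uso_success \<omega> k \<and> uso_time \<omega> k \<in> B \<and> sat \<omega> (uso_time \<omega> k)) \<partial>M) =
    ennreal p * (\<integral>\<^sup>+\<omega>. of_bool (uso_time \<omega> k \<in> B \<and> sat \<omega> (uso_time \<omega> k)) \<partial>M)"
proof -
  have "(\<integral>\<^sup>+\<omega>. of_bool (uso_success \<omega> k \<and> uso_time \<omega> k \<in> B \<and> sat \<omega> (uso_time \<omega> k)) \<partial>M) =
    (\<integral>\<^sup>+\<omega>. of_bool (uso_success \<omega> k) * of_bool (uso_time \<omega> k \<in> B \<and> sat \<omega> (uso_time \<omega> k)) \<partial>M)"
    by (intro nn_integral_cong) auto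
  also have "\<dots> = ennreal p * (\<integral>\<^sup>+\<omega>. of_bool (uso_time \<omega> k \<in> B \<and> sat \<omega> (uso_time \<omega> k)) \<partial>M)"
    by (rule resamples_bernoulli_thinning[OF resamples_uso[of k] _ _ _ _ AE_positive_lengths])
      (use p_pos p_less_1 in \<open>simp_all add: cond_at_upd_uso\<close>)
  finally show ?thesis .
qed

definition eligible :: "real set" where
  "eligible = {s. tcut < remaining \<tau> s}"

lemma eligible_borel [measurable]: "eligible \<in> sets borel"
proof -
  have "Measurable.pred borel (\<lambda>s :: real. tcut < remaining \<tau> s)" by measurable
  then show ?thesis by (simp add: eligible_def pred_def)
qed

text \<open>
  The expected time spent in condition 1 during \<open>B\<close>.
\<close>

definition occupation :: "real set \<Rightarrow> ennreal" where
  "occupation B = (\<integral>\<^sup>+s. indicator B s * esat_prob s \<partial>lborel)"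

text \<open>
  The departures are sorted by their cause, and for each cause the sum over stays turns the event of being
  in one particular stay into that of being in condition 1.
\<close>

lemma expected_leaves:
  "(\<Sum>n. \<integral>\<^sup>+\<omega>. of_bool (leave \<omega> n < s) \<partial>M) =
    ennreal \<mu>1 * occupation {0<..<s} + (\<Sum>k. ennreal p * (of_bool (so_time \<tau> k < s) * esat_prob (so_time \<tau> k))) +
    ennreal p * (ennreal lam * occupation ({0<..<s} \<inter> eligible))"
proof -
  let ?in = "\<lambda>\<omega> n t. enter \<omega> n \<le> t \<and> t \<le> leave \<omega> n"
  let ?so = "\<lambda>\<omega> k. so_success \<omega> k \<and> so_time \<tau> k < s"
  let ?uso = "\<lambda>\<omega> k. uso_success \<omega> k \<and> uso_time \<omega> k \<in> {0<..<s} \<inter> eligible"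
  have "(\<Sum>n. \<integral>\<^sup>+\<omega>. of_bool (leave \<omega> n < s) \<partial>M) = (\<integral>\<^sup>+\<omega>. (\<Sum>n. of_bool (leave \<omega> n < s)) \<partial>M)"
    by (rule nn_integral_suminf[symmetric]) simp
  also have "\<dots> = (\<integral>\<^sup>+\<omega>. (\<Sum>n. of_bool (fails \<omega> n \<and> leave \<omega> n \<in> {0<..<s})) +
      (\<Sum>k. of_bool (so_success \<omega> k \<and> so_time \<tau> k < s \<and> sat \<omega> (so_time \<tau> k))) +
      (\<Sum>k. of_bool (uso_success \<omega> k \<and> uso_time \<omega> k \<in> {0<..<s} \<inter> eligible \<and> sat \<omega> (uso_time \<omega> k))) \<partial>M)"
  proof (rule nn_integral_cong_AE, use AE_positive_lengths AE_usos_unbounded AE_no_tie in eventually_elim)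
    fix \<omega> assume pos: "positive_lengths \<omega>" and unb: "usos_unbounded \<omega>"
      and tie: "\<forall>n. enter \<omega> n + stay1 \<omega> n \<notin> epochs \<omega>"
    have fin: "(\<Sum>n. of_bool (a \<and> ?in \<omega> n t)) = (of_bool (a \<and> sat \<omega> t) :: ennreal)" for a t
      using suminf_in_stay1[OF pos, of t] by (cases a) auto
    have fp: "0 < leave \<omega> n" if "fails \<omega> n" for n
      using enter_nonneg[OF pos, of n] positive_lengthsD(2)[OF pos, of n] that by simp
    have "(\<Sum>n. of_bool (leave \<omega> n < s) :: ennreal) =
      (\<Sum>n. of_bool (fails \<omega> n \<and> leave \<omega> n \<in> {0<..<s}) + (\<Sum>k. of_bool (?so \<omega> k \<and> ?in \<omega> n (so_time \<tau> k))) +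
        (\<Sum>k. of_bool (?uso \<omega> k \<and> ?in \<omega> n (uso_time \<omega> k))))"
    proof (intro arg_cong[where f=suminf] ext)
      fix n
      have "fails \<omega> n \<and> leave \<omega> n < s \<longleftrightarrow> fails \<omega> n \<and> leave \<omega> n \<in> {0<..<s}"
        using fp[of n] by auto
      moreover have "(so_success \<omega> k \<and> so_time \<tau> k < s \<and> enter \<omega> n \<le> so_time \<tau> k \<and> so_time \<tau> k \<le> leave \<omega> n) \<longleftrightarrow>
        ?so \<omega> k \<and> ?in \<omega> n (so_time \<tau> k)" for k by auto
      moreover have "(uso_success \<omega> k \<and> uso_time \<omega> k < s \<and> tcut < remaining \<tau> (uso_time \<omega> k) \<and>
        enter \<omega> n \<le> uso_time \<omega> k \<and> uso_time \<omega> k \<le> leave \<omega> n) \<longleftrightarrow> ?uso \<omega> k \<and> ?in \<omega> n (uso_time \<omega> k)" for k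
        using uso_time_pos[OF pos, of k] by (auto simp: eligible_def)
      ultimately show "(of_bool (leave \<omega> n < s) :: ennreal) =
        of_bool (fails \<omega> n \<and> leave \<omega> n \<in> {0<..<s}) + (\<Sum>k. of_bool (?so \<omega> k \<and> ?in \<omega> n (so_time \<tau> k))) +
        (\<Sum>k. of_bool (?uso \<omega> k \<and> ?in \<omega> n (uso_time \<omega> k)))"
        using leave_less_decomposition[OF pos unb, of n s] tie by (simp only: simp_thms)
    qed
    also have "\<dots> = (\<Sum>n. of_bool (fails \<omega> n \<and> leave \<omega> n \<in> {0<..<s})) +
        (\<Sum>n. \<Sum>k. of_bool (?so \<omega> k \<and> ?in \<omega> n (so_time \<tau> k))) +
        (\<Sum>n. \<Sum>k. of_bool (?uso \<omega> k \<and> ?in \<omega> n (uso_time \<omega> k)))"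
      by (simp add: suminf_add)
    also have "(\<Sum>n. \<Sum>k. of_bool (?so \<omega> k \<and> ?in \<omega> n (so_time \<tau> k)) :: ennreal) =
        (\<Sum>k. of_bool (?so \<omega> k \<and> sat \<omega> (so_time \<tau> k)))"
      by (subst ennreal_suminf_commute) (simp only: fin)
    also have "(\<Sum>n. \<Sum>k. of_bool (?uso \<omega> k \<and> ?in \<omega> n (uso_time \<omega> k)) :: ennreal) =
        (\<Sum>k. of_bool (?uso \<omega> k \<and> sat \<omega> (uso_time \<omega> k)))"
      by (subst ennreal_suminf_commute) (simp only: fin)
    finally show "(\<Sum>n. of_bool (leave \<omega> n < s) :: ennreal) =
      (\<Sum>n. of_bool (fails \<omega> n \<and> leave \<omega> n \<in> {0<..<s})) +
      (\<Sum>k. of_bool (so_success \<omega> k \<and> so_time \<tau> k < s \<and> sat \<omega> (so_time \<tau> k))) +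
      (\<Sum>k. of_bool (uso_success \<omega> k \<and> uso_time \<omega> k \<in> {0<..<s} \<inter> eligible \<and> sat \<omega> (uso_time \<omega> k)))"
      by (simp only: conj_assoc)
  qed
  also have "\<dots> = (\<Sum>n. \<integral>\<^sup>+\<omega>. of_bool (fails \<omega> n \<and> leave \<omega> n \<in> {0<..<s}) \<partial>M) +
      (\<Sum>k. \<integral>\<^sup>+\<omega>. of_bool (so_success \<omega> k \<and> so_time \<tau> k < s \<and> sat \<omega> (so_time \<tau> k)) \<partial>M) +
      (\<Sum>k. \<integral>\<^sup>+\<omega>. of_bool (uso_success \<omega> k \<and> uso_time \<omega> k \<in> {0<..<s} \<inter> eligible \<and> sat \<omega> (uso_time \<omega> k)) \<partial>M)"
    by (simp add: nn_integral_add nn_integral_suminf)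
  also have "(\<Sum>n. \<integral>\<^sup>+\<omega>. of_bool (fails \<omega> n \<and> leave \<omega> n \<in> {0<..<s}) \<partial>M) = ennreal \<mu>1 * occupation {0<..<s}"
    by (simp only: expected_failures nn_integral_time_in_state occupation_def borel_open open_greaterThanLessThan)
  also have "(\<Sum>k. \<integral>\<^sup>+\<omega>. of_bool (uso_success \<omega> k \<and> uso_time \<omega> k \<in> {0<..<s} \<inter> eligible \<and> sat \<omega> (uso_time \<omega> k)) \<partial>M) =
    ennreal p * (ennreal lam * occupation ({0<..<s} \<inter> eligible))"
  proof -
    have b: "{0<..<s} \<inter> eligible \<in> sets borel" "{0<..<s} \<inter> eligible \<subseteq> {0<..}" by auto
    show ?thesis
      unfolding nn_integral_uso_success[OF b(1)] ennreal_suminf_cmult expected_usos_sat[OF b]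
        nn_integral_time_in_state(1)[OF b(1)] occupation_def ..
  qed
  finally show ?thesis unfolding nn_integral_so_success .
qed

text \<open>
  Path by path, the indicator of condition 1 at \<open>s\<close> plus the number of departures before \<open>s\<close> is the number of
  entrances up to \<open>s\<close>. The identity is written without subtraction, since both numbers are
  summed in \<open>[0, \<infinity>]\<close>.
\<close>

lemma balance:
  assumes "0 \<le> s"
  shows "esat_prob s + (ennreal \<mu>1 * occupation {0<..<s} +
      (\<Sum>k. ennreal p * (of_bool (so_time \<tau> k < s) * esat_prob (so_time \<tau> k))) +
      ennreal p * (ennreal lam * occupation ({0<..<s} \<inter> eligible))) =
    ennreal (pmf init Satisfactory) + ennreal \<mu>2 * (\<integral>\<^sup>+t. indicator {0<..s} t * (1 - esat_prob t) \<partial>lborel)"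
proof -
  have "esat_prob s + (\<Sum>n. \<integral>\<^sup>+\<omega>. of_bool (leave \<omega> n < s) \<partial>M) =
    (\<integral>\<^sup>+\<omega>. of_bool (sat \<omega> s) + (\<Sum>n. of_bool (leave \<omega> n < s)) \<partial>M)"
    unfolding esat_prob_def by (simp add: nn_integral_suminf nn_integral_add)
  also have "\<dots> = (\<integral>\<^sup>+\<omega>. of_bool (initial_cond \<omega> = Satisfactory) + (\<Sum>n. of_bool (enter \<omega> n \<in> {0<..s})) \<partial>M)"
  proof (rule nn_integral_cong_AE, use AE_positive_lengths in eventually_elim)
    fix \<omega> assume pos: "positive_lengths \<omega>"
    have "of_bool (sat \<omega> s) + (\<Sum>n. of_bool (leave \<omega> n < s)) =
        (\<Sum>n. of_bool (enter \<omega> n \<le> s \<and> s \<le> leave \<omega> n) + of_bool (leave \<omega> n < s) :: ennreal)"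
      by (subst suminf_add[symmetric]) (simp_all add: suminf_in_stay1[OF pos])
    \<comment> \<open>Each stay satisfies the balance separately, so no infinite sums are subtracted.\<close>
    also have "\<dots> = (\<Sum>n. of_bool (enter \<omega> n = 0) + of_bool (enter \<omega> n \<in> {0<..s}))"
    proof (intro arg_cong[where f=suminf] ext)
      fix n
      show "(of_bool (enter \<omega> n \<le> s \<and> s \<le> leave \<omega> n) + of_bool (leave \<omega> n < s) :: ennreal) =
        of_bool (enter \<omega> n = 0) + of_bool (enter \<omega> n \<in> {0<..s})"
        using enter_le_leave[OF pos, of n] enter_nonneg[OF pos, of n] assms by auto
    qed
    also have "\<dots> = (\<Sum>n. of_bool (enter \<omega> n = 0)) + (\<Sum>n. of_bool (enter \<omega> n \<in> {0<..s}))"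
      by (subst suminf_add[symmetric]) simp_all
    also have "(\<Sum>n. of_bool (enter \<omega> n = 0) :: ennreal) = of_bool (initial_cond \<omega> = Satisfactory)"
      unfolding enter_eq_0_iff[OF pos] by (subst suminf_of_bool_unique) auto
    finally show "of_bool (sat \<omega> s) + (\<Sum>n. of_bool (leave \<omega> n < s)) =
      (of_bool (initial_cond \<omega> = Satisfactory) + (\<Sum>n. of_bool (enter \<omega> n \<in> {0<..s})) :: ennreal)" .
  qed
  also have "\<dots> = (\<integral>\<^sup>+\<omega>. of_bool (initial_cond \<omega> = Satisfactory) \<partial>M) + (\<Sum>n. \<integral>\<^sup>+\<omega>. of_bool (enter \<omega> n \<in> {0<..s}) \<partial>M)"
    by (simp add: nn_integral_suminf nn_integral_add)
  finally have "esat_prob s + (\<Sum>n. \<integral>\<^sup>+\<omega>. of_bool (leave \<omega> n < s) \<partial>M) = \<dots>" .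
  moreover have "{0<..s} \<in> sets borel" by simp
  ultimately show ?thesis
    unfolding expected_leaves expected_entrances nn_integral_initial by (simp only: nn_integral_time_in_state(2))
qed

section \<open>The probability of condition 1 over a cycle\<close>

definition sat_prob :: "real \<Rightarrow> real" where
  "sat_prob s = found_prob \<mu>1 \<mu>2 lam \<tau> p tcut init s Satisfactory"

lemma esat_prob_eq: "esat_prob s = ennreal (sat_prob s)"
proof -
  have "esat_prob s = (\<integral>\<^sup>+\<omega>. indicator {\<omega> \<in> space M. sat \<omega> s} \<omega> \<partial>M)"
    unfolding esat_prob_def by (intro nn_integral_cong) (auto simp: indicator_def)
  also have "\<dots> = emeasure M {\<omega> \<in> space M. sat \<omega> s}" by (rule nn_integral_indicator) measurable
  finally show ?thesis by (simp add: sat_prob_def found_prob_def emeasure_eq_measure)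
qed

lemma sat_prob_bounds: "0 \<le> sat_prob s" "sat_prob s \<le> 1"
  by (simp_all add: sat_prob_def found_prob_def)

lemma measurable_sat_prob [measurable]: "sat_prob \<in> borel_measurable borel"
proof -
  have "sat_prob = (\<lambda>s. enn2real (esat_prob s))" by (simp add: esat_prob_eq sat_prob_bounds fun_eq_iff)
  then show ?thesis by simp
qed

lemma sat_prob_integrable: "sat_prob integrable_on {a..b}"
  by (rule bounded_integral[OF measurable_sat_prob sat_prob_bounds])

text \<open>
  The derivative of \<open>sat_prob\<close> between scheduled opportunities.
\<close>

definition rate :: "real \<Rightarrow> real" where
  "rate t = \<mu>2 - (\<mu>1 + \<mu>2 + lam * p * indicator eligible t) * sat_prob t"

lemma sat_prob_eligible_integrable: "(\<lambda>t. indicator eligible t * sat_prob t) integrable_on {a..b}"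
  by (rule bounded_integral[where C=1]) (use sat_prob_bounds in \<open>auto simp: indicator_def\<close>)

lemma rate_integrable: "rate integrable_on {a..b}"
proof -
  have "(\<lambda>t. \<mu>2 - (\<mu>1 + \<mu>2) * sat_prob t - lam * p * (indicator eligible t * sat_prob t)) integrable_on {a..b}"
    by (intro integrable_diff integrable_on_mult_right sat_prob_integrable sat_prob_eligible_integrable) auto
  then show ?thesis by (simp add: rate_def[abs_def] algebra_simps)
qed

lemma integral_rate:
  "integral {a..b} rate = \<mu>2 * integral {a..b} (\<lambda>t. 1 - sat_prob t) - \<mu>1 * integral {a..b} sat_prob
      - p * (lam * integral {a..b} (\<lambda>t. indicator eligible t * sat_prob t))"
proof -
  have "rate = (\<lambda>t. \<mu>2 * (1 - sat_prob t) - \<mu>1 * sat_prob t - p * (lam * (indicator eligible t * sat_prob t)))"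
    by (auto simp: rate_def algebra_simps)
  moreover have "(\<lambda>t. 1 - sat_prob t) integrable_on {a..b}"
    by (intro integrable_diff sat_prob_integrable) auto
  ultimately show ?thesis
    by (simp add: integral_diff integral_mult_right integrable_diff integrable_on_mult_right
      sat_prob_integrable sat_prob_eligible_integrable)
qed

lemma sat_prob_balance:
  assumes s: "0 \<le> s" and K: "\<And>k. so_time \<tau> k < s \<longleftrightarrow> k < K"
  shows "sat_prob s = pmf init Satisfactory + integral {0..s} rate - p * (\<Sum>k<K. sat_prob (so_time \<tau> k))"
proof -
  have oc: "occupation {0<..<s} = ennreal (integral {0..s} sat_prob)"
    unfolding occupation_def esat_prob_eq by (rule bounded_integral(2)[OF measurable_sat_prob sat_prob_bounds])
  have "occupation ({0<..<s} \<inter> eligible) = (\<integral>\<^sup>+t. indicator {0<..<s} t * ennreal (indicator eligible t * sat_prob t) \<partial>lborel)"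
    unfolding occupation_def esat_prob_eq by (intro nn_integral_cong) (auto simp: indicator_def)
  also have "\<dots> = ennreal (integral {0..s} (\<lambda>t. indicator eligible t * sat_prob t))"
    by (rule bounded_integral(2)[where C=1]) (use sat_prob_bounds in \<open>auto simp: indicator_def\<close>)
  finally have oe: "occupation ({0<..<s} \<inter> eligible) = ennreal (integral {0..s} (\<lambda>t. indicator eligible t * sat_prob t))" .
  have "(\<integral>\<^sup>+t. indicator {0<..s} t * (1 - esat_prob t) \<partial>lborel) = (\<integral>\<^sup>+t. indicator {0<..s} t * ennreal (1 - sat_prob t) \<partial>lborel)"
    unfolding esat_prob_eq by (intro nn_integral_cong) (simp add: ennreal_minus sat_prob_bounds flip: ennreal_1)
  also have "\<dots> = ennreal (integral {0..s} (\<lambda>t. 1 - sat_prob t))"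
    by (rule bounded_integral(3)[where C=1]) (use sat_prob_bounds in auto)
  finally have on: "(\<integral>\<^sup>+t. indicator {0<..s} t * (1 - esat_prob t) \<partial>lborel) = ennreal (integral {0..s} (\<lambda>t. 1 - sat_prob t))" .
  have "(\<Sum>k. ennreal p * (of_bool (so_time \<tau> k < s) * esat_prob (so_time \<tau> k))) =
      (\<Sum>k<K. ennreal p * (of_bool (so_time \<tau> k < s) * esat_prob (so_time \<tau> k)))"
    by (rule suminf_finite) (auto simp: K)
  also have "\<dots> = ennreal (p * (\<Sum>k<K. sat_prob (so_time \<tau> k)))"
    using p_pos sat_prob_bounds by (simp add: K esat_prob_eq sum_distrib_left ennreal_mult sum_nonneg flip: sum_ennreal)
  finally have os: "(\<Sum>k. ennreal p * (of_bool (so_time \<tau> k < s) * esat_prob (so_time \<tau> k))) = ennreal (p * (\<Sum>k<K. sat_prob (so_time \<tau> k)))" .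
  have nn: "0 \<le> integral {0..s} sat_prob" "0 \<le> integral {0..s} (\<lambda>t. indicator eligible t * sat_prob t)"
    "0 \<le> integral {0..s} (\<lambda>t. 1 - sat_prob t)" "0 \<le> (\<Sum>k<K. sat_prob (so_time \<tau> k))"
    using sat_prob_bounds by (auto intro!: integral_nonneg integrable_diff sat_prob_integrable sat_prob_eligible_integrable sum_nonneg)
  have "ennreal (sat_prob s + (\<mu>1 * integral {0..s} sat_prob + p * (\<Sum>k<K. sat_prob (so_time \<tau> k)) +
      p * (lam * integral {0..s} (\<lambda>t. indicator eligible t * sat_prob t)))) =
    ennreal (pmf init Satisfactory + \<mu>2 * integral {0..s} (\<lambda>t. 1 - sat_prob t))"
    using balance[OF s] nn \<mu>1_pos \<mu>2_pos lam_pos p_pos sat_prob_bounds[of s]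
    unfolding oc oe on os unfolding esat_prob_eq by (simp add: ennreal_mult)
  then have "sat_prob s + (\<mu>1 * integral {0..s} sat_prob + p * (\<Sum>k<K. sat_prob (so_time \<tau> k)) +
      p * (lam * integral {0..s} (\<lambda>t. indicator eligible t * sat_prob t))) =
    pmf init Satisfactory + \<mu>2 * integral {0..s} (\<lambda>t. 1 - sat_prob t)"
    using nn \<mu>1_pos \<mu>2_pos lam_pos p_pos sat_prob_bounds[of s] by (subst (asm) ennreal_inj) auto
  then show ?thesis by (simp add: integral_rate algebra_simps)
qed

text \<open>
  The probability of condition 1 at the beginning of the cycle from \<open>j * \<tau>\<close> to \<open>(j + 1) * \<tau>\<close>. Except at
  time 0 this is just after a scheduled opportunity, where condition 1 persists if it is found and the
  maintenance fails.
\<close>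

definition start_prob :: "nat \<Rightarrow> real" where
  "start_prob j = (case j of 0 \<Rightarrow> pmf init Satisfactory | Suc i \<Rightarrow> (1 - p) * sat_prob (so_time \<tau> i))"

text \<open>
  For \<open>j > 0\<close>, the difference of the balance equations at \<open>s\<close> and at the beginning of its cycle. The only scheduled
  opportunity that distinguishes them is the one at the beginning, which is responsible for the factor
  \<open>1 - p\<close> in \<open>start_prob\<close>.
\<close>

lemma sat_prob_cycle_integral:
  assumes s: "real j * \<tau> < s" "s \<le> real (Suc j) * \<tau>"
  shows "sat_prob s = start_prob j + integral {real j * \<tau>..s} rate"
proof -
  have s0: "0 \<le> s" using s \<tau>_pos by (meson less_imp_le mult_nonneg_nonneg of_nat_0_le_iff order_trans)
  have K: "so_time \<tau> k < s \<longleftrightarrow> k < j" for k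
  proof
    assume "so_time \<tau> k < s"
    then have "real (Suc k) * \<tau> < real (Suc j) * \<tau>" using s by (simp add: so_time_def)
    then show "k < j" using \<tau>_pos by simp
  next
    assume "k < j"
    then have "real (Suc k) * \<tau> \<le> real j * \<tau>" using \<tau>_pos by (intro mult_right_mono) auto
    then show "so_time \<tau> k < s" using s by (simp add: so_time_def)
  qed
  show ?thesis
  proof (cases j)
    case 0
    then show ?thesis using sat_prob_balance[OF s0 K] by (simp add: start_prob_def)
  next
    case (Suc i)
    let ?b = "real j * \<tau>"
    have b: "?b = so_time \<tau> i" "0 \<le> ?b" using Suc \<tau>_pos by (auto simp: so_time_def)
    have K': "so_time \<tau> k < ?b \<longleftrightarrow> k < i" for k
      unfolding b(1) using strict_mono_less[OF so_time_strict_mono] .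
    have "integral {0..?b} rate + integral {?b..s} rate = integral {0..s} rate"
      using b s rate_integrable by (intro Henstock_Kurzweil_Integration.integral_combine) auto
    then show ?thesis
      using sat_prob_balance[OF s0 K] sat_prob_balance[OF b(2) K'] Suc b(1)
      by (simp add: start_prob_def algebra_simps)
  qed
qed

lemma eligible_iff:
  assumes "real j * \<tau> < t" "t \<le> real (Suc j) * \<tau>"
  shows "t \<in> eligible \<longleftrightarrow> t < real (Suc j) * \<tau> - tcut"
proof -
  have "\<lceil>t / \<tau>\<rceil> = int (Suc j)"
    using assms \<tau>_pos by (intro ceiling_unique) (auto simp: field_simps)
  then show ?thesis by (auto simp: eligible_def remaining_def)
qed

lemma sat_prob_before_cutoff:
  assumes s: "real j * \<tau> < s" "s \<le> real (Suc j) * \<tau> - tcut"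
  shows "sat_prob s = \<mu>2 / (\<mu>1 + \<mu>2 + lam * p) + (start_prob j - \<mu>2 / (\<mu>1 + \<mu>2 + lam * p)) *
    exp (- (\<mu>1 + \<mu>2 + lam * p) * (s - real j * \<tau>))"
proof (rule linear_integral_equation[OF _ _ sat_prob_integrable _ s])
  show "real j * \<tau> < real (Suc j) * \<tau> - tcut" using s by simp
  show "\<mu>1 + \<mu>2 + lam * p \<noteq> 0" using \<mu>1_pos \<mu>2_pos lam_pos p_pos by (simp add: add_pos_pos less_imp_neq[symmetric])
  fix s assume s: "real j * \<tau> < s" "s \<le> real (Suc j) * \<tau> - tcut"
  have "integral {real j * \<tau>..s} rate = integral {real j * \<tau>..s} (\<lambda>t. \<mu>2 - (\<mu>1 + \<mu>2 + lam * p) * sat_prob t)"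
    using s tcut_pos eligible_iff[of j]
    by (intro integral_spike[where S="{real j * \<tau>, real (Suc j) * \<tau> - tcut}"]) (auto simp: rate_def)
  then show "sat_prob s = start_prob j + integral {real j * \<tau>..s} (\<lambda>t. \<mu>2 - (\<mu>1 + \<mu>2 + lam * p) * sat_prob t)"
    using sat_prob_cycle_integral[of j s] s tcut_pos by simp
qed

lemma sat_prob_after_cutoff:
  assumes s: "real (Suc j) * \<tau> - tcut < s" "s \<le> real (Suc j) * \<tau>"
  shows "sat_prob s = \<mu>2 / (\<mu>1 + \<mu>2) + (sat_prob (real (Suc j) * \<tau> - tcut) - \<mu>2 / (\<mu>1 + \<mu>2)) *
    exp (- (\<mu>1 + \<mu>2) * (s - (real (Suc j) * \<tau> - tcut)))"
proof (rule linear_integral_equation[OF _ _ sat_prob_integrable _ s])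
  let ?c = "real (Suc j) * \<tau> - tcut"
  show "?c < real (Suc j) * \<tau>" using tcut_pos by simp
  show "\<mu>1 + \<mu>2 \<noteq> 0" using \<mu>1_pos \<mu>2_pos by simp
  fix s assume s: "?c < s" "s \<le> real (Suc j) * \<tau>"
  have jc: "real j * \<tau> < ?c" using tcut_less by (simp add: algebra_simps)
  have "integral {?c..s} rate = integral {?c..s} (\<lambda>t. \<mu>2 - (\<mu>1 + \<mu>2) * sat_prob t)"
    using s jc eligible_iff[of j] by (intro integral_cong) (auto simp: rate_def)
  moreover have "integral {real j * \<tau>..?c} rate + integral {?c..s} rate = integral {real j * \<tau>..s} rate"
    using jc s rate_integrable by (intro Henstock_Kurzweil_Integration.integral_combine) auto
  ultimately show "sat_prob s = sat_prob ?c + integral {?c..s} (\<lambda>t. \<mu>2 - (\<mu>1 + \<mu>2) * sat_prob t)"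
    using sat_prob_cycle_integral[of j s] sat_prob_cycle_integral[of j ?c] s jc tcut_pos by simp
qed

end

section \<open>The stationary regime\<close>

text \<open>
  Solving the equation over one cycle sends the probability \<open>y\<close> of condition 1 at its beginning to
  \<open>cycle_gain + cycle_decay * y\<close> at its end.
\<close>

definition cycle_decay :: "real \<Rightarrow> real \<Rightarrow> real \<Rightarrow> real \<Rightarrow> real \<Rightarrow> real \<Rightarrow> real" where
  "cycle_decay \<mu>1 \<mu>2 lam \<tau> p tcut =
    exp (- (\<mu>1 + \<mu>2 + lam * p) * (\<tau> - tcut)) * exp (- (\<mu>1 + \<mu>2) * tcut)"

definition cycle_gain :: "real \<Rightarrow> real \<Rightarrow> real \<Rightarrow> real \<Rightarrow> real \<Rightarrow> real \<Rightarrow> real" where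
  "cycle_gain \<mu>1 \<mu>2 lam \<tau> p tcut =
    \<mu>2 / (\<mu>1 + \<mu>2) * (1 - exp (- (\<mu>1 + \<mu>2) * tcut)) +
    \<mu>2 / (\<mu>1 + \<mu>2 + lam * p) * (1 - exp (- (\<mu>1 + \<mu>2 + lam * p) * (\<tau> - tcut))) * exp (- (\<mu>1 + \<mu>2) * tcut)"

lemma cond_UNIV: "(UNIV :: cond set) = {Perfect, Satisfactory}"
  using cond.exhaust by blast

lemma pmf_Perfect: "pmf q Perfect = 1 - pmf q Satisfactory"
proof -
  have "set_pmf q \<subseteq> {Perfect, Satisfactory}" using cond_UNIV by auto
  then show ?thesis using sum_pmf_eq_1[of "{Perfect, Satisfactory}" q] by simp
qed

lemma cond_pmf_eq_iff: "q = q' \<longleftrightarrow> pmf q Satisfactory = pmf q' Satisfactory"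
proof
  assume *: "pmf q Satisfactory = pmf q' Satisfactory"
  show "q = q'"
  proof (rule pmf_eqI)
    fix c show "pmf q c = pmf q' c" using * by (cases c) (simp_all add: pmf_Perfect)
  qed
qed simp

lemma ex_cond_pmf:
  assumes "0 \<le> x" "x \<le> 1"
  shows "\<exists>q. pmf q Satisfactory = x"
proof
  let ?h = "\<lambda>b. if b then Satisfactory else Perfect"
  have "inj ?h" by (auto simp: inj_def)
  from pmf_map_inj'[OF this, of "bernoulli_pmf x" True]
  show "pmf (map_pmf ?h (bernoulli_pmf x)) Satisfactory = x" using assms by simp
qed

context maintenance_model
begin

abbreviation decay where "decay \<equiv> cycle_decay \<mu>1 \<mu>2 lam \<tau> p tcut"

abbreviation gain where "gain \<equiv> cycle_gain \<mu>1 \<mu>2 lam \<tau> p tcut"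

lemma rates_pos: "0 < \<mu>1 + \<mu>2" "0 < \<mu>1 + \<mu>2 + lam * p"
  using \<mu>1_pos \<mu>2_pos lam_pos p_pos by (simp_all add: add_pos_pos)

lemma decay_bounds: "0 < decay" "decay < 1"
proof -
  show "0 < decay" by (simp add: cycle_decay_def)
  have "- (\<mu>1 + \<mu>2 + lam * p) * (\<tau> - tcut) < 0" "- (\<mu>1 + \<mu>2) * tcut < 0"
    using rates_pos tcut_less tcut_pos by (simp_all only: mult_less_0_iff) auto
  then show "decay < 1"
    unfolding cycle_decay_def by (simp add: flip: exp_add)
qed

lemma sat_prob_so_time: "sat_prob (so_time \<tau> j) = gain + decay * start_prob j"
proof -
  define X where "X = exp (- (\<mu>1 + \<mu>2 + lam * p) * (\<tau> - tcut))"
  define Y where "Y = exp (- (\<mu>1 + \<mu>2) * tcut)"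
  define m1 where "m1 = \<mu>2 / (\<mu>1 + \<mu>2)"
  define m2 where "m2 = \<mu>2 / (\<mu>1 + \<mu>2 + lam * p)"
  have s: "so_time \<tau> j = real (Suc j) * \<tau>" by (simp add: so_time_def)
  have "real (Suc j) * \<tau> - tcut - real j * \<tau> = \<tau> - tcut" by (simp add: algebra_simps)
  then have "sat_prob (real (Suc j) * \<tau> - tcut) = m2 + (start_prob j - m2) * X"
    using sat_prob_before_cutoff[of j "real (Suc j) * \<tau> - tcut"] tcut_less
    unfolding X_def m2_def by simp
  moreover have "sat_prob (so_time \<tau> j) = m1 + (sat_prob (real (Suc j) * \<tau> - tcut) - m1) * Y"
    using sat_prob_after_cutoff[of j "so_time \<tau> j"] tcut_pos
    unfolding s Y_def m1_def by simp
  ultimately have "sat_prob (so_time \<tau> j) = m1 + (m2 + (start_prob j - m2) * X - m1) * Y" by simp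
  also have "\<dots> = (m1 * (1 - Y) + m2 * (1 - X) * Y) + X * Y * start_prob j"
    by (simp add: algebra_simps)
  finally show ?thesis
    unfolding cycle_decay_def cycle_gain_def X_def Y_def m1_def m2_def .
qed

text \<open>
  The fixed point of \<open>q \<mapsto> gain + decay * ((1 - p) * q)\<close>, the map from one scheduled opportunity to the next.
\<close>

definition stationary_prob :: real where
  "stationary_prob = gain / (1 - (1 - p) * decay)"

lemma stationary_denominator: "0 < 1 - (1 - p) * decay"
  using decay_bounds p_pos p_less_1 mult_strict_mono[of "1 - p" 1 decay 1] by simp

lemma stationary_prob_fixpoint: "q = gain + decay * ((1 - p) * q) \<longleftrightarrow> q = stationary_prob"
proof -
  have "x * (1 - y * d) = x - d * (y * x)" for x y d :: real
    by (simp add: algebra_simps)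
  then have "q * (1 - (1 - p) * decay) = q - decay * ((1 - p) * q)" .
  then have "q = gain + decay * ((1 - p) * q) \<longleftrightarrow> q * (1 - (1 - p) * decay) = gain"
    by linarith
  then show ?thesis
    unfolding stationary_prob_def
    by (simp only: nonzero_eq_divide_eq[OF less_imp_neq[OF stationary_denominator, symmetric]])
qed

lemma stationary_regime_iff_sat_prob:
  "stationary_regime \<mu>1 \<mu>2 lam \<tau> p tcut init \<longleftrightarrow> (\<forall>k. sat_prob (so_time \<tau> (Suc k)) = sat_prob (so_time \<tau> k))"
proof -
  have all: "(\<forall>c. Q c) \<longleftrightarrow> Q Perfect \<and> Q Satisfactory" for Q
    using cond.exhaust by metis
  have P: "found_prob \<mu>1 \<mu>2 lam \<tau> p tcut init s Perfect = 1 - sat_prob s" for s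
  proof -
    have "c = Perfect \<longleftrightarrow> c \<noteq> Satisfactory" for c
      by (cases c) simp_all
    then have "{\<omega> \<in> space M. cond_at \<tau> tcut \<omega> s = Perfect} = space M - {\<omega> \<in> space M. sat \<omega> s}"
      by auto
    moreover have "{\<omega> \<in> space M. sat \<omega> s} \<in> events" by measurable
    ultimately show ?thesis unfolding found_prob_def sat_prob_def by (simp only: prob_compl)
  qed
  show ?thesis
    unfolding stationary_regime_def all P sat_prob_def[symmetric] by simp
qed

text \<open>
  Equality at the first two opportunities already forces the fixed point; as \<open>decay\<close> is not zero, the
  initial law can be recovered from the probability found at the first opportunity.
\<close>

lemma stationary_regime_iff:
  "stationary_regime \<mu>1 \<mu>2 lam \<tau> p tcut init \<longleftrightarrow> pmf init Satisfactory = (1 - p) * stationary_prob"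
  unfolding stationary_regime_iff_sat_prob
proof
  assume "\<forall>k. sat_prob (so_time \<tau> (Suc k)) = sat_prob (so_time \<tau> k)"
  then have eq: "sat_prob (so_time \<tau> (Suc 0)) = sat_prob (so_time \<tau> 0)" by blast
  have "sat_prob (so_time \<tau> (Suc 0)) = gain + decay * ((1 - p) * sat_prob (so_time \<tau> 0))"
    by (subst sat_prob_so_time) (simp add: start_prob_def)
  then have q: "sat_prob (so_time \<tau> 0) = stationary_prob" using eq stationary_prob_fixpoint by metis
  have "sat_prob (so_time \<tau> 0) = gain + decay * pmf init Satisfactory"
    by (subst sat_prob_so_time) (simp add: start_prob_def)
  moreover have "stationary_prob = gain + decay * ((1 - p) * stationary_prob)"
    using stationary_prob_fixpoint by blast
  ultimately have "decay * pmf init Satisfactory = decay * ((1 - p) * stationary_prob)" using q by linarith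
  then show "pmf init Satisfactory = (1 - p) * stationary_prob" using decay_bounds(1) by simp
next
  assume i: "pmf init Satisfactory = (1 - p) * stationary_prob"
  have fp: "stationary_prob = gain + decay * ((1 - p) * stationary_prob)"
    using stationary_prob_fixpoint by blast
  have "sat_prob (so_time \<tau> k) = stationary_prob" for k
  proof (induction k)
    case 0
    show ?case using fp i by (subst sat_prob_so_time) (simp add: start_prob_def)
  next
    case (Suc k)
    then show ?case using fp by (subst sat_prob_so_time) (simp add: start_prob_def)
  qed
  then show "\<forall>k. sat_prob (so_time \<tau> (Suc k)) = sat_prob (so_time \<tau> k)" by simp
qed

text \<open>
  The expression is the probability of finding condition 1 at the first scheduled opportunity. With the two
  deterministic initial laws this bounds \<open>gain\<close> and \<open>gain + decay\<close>, which makes the stationary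
  initial probability a number in \<open>[0, 1]\<close>.
\<close>

lemma gain_bounds:
  "0 \<le> pmf init Satisfactory * decay + gain" "pmf init Satisfactory * decay + gain \<le> 1"
  using sat_prob_so_time[of 0] sat_prob_bounds[of "so_time \<tau> 0"] by (simp_all add: start_prob_def mult.commute)

text \<open>
  The two solved pieces, read backwards from the next scheduled opportunity. \<open>C1\<close> comes from
  continuity at \<open>tcut\<close>, and \<open>C2\<close> from the requirement that the probability \<open>q\<close> found at the end of the cycle be the one
  found just before its beginning.
\<close>

lemma stationary_formula:
  assumes st: "stationary_regime \<mu>1 \<mu>2 lam \<tau> p tcut init"
  shows "tcut \<le> t \<Longrightarrow> t < \<tau> \<Longrightarrow> sat_prob (so_time \<tau> (Suc k) - t) =
      \<mu>2 / (\<mu>1 + \<mu>2 + lam * p) + C2 \<mu>1 \<mu>2 lam \<tau> p tcut * exp ((\<mu>1 + \<mu>2 + lam * p) * t)" (is "_ \<Longrightarrow> _ \<Longrightarrow> ?A t")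
    and "0 \<le> t \<Longrightarrow> t < tcut \<Longrightarrow> sat_prob (so_time \<tau> (Suc k) - t) =
      \<mu>2 / (\<mu>1 + \<mu>2) + C1 \<mu>1 \<mu>2 lam \<tau> p tcut * exp ((\<mu>1 + \<mu>2) * t)" (is "_ \<Longrightarrow> _ \<Longrightarrow> ?B t")
proof -
  define c1 where "c1 = \<mu>1 + \<mu>2"
  define c2 where "c2 = c1 + lam * p"
  have c: "0 < c1" "0 < c2" using rates_pos by (simp_all add: c1_def c2_def)
  define q where "q = sat_prob (so_time \<tau> k)"
  have q: "sat_prob (so_time \<tau> (Suc k)) = q" using st by (simp add: q_def stationary_regime_iff_sat_prob)
  have start: "start_prob (Suc k) = (1 - p) * q" by (simp add: start_prob_def q_def)
  have so: "so_time \<tau> (Suc k) = real (Suc (Suc k)) * \<tau>" by (simp add: so_time_def)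
  define D2 where "D2 = ((1 - p) * q - \<mu>2 / c2) * exp (- c2 * \<tau>)"
  have one: "sat_prob (so_time \<tau> (Suc k) - t) = \<mu>2 / c2 + D2 * exp (c2 * t)" if "tcut \<le> t" "t < \<tau>" for t
  proof -
    have "exp (- c2 * (so_time \<tau> (Suc k) - t - real (Suc k) * \<tau>)) = exp (- c2 * \<tau>) * exp (c2 * t)"
      by (simp add: so algebra_simps flip: exp_add)
    then show ?thesis
      using sat_prob_before_cutoff[of "Suc k" "so_time \<tau> (Suc k) - t"] that
      by (simp add: so start D2_def c1_def[symmetric] c2_def[symmetric] algebra_simps)
  qed
  define D1 where "D1 = (\<mu>2 / c2 + D2 * exp (c2 * tcut) - \<mu>2 / c1) * exp (- c1 * tcut)"
  have two: "sat_prob (so_time \<tau> (Suc k) - t) = \<mu>2 / c1 + D1 * exp (c1 * t)" if "t < tcut" "0 \<le> t" for t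
  proof -
    have "exp (- c1 * (so_time \<tau> (Suc k) - t - (so_time \<tau> (Suc k) - tcut))) = exp (- c1 * tcut) * exp (c1 * t)"
      by (simp add: algebra_simps flip: exp_add)
    then have "sat_prob (so_time \<tau> (Suc k) - t) = \<mu>2 / c1 + (sat_prob (so_time \<tau> (Suc k) - tcut) - \<mu>2 / c1) *
        (exp (- c1 * tcut) * exp (c1 * t))"
      using sat_prob_after_cutoff[of "Suc k" "so_time \<tau> (Suc k) - t"] that
      unfolding so c1_def[symmetric] by simp
    then show ?thesis using one[of tcut] tcut_less by (simp add: D1_def mult.assoc)
  qed
  define e where "e = exp (- c1 * tcut)"
  define L where "L = exp (lam * p * tcut)"
  define E where "E = exp (c2 * \<tau>)"
  have L: "exp (c2 * tcut) * e = L"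
    by (simp add: e_def L_def c2_def algebra_simps flip: exp_add)
  have D1: "D1 = D2 * L - \<mu>2 / c1 * (lam * p / c2) * e"
  proof -
    have K: "\<mu>2 / c1 * (lam * p / c2) = \<mu>2 / c1 - \<mu>2 / c2"
      using c by (simp add: c2_def field_simps)
    have "(b + D2 * x - a) * e = D2 * (x * e) - K * e" if "K = a - b" for a b x K
      unfolding that by (simp add: algebra_simps)
    from this[OF K] show ?thesis unfolding D1_def L[symmetric] e_def[symmetric] .
  qed
  \<comment> \<open>Stationarity: \<open>q\<close> is both the value at the end of the cycle and the one that starts it.\<close>
  have "D2 * (1 / (1 - p) * E) = D2 * E / (1 - p)" by simp
  also have "D2 * E = (1 - p) * q - \<mu>2 / c2"
    by (simp add: D2_def E_def mult.assoc flip: exp_add)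
  also have "\<dots> / (1 - p) = q - \<mu>2 / c2 * (1 / (1 - p))"
    using p_less_1 by (simp add: diff_divide_distrib)
  also have "q = \<mu>2 / c1 + D1" using two[of 0] q tcut_pos by simp
  finally have "D2 * (1 / (1 - p) * E) =
      \<mu>2 / c1 + (D2 * L - \<mu>2 / c1 * (lam * p / c2) * e) - \<mu>2 / c2 * (1 / (1 - p))"
    unfolding D1 .
  moreover have "\<mu>2 / c1 * (1 - e) - \<mu>2 / c2 * (1 / (1 - p) - e) =
      \<mu>2 / c1 - \<mu>2 / c1 * (lam * p / c2) * e - \<mu>2 / c2 * (1 / (1 - p))"
  proof -
    have K: "\<mu>2 / c1 * (lam * p / c2) = \<mu>2 / c1 - \<mu>2 / c2"
      using c by (simp add: c2_def field_simps)
    have "a * (1 - e) - b * (r - e) = a - K * e - b * r" if "K = a - b" for a b r K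
      unfolding that by (simp add: algebra_simps)
    from this[OF K] show ?thesis .
  qed
  ultimately have num: "D2 * (1 / (1 - p) * E - L) = \<mu>2 / c1 * (1 - e) - \<mu>2 / c2 * (1 / (1 - p) - e)"
    by (simp add: algebra_simps)
  have "lam * p * tcut \<le> lam * p * \<tau>" using lam_pos p_pos tcut_less by simp
  then have "lam * p * tcut < c2 * \<tau>" using c(1) \<tau>_pos by (simp add: c2_def algebra_simps add_strict_increasing)
  then have "L < E" by (simp add: L_def E_def)
  moreover have "E \<le> 1 / (1 - p) * E" using p_pos p_less_1 by (simp add: E_def field_simps)
  ultimately have den: "1 / (1 - p) * E - L \<noteq> 0" by simp
  have C2: "C2 \<mu>1 \<mu>2 lam \<tau> p tcut = D2"
    unfolding C2_def c1_def[symmetric] c2_def[symmetric] e_def[symmetric] E_def[symmetric] L_def[symmetric]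
      num[symmetric] using den by simp
  have C1: "C1 \<mu>1 \<mu>2 lam \<tau> p tcut = D1"
    unfolding C1_def C2 D1 c1_def[symmetric] c2_def[symmetric] e_def[symmetric] L_def[symmetric] ..
  show "tcut \<le> t \<Longrightarrow> t < \<tau> \<Longrightarrow> ?A t"
    using one[of t] unfolding C2 c1_def[symmetric] c2_def[symmetric] .
  show "0 \<le> t \<Longrightarrow> t < tcut \<Longrightarrow> ?B t"
    using two[of t] unfolding C1 c1_def[symmetric] by blast
qed

section \<open>The expected cost of a cycle\<close>

lemma expected_num_pm_so:
  "has_bochner_integral M (\<lambda>\<omega>. real (num_pm_so \<tau> tcut (so_time \<tau> k) (so_time \<tau> (Suc k)) \<omega>)) (sat_prob (so_time \<tau> k))"
proof -
  have "{j. so_time \<tau> j \<in> {so_time \<tau> k..<so_time \<tau> (Suc k)} \<and> sat \<omega> (so_time \<tau> j)} = (if sat \<omega> (so_time \<tau> k) then {k} else {})" for \<omega>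
    using strict_mono_less_eq[OF so_time_strict_mono] strict_mono_less[OF so_time_strict_mono]
    by (auto simp: less_Suc_eq)
  then have "num_pm_so \<tau> tcut (so_time \<tau> k) (so_time \<tau> (Suc k)) \<omega> = card (if sat \<omega> (so_time \<tau> k) then {k} else {})" for \<omega>
    by (simp only: num_pm_so_def)
  then have "(\<lambda>\<omega>. real (num_pm_so \<tau> tcut (so_time \<tau> k) (so_time \<tau> (Suc k)) \<omega>)) = indicator {\<omega> \<in> space M. sat \<omega> (so_time \<tau> k)}"
    by (auto simp: fun_eq_iff indicator_def)
  moreover have "has_bochner_integral M (indicator {\<omega> \<in> space M. sat \<omega> (so_time \<tau> k)} :: _ \<Rightarrow> real) (sat_prob (so_time \<tau> k))"
    unfolding sat_prob_def found_prob_def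
  proof (rule has_bochner_integral_real_indicator)
    show "{\<omega> \<in> space M. sat \<omega> (so_time \<tau> k)} \<in> events" by measurable
  qed (simp add: less_top[symmetric])
  ultimately show ?thesis by simp
qed

lemma expected_num_cm:
  "has_bochner_integral M (\<lambda>\<omega>. real (num_cm \<tau> tcut a b \<omega>)) (\<mu>1 * integral {a..b} sat_prob)"
  unfolding num_cm_def
proof (rule expected_count)
  have oc: "occupation {a..<b} = ennreal (integral {a..b} sat_prob)"
    unfolding occupation_def esat_prob_eq by (rule bounded_integral(4)[OF measurable_sat_prob sat_prob_bounds])
  have B: "{a..<b} \<in> sets borel" by simp
  show "(\<Sum>n. \<integral>\<^sup>+\<omega>. of_bool (fails \<omega> n \<and> leave \<omega> n \<in> {a..<b}) \<partial>M) = ennreal (\<mu>1 * integral {a..b} sat_prob)"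
    unfolding expected_failures[OF B] nn_integral_time_in_state(1)[OF B] occupation_def[symmetric] oc
    using \<mu>1_pos sat_prob_bounds sat_prob_integrable by (simp add: ennreal_mult integral_nonneg)
  show "0 \<le> \<mu>1 * integral {a..b} sat_prob" using \<mu>1_pos sat_prob_bounds sat_prob_integrable by (simp add: integral_nonneg)
qed measurable

lemma expected_num_pm_uso:
  "has_bochner_integral M (\<lambda>\<omega>. real (num_pm_uso \<tau> tcut (so_time \<tau> k) (so_time \<tau> (Suc k)) \<omega>))
    (lam * integral {so_time \<tau> k..so_time \<tau> (Suc k) - tcut} sat_prob)"
proof -
  let ?a = "so_time \<tau> k" and ?b = "so_time \<tau> (Suc k)"
  have ab: "?a = real (Suc k) * \<tau>" "?b = real (Suc (Suc k)) * \<tau>" by (simp_all add: so_time_def)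
  have lt: "0 < ?a" "?a < ?b - tcut" using \<tau>_pos tcut_less by (simp_all add: ab algebra_simps add_pos_nonneg)
  have el: "t \<in> eligible \<longleftrightarrow> t < ?b - tcut" if "?a < t" "t \<le> ?b" for t
    using eligible_iff[of "Suc k" t] that by (simp add: ab)
  have "integral {?a..?b} (\<lambda>t. indicator eligible t * sat_prob t) =
      integral {?a..?b - tcut} (\<lambda>t. indicator eligible t * sat_prob t) + integral {?b - tcut..?b} (\<lambda>t. indicator eligible t * sat_prob t)"
    using lt tcut_pos sat_prob_eligible_integrable by (intro Henstock_Kurzweil_Integration.integral_combine[symmetric]) auto
  also have "integral {?a..?b - tcut} (\<lambda>t. indicator eligible t * sat_prob t) = integral {?a..?b - tcut} sat_prob"
    using lt tcut_pos by (intro integral_spike[where S="{?a, ?b - tcut}"]) (auto simp: el)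
  also have "integral {?b - tcut..?b} (\<lambda>t. indicator eligible t * sat_prob t) = integral {?b - tcut..?b} (\<lambda>t. 0)"
    using lt tcut_pos by (intro integral_cong) (auto simp: el)
  finally have int: "integral {?a..?b} (\<lambda>t. indicator eligible t * sat_prob t) = integral {?a..?b - tcut} sat_prob" by simp
  have "occupation ({?a..<?b} \<inter> eligible) = (\<integral>\<^sup>+t. indicator {?a..<?b} t * ennreal (indicator eligible t * sat_prob t) \<partial>lborel)"
    unfolding occupation_def esat_prob_eq by (intro nn_integral_cong) (auto simp: indicator_def)
  also have "\<dots> = ennreal (integral {?a..?b} (\<lambda>t. indicator eligible t * sat_prob t))"
    by (rule bounded_integral(4)[where C=1]) (use sat_prob_bounds in \<open>auto simp: indicator_def\<close>)
  finally have oc: "occupation ({?a..<?b} \<inter> eligible) = ennreal (integral {?a..?b - tcut} sat_prob)" using int by simp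
  have B: "{?a..<?b} \<inter> eligible \<in> sets borel" "{?a..<?b} \<inter> eligible \<subseteq> {0<..}" using lt by auto
  have eq: "num_pm_uso \<tau> tcut ?a ?b \<omega> = card {k. uso_time \<omega> k \<in> {?a..<?b} \<inter> eligible \<and> sat \<omega> (uso_time \<omega> k)}" for \<omega>
    unfolding num_pm_uso_def by (intro arg_cong[where f=card]) (auto simp: eligible_def)
  show ?thesis unfolding eq
  proof (rule expected_count)
    show "(\<Sum>k. \<integral>\<^sup>+\<omega>. of_bool (uso_time \<omega> k \<in> {?a..<?b} \<inter> eligible \<and> sat \<omega> (uso_time \<omega> k)) \<partial>M) =
        ennreal (lam * integral {?a..?b - tcut} sat_prob)"
      unfolding expected_usos_sat[OF B] nn_integral_time_in_state(1)[OF B(1)] occupation_def[symmetric] oc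
      using lam_pos sat_prob_bounds sat_prob_integrable by (simp add: ennreal_mult integral_nonneg)
    show "0 \<le> lam * integral {?a..?b - tcut} sat_prob" using lam_pos sat_prob_bounds sat_prob_integrable by (simp add: integral_nonneg)
  qed measurable
qed

lemma expected_cycle_cost:
  "has_bochner_integral M (cycle_cost c_so c_uso c_cm \<tau> tcut k)
    (c_so * sat_prob (so_time \<tau> k) + c_uso * lam * integral {tcut..\<tau>} (\<lambda>t. sat_prob (so_time \<tau> (Suc k) - t))
      + c_cm * \<mu>1 * integral {0..\<tau>} (\<lambda>t. sat_prob (so_time \<tau> (Suc k) - t)))"
proof -
  have "so_time \<tau> (Suc k) - \<tau> = so_time \<tau> k" by (simp add: so_time_def algebra_simps)
  then have "integral {tcut..\<tau>} (\<lambda>t. sat_prob (so_time \<tau> (Suc k) - t)) = integral {so_time \<tau> k..so_time \<tau> (Suc k) - tcut} sat_prob"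
    "integral {0..\<tau>} (\<lambda>t. sat_prob (so_time \<tau> (Suc k) - t)) = integral {so_time \<tau> k..so_time \<tau> (Suc k)} sat_prob"
    by (simp_all add: integral_reflect_shift sat_prob_integrable)
  then show ?thesis
    using has_bochner_integral_add[OF has_bochner_integral_add[OF
        has_bochner_integral_mult_right[OF expected_num_pm_so[of k], of c_so]
        has_bochner_integral_mult_right[OF expected_num_pm_uso[of k], of c_uso]]
        has_bochner_integral_mult_right[OF expected_num_cm[of "so_time \<tau> k" "so_time \<tau> (Suc k)"], of c_cm]]
    unfolding cycle_cost_def[abs_def] by (simp add: mult.assoc)
qed

end

theorem theorem3:
  fixes \<mu>1 \<mu>2 lam \<tau> p tcut c_so c_uso c_cm :: real
  assumes "0 < \<mu>1" "0 < \<mu>2" "0 < lam" "0 < \<tau>"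
    and "0 < p" "p < 1"
    and "0 < tcut" "tcut < \<tau>"
    and "0 < c_so" "c_so < c_cm"
    and "0 < c_uso" "c_uso < c_cm"
  shows "(\<exists>!init. stationary_regime \<mu>1 \<mu>2 lam \<tau> p tcut init) \<and>
    (\<forall>init k. stationary_regime \<mu>1 \<mu>2 lam \<tau> p tcut init \<longrightarrow>
      (let M = model \<mu>1 \<mu>2 lam p init;
           p1 = (\<lambda>t. found_prob \<mu>1 \<mu>2 lam \<tau> p tcut init (so_time \<tau> (Suc k) - t) Satisfactory);
           cost = cycle_cost c_so c_uso c_cm \<tau> tcut k
       in integrable M cost \<and>
          (\<integral>\<omega>. cost \<omega> \<partial>M) / \<tau> =
            (c_so * p1 0 + c_uso * lam * integral {tcut..\<tau>} p1
              + c_cm * \<mu>1 * integral {0..\<tau>} p1) / \<tau> \<and>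
          (\<forall>t\<in>{0..<tcut}. p1 t =
             \<mu>2 / (\<mu>1 + \<mu>2) + C1 \<mu>1 \<mu>2 lam \<tau> p tcut * exp ((\<mu>1 + \<mu>2) * t)) \<and>
          (\<forall>t\<in>{tcut..<\<tau>}. p1 t =
             \<mu>2 / (\<mu>1 + \<mu>2 + lam * p)
               + C2 \<mu>1 \<mu>2 lam \<tau> p tcut * exp ((\<mu>1 + \<mu>2 + lam * p) * t))))"
proof (intro conjI allI impI)
  have model: "maintenance_model \<tau> tcut \<mu>1 \<mu>2 lam p"
    using assms by unfold_locales
  let ?d = "cycle_decay \<mu>1 \<mu>2 lam \<tau> p tcut" and ?g = "cycle_gain \<mu>1 \<mu>2 lam \<tau> p tcut"
  let ?q = "?g / (1 - (1 - p) * ?d)"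
  note st = maintenance_model.stationary_regime_iff[OF model, unfolded maintenance_model.stationary_prob_def[OF model]]
  have d: "0 < ?d" "?d < 1" "0 < 1 - (1 - p) * ?d"
    using maintenance_model.decay_bounds[OF model] maintenance_model.stationary_denominator[OF model] by auto
  \<comment> \<open>A system started surely in condition 2, respectively 1, yields the two bounds.\<close>
  have g: "0 \<le> ?g" "?d + ?g \<le> 1"
    using maintenance_model.gain_bounds[OF model, of "return_pmf Perfect"]
      maintenance_model.gain_bounds[OF model, of "return_pmf Satisfactory"] by auto
  have "0 \<le> ?q" using g d by simp
  moreover have "(1 - p) * ?q \<le> 1"
  proof -
    have "(1 - p) * (?g + ?d) \<le> 1 * 1" using g d assms by (intro mult_mono) auto
    then show ?thesis using d by (simp add: field_simps)
  qed
  moreover have "0 \<le> 1 - p" using assms by simp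
  ultimately obtain init where "pmf init Satisfactory = (1 - p) * ?q"
    using ex_cond_pmf[of "(1 - p) * ?q"] mult_nonneg_nonneg[of "1 - p" ?q] by blast
  then show "\<exists>!init. stationary_regime \<mu>1 \<mu>2 lam \<tau> p tcut init"
    unfolding st by (metis cond_pmf_eq_iff)
next
  fix init k
  assume stat: "stationary_regime \<mu>1 \<mu>2 lam \<tau> p tcut init"
  interpret maintenance_model \<tau> tcut \<mu>1 \<mu>2 lam p init
    using assms by unfold_locales
  have "sat_prob (so_time \<tau> (Suc k)) = sat_prob (so_time \<tau> k)"
    using stat by (simp add: stationary_regime_iff_sat_prob)
  then show "let M = model \<mu>1 \<mu>2 lam p init;
           p1 = (\<lambda>t. found_prob \<mu>1 \<mu>2 lam \<tau> p tcut init (so_time \<tau> (Suc k) - t) Satisfactory);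
           cost = cycle_cost c_so c_uso c_cm \<tau> tcut k
       in integrable M cost \<and>
          (\<integral>\<omega>. cost \<omega> \<partial>M) / \<tau> =
            (c_so * p1 0 + c_uso * lam * integral {tcut..\<tau>} p1
              + c_cm * \<mu>1 * integral {0..\<tau>} p1) / \<tau> \<and>
          (\<forall>t\<in>{0..<tcut}. p1 t =
             \<mu>2 / (\<mu>1 + \<mu>2) + C1 \<mu>1 \<mu>2 lam \<tau> p tcut * exp ((\<mu>1 + \<mu>2) * t)) \<and>
          (\<forall>t\<in>{tcut..<\<tau>}. p1 t =
             \<mu>2 / (\<mu>1 + \<mu>2 + lam * p)
               + C2 \<mu>1 \<mu>2 lam \<tau> p tcut * exp ((\<mu>1 + \<mu>2 + lam * p) * t))"
    using expected_cycle_cost[of c_so c_uso c_cm k] stationary_formula[OF stat, of _ k]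
    unfolding Let_def sat_prob_def[symmetric] by (auto simp: has_bochner_integral_iff)
qed

end
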